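(* Let $A$ be a finite abelian group. If $\mathcal G_1$ is a surface group and $1\to A\to\Gamma\to\mathcal G_1\to1$ is a central extension, then there is a finite index subgroup $H<\mathcal G_1$ with $[\mathcal G_1:H]\le e(A)$ such that the induced extension of $H$ by $A$ is trivial. Moreover, we can take $H\unlhd\mathcal G_1$ with $\mathcal G_1/H$ cyclic.
   Context: A surface group is the fundamental group of a closed orientable surface of genus at least $2$. $e(A)$ is the exponent of $A$. The induced extension of a subgroup $H$ is the restriction $1\to A\to\phi^{-1}(H)\to H\to1$, where $\phi:\Gamma\to\mathcal G_1$ is the given surjection. A central extension is trivial if it is isomorphic, as an extension, to the product extension $1\to A\to A\times H\to H\to1$. *)

theory Defs
  imports "HOL-Analysis.Analysis" "HOL-Algebra.Elementary_Groups"
begin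

section \<open>The fundamental group\<close>

definition loops :: "'s::topological_space set \<Rightarrow> 's \<Rightarrow> (real \<Rightarrow> 's) set" where
  "loops S x = {p. path p \<and> path_image p \<subseteq> S \<and> pathstart p = x \<and> pathfinish p = x}"

definition path_class :: "'s::topological_space set \<Rightarrow> (real \<Rightarrow> 's) \<Rightarrow> (real \<Rightarrow> 's) set" where
  "path_class S p = {q. homotopic_paths S p q}"

text \<open>
  The product of two classes is the class of \<open>p +++ q\<close> for any representatives; by
  \<open>homotopic_paths_join\<close> all the sets in the union below coincide, see
  \<open>fundamental_group_mult\<close>.
\<close>

definition fundamental_group :: "'s::topological_space set \<Rightarrow> 's \<Rightarrow> (real \<Rightarrow> 's) set monoid" where
  "fundamental_group S x =
    \<lparr>carrier = path_class S ` loops S x,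
     monoid.mult = (\<lambda>P Q. \<Union>p\<in>P. \<Union>q\<in>Q. path_class S (p +++ q)),
     one = path_class S (\<lambda>_. x)\<rparr>"

lemma path_class_eq_iff:
  assumes "p \<in> loops S x"
  shows "path_class S p = path_class S q \<longleftrightarrow> homotopic_paths S p q"
proof
  assume eq: "path_class S p = path_class S q"
  have "p \<in> path_class S p"
    using assms by (simp add: path_class_def loops_def)
  then show "homotopic_paths S p q"
    unfolding eq by (simp add: path_class_def homotopic_paths_sym)
next
  assume "homotopic_paths S p q"
  then show "path_class S p = path_class S q"
    unfolding path_class_def by (blast intro: homotopic_paths_sym homotopic_paths_trans)
qed

lemma loops_join: "p \<in> loops S x \<Longrightarrow> q \<in> loops S x \<Longrightarrow> p +++ q \<in> loops S x"
  by (auto simp: loops_def path_image_join)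

lemma fundamental_group_mult:
  assumes "p \<in> loops S x" "q \<in> loops S x"
  shows "path_class S p \<otimes>\<^bsub>fundamental_group S x\<^esub> path_class S q = path_class S (p +++ q)"
proof -
  have eq: "path_class S (p' +++ q') = path_class S (p +++ q)"
    if "p' \<in> path_class S p" "q' \<in> path_class S q" for p' q'
  proof -
    have "homotopic_paths S (p +++ q) (p' +++ q')"
      using that assms by (intro homotopic_paths_join) (simp_all add: path_class_def loops_def)
    then have "path_class S (p +++ q) = path_class S (p' +++ q')"
      by (simp only: path_class_eq_iff[OF loops_join[OF assms]])
    then show ?thesis
      by (rule sym)
  qed
  have "p \<in> path_class S p" "q \<in> path_class S q"
    using assms by (simp_all add: path_class_def loops_def)
  then have "(\<Union>p'\<in>path_class S p. \<Union>q'\<in>path_class S q. path_class S (p' +++ q')) = path_class S (p +++ q)"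
    using eq by blast
  then show ?thesis
    by (simp add: fundamental_group_def)
qed

lemma const_loop: "x \<in> S \<Longrightarrow> (\<lambda>_. x) \<in> loops S x"
  by (auto simp: loops_def path_def path_image_def pathstart_def pathfinish_def)

lemma homotopic_paths_const_join:
  assumes "p \<in> loops S x"
  shows "homotopic_paths S ((\<lambda>_. x) +++ p) p"
proof (rule homotopic_paths_sym)
  let ?f = "\<lambda>t::real. max 0 (2 * t - 1)"
  show "homotopic_paths S p ((\<lambda>_. x) +++ p)"
  proof (rule homotopic_paths_reparametrize[where f = ?f])
    show "path p" "path_image p \<subseteq> S"
      using assms by (auto simp: loops_def)
    show "continuous_on {0..1} ?f"
      by (intro continuous_intros)
    show "?f \<in> {0..1} \<rightarrow> {0..1}" "?f 0 = 0" "?f 1 = 1"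
      by auto
    show "((\<lambda>_. x) +++ p) t = p (?f t)" for t
      using assms by (auto simp: joinpaths_def loops_def pathstart_def)
  qed
qed

lemma homotopic_paths_reversepath_join:
  assumes "p \<in> loops S x"
  shows "homotopic_paths S (reversepath p +++ p) (\<lambda>_. x)"
proof -
  have p: "continuous_on {0..1} p" "p 0 = x" "p 1 = x" "p ` {0..1} \<subseteq> S"
    using assms by (auto simp: loops_def path_def path_image_def pathstart_def pathfinish_def)
  let ?h = "\<lambda>y. p (max (1 - fst y) \<bar>1 - 2 * snd y\<bar>)"
  have f: "max (1 - s) \<bar>1 - 2 * t\<bar> \<in> {0..1}" if "s \<in> {0..1}" "t \<in> {0..1}" for s t :: real
    using that by (simp add: abs_le_iff)
  have "homotopic_paths S (\<lambda>_. x) (reversepath p +++ p)"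
    unfolding homotopic_paths
  proof (intro exI[of _ ?h] conjI ballI)
    show "continuous_on ({0..1} \<times> {0..1}) ?h"
      by (rule continuous_on_compose2[OF p(1)]) (intro continuous_intros, use f in force)
    show "?h \<in> {0..1} \<times> {0..1} \<rightarrow> S"
      using f p(4) by force
  next
    fix t :: real assume t: "t \<in> {0..1}"
    have "max (1 - 0) \<bar>1 - 2 * t\<bar> = 1"
      using f[of 0 t] t by simp
    then show "?h (0, t) = x"
      using p(3) by simp
    show "?h (1, t) = (reversepath p +++ p) t"
      by (simp add: joinpaths_def reversepath_def)
    have "max (1 - t) 1 = 1"
      using t by simp
    then show "pathstart (?h \<circ> Pair t) = pathstart (\<lambda>_. x)"
        "pathfinish (?h \<circ> Pair t) = pathfinish (\<lambda>_. x)"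
      using p(3) by (simp_all add: pathstart_def pathfinish_def)
  qed
  then show ?thesis
    by (rule homotopic_paths_sym)
qed

lemma group_fundamental_group:
  assumes x: "x \<in> S"
  shows "group (fundamental_group S x)"
proof -
  let ?G = "fundamental_group S x"
  have carrier: "carrier ?G = path_class S ` loops S x"
    and one: "\<one>\<^bsub>?G\<^esub> = path_class S (\<lambda>_. x)"
    by (simp_all add: fundamental_group_def)
  show ?thesis
  proof (rule groupI)
    fix P Q assume "P \<in> carrier ?G" "Q \<in> carrier ?G"
    then show "P \<otimes>\<^bsub>?G\<^esub> Q \<in> carrier ?G"
      by (auto simp: carrier fundamental_group_mult intro!: loops_join)
  next
    show "\<one>\<^bsub>?G\<^esub> \<in> carrier ?G"
      using const_loop[OF x] by (simp add: carrier one)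
  next
    fix P Q R assume "P \<in> carrier ?G" "Q \<in> carrier ?G" "R \<in> carrier ?G"
    then obtain p q r where pqr: "p \<in> loops S x" "q \<in> loops S x" "r \<in> loops S x"
      and eq: "P = path_class S p" "Q = path_class S q" "R = path_class S r"
      by (auto simp: carrier)
    have "homotopic_paths S (p +++ (q +++ r)) ((p +++ q) +++ r)"
      using pqr by (intro homotopic_paths_assoc) (auto simp: loops_def)
    then have "path_class S (p +++ (q +++ r)) = path_class S ((p +++ q) +++ r)"
      by (rule iffD2[OF path_class_eq_iff[OF loops_join[OF pqr(1) loops_join[OF pqr(2,3)]]]])
    then show "P \<otimes>\<^bsub>?G\<^esub> Q \<otimes>\<^bsub>?G\<^esub> R = P \<otimes>\<^bsub>?G\<^esub> (Q \<otimes>\<^bsub>?G\<^esub> R)"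
      by (simp add: eq fundamental_group_mult loops_join pqr)
  next
    fix P assume "P \<in> carrier ?G"
    then obtain p where p: "p \<in> loops S x" "P = path_class S p"
      by (auto simp: carrier)
    have "path_class S ((\<lambda>_. x) +++ p) = path_class S p"
      by (rule iffD2[OF path_class_eq_iff[OF loops_join[OF const_loop[OF x] p(1)]]])
         (rule homotopic_paths_const_join[OF p(1)])
    then show "\<one>\<^bsub>?G\<^esub> \<otimes>\<^bsub>?G\<^esub> P = P"
      by (simp add: one p fundamental_group_mult const_loop[OF x])
    have r: "reversepath p \<in> loops S x"
      using p(1) by (auto simp: loops_def)
    have "path_class S (reversepath p +++ p) = path_class S (\<lambda>_. x)"
      by (rule iffD2[OF path_class_eq_iff[OF loops_join[OF r p(1)]]])
         (rule homotopic_paths_reversepath_join[OF p(1)])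
    then have "path_class S (reversepath p) \<otimes>\<^bsub>?G\<^esub> P = \<one>\<^bsub>?G\<^esub>"
      by (simp add: one p fundamental_group_mult r)
    then show "\<exists>Q\<in>carrier ?G. Q \<otimes>\<^bsub>?G\<^esub> P = \<one>\<^bsub>?G\<^esub>"
      by (rule bexI) (simp add: carrier r)
  qed
qed

section \<open>Closed orientable surfaces\<close>

text \<open>
  The closed orientable surface of genus \<open>g \<ge> 1\<close> is obtained from a polygon with \<open>4 g\<close> sides,
  realised as the closed unit disc with its boundary circle divided into \<open>4 g\<close> equal arcs, by
  gluing the sides in pairs according to the boundary word
  \<open>a\<^sub>1 b\<^sub>1 a\<^sub>1\<inverse> b\<^sub>1\<inverse> \<dots> a\<^sub>g b\<^sub>g a\<^sub>g\<inverse> b\<^sub>g\<inverse>\<close>: side \<open>4 i + j\<close> is glued, with reversed direction, to side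
  \<open>4 i + j + 2\<close> for \<open>j = 0, 1\<close>.
\<close>

definition polygon_side :: "nat \<Rightarrow> nat \<Rightarrow> real \<Rightarrow> complex" where
  "polygon_side g k t = cis (2 * pi * (real k + t) / real (4 * g))"

definition side_gluing :: "nat \<Rightarrow> complex \<Rightarrow> complex \<Rightarrow> bool" where
  "side_gluing g z w \<longleftrightarrow>
    (\<exists>i<g. \<exists>j\<in>{0,1}. \<exists>t\<in>{0..1}.
      z = polygon_side g (4 * i + j) t \<and> w = polygon_side g (4 * i + j + 2) (1 - t))"

text \<open>
  A space is homeomorphic to the glued polygon iff it receives a quotient map from the disc whose
  fibres are the classes of the equivalence relation generated by the gluing.
\<close>

definition closed_orientable_surface :: "nat \<Rightarrow> 's::topological_space set \<Rightarrow> bool" where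
  "closed_orientable_surface g S \<longleftrightarrow>
    g \<ge> 1 \<and>
    (\<exists>q. quotient_map (top_of_set (cball 0 1)) (top_of_set S) q \<and>
         (\<forall>z\<in>cball 0 1. \<forall>w\<in>cball 0 1. q z = q w \<longleftrightarrow> equivclp (side_gluing g) z w))"

section \<open>Group extensions\<close>

text \<open>
  \<open>A\<close>, \<open>E\<close>, \<open>Q\<close> have different carrier types, so \<open>short_exact_sequence\<close> from \<open>HOL-Algebra\<close>,
  which puts all groups on one type, cannot be used for \<open>1 \<rightarrow> A \<rightarrow> E \<rightarrow> Q \<rightarrow> 1\<close>.
\<close>

definition group_exponent :: "('a, 'm) monoid_scheme \<Rightarrow> nat" where
  "group_exponent A = (LEAST n. 0 < n \<and> (\<forall>a\<in>carrier A. a [^]\<^bsub>A\<^esub> n = \<one>\<^bsub>A\<^esub>))"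

definition group_extension ::
    "'a monoid \<Rightarrow> 'e monoid \<Rightarrow> 'q monoid \<Rightarrow> ('a \<Rightarrow> 'e) \<Rightarrow> ('e \<Rightarrow> 'q) \<Rightarrow> bool" where
  "group_extension A E Q \<iota> \<phi> \<longleftrightarrow>
    group A \<and> group E \<and> group Q \<and> \<iota> \<in> mon A E \<and> \<phi> \<in> epi E Q \<and>
    \<iota> ` carrier A = kernel E Q \<phi>"

definition central_extension ::
    "'a monoid \<Rightarrow> 'e monoid \<Rightarrow> 'q monoid \<Rightarrow> ('a \<Rightarrow> 'e) \<Rightarrow> ('e \<Rightarrow> 'q) \<Rightarrow> bool" where
  "central_extension A E Q \<iota> \<phi> \<longleftrightarrow>
    group_extension A E Q \<iota> \<phi> \<and>
    (\<forall>a\<in>carrier A. \<forall>x\<in>carrier E. \<iota> a \<otimes>\<^bsub>E\<^esub> x = x \<otimes>\<^bsub>E\<^esub> \<iota> a)"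

definition isomorphic_extensions ::
    "'a monoid \<Rightarrow> 'q monoid \<Rightarrow> 'e monoid \<Rightarrow> ('a \<Rightarrow> 'e) \<Rightarrow> ('e \<Rightarrow> 'q) \<Rightarrow>
      'f monoid \<Rightarrow> ('a \<Rightarrow> 'f) \<Rightarrow> ('f \<Rightarrow> 'q) \<Rightarrow> bool" where
  "isomorphic_extensions A Q E \<iota> \<phi> F \<iota>' \<phi>' \<longleftrightarrow>
    (\<exists>\<theta>\<in>iso E F. (\<forall>a\<in>carrier A. \<theta> (\<iota> a) = \<iota>' a) \<and> (\<forall>x\<in>carrier E. \<phi>' (\<theta> x) = \<phi> x))"

definition trivial_extension ::
    "'a monoid \<Rightarrow> 'e monoid \<Rightarrow> 'q monoid \<Rightarrow> ('a \<Rightarrow> 'e) \<Rightarrow> ('e \<Rightarrow> 'q) \<Rightarrow> bool" where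
  "trivial_extension A E Q \<iota> \<phi> \<longleftrightarrow>
    isomorphic_extensions A Q E \<iota> \<phi> (A \<times>\<times> Q) (\<lambda>a. (a, \<one>\<^bsub>Q\<^esub>)) snd"

text \<open>
  The middle group \<open>\<phi>\<^sup>-\<^sup>1(H)\<close> of the extension induced on a subgroup \<open>H\<close> of the quotient; the
  maps of the induced extension are \<open>\<iota>\<close> and \<open>\<phi>\<close> themselves.
\<close>

definition induced_extension_group :: "'e monoid \<Rightarrow> ('e \<Rightarrow> 'q) \<Rightarrow> 'q set \<Rightarrow> 'e monoid" where
  "induced_extension_group E \<phi> H = E\<lparr>carrier := {x \<in> carrier E. \<phi> x \<in> H}\<rparr>"

end

theory Submission
  imports Defs "HOL-Algebra.Multiplicative_Group"
begin

text \<open>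
  The surface is the quotient of the rectangle of polar coordinates \<open>[0, 1] \<times> [0, 4 g]\<close>. It has three
  open charts, each of which contracts along the images of straight segments: the open disc, the
  neighbourhoods of the open sides, and the neighbourhood of the vertex. Elements
  of a group \<open>K\<close> attached to the sides and vertices and satisfying the surface relation define a
  Cech cocycle for this cover, and its holonomy is a homomorphism from the fundamental group to \<open>K\<close>.
  This is the existence half of the presentation of the surface group. The
  fundamental group itself carries tautological side elements whose holonomy is the identity, and so
  a lift of these data to \<open>\<Gamma>\<close> satisfying the surface relation yields a section of \<open>\<Gamma> \<rightarrow> G\<close>.

  For a central extension, the surface word in arbitrary lifts is an element \<open>c\<close> of \<open>A\<close>, the obstruction
  to a section. Let \<open>X, Y : G \<rightarrow> \<int>\<close> be dual to the first two generators, and change the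
  multiplication of \<open>\<Gamma>\<close> to \<open>a * b = a b c\<^sup>X\<^sup>(\<^sup>a\<^sup>)\<^sup>Y\<^sup>(\<^sup>b\<^sup>)\<close>. The twisted commutator of the first two generators
  acquires the factor \<open>c\<^sup>-\<^sup>1\<close>, so the obstruction vanishes and the twisted extension has a section.
  Where \<open>X\<close> is divisible by the exponent of \<open>A\<close> the twist disappears; hence the
  section is a homomorphism into \<open>\<Gamma>\<close> on \<open>H = X\<^sup>-\<^sup>1(e(A) \<int>)\<close>.
\<close>

section \<open>Holonomy of a group-valued cocycle\<close>

locale group_cocycle = K: group K
  for K :: "('k, 'm) monoid_scheme" (structure) +
  fixes S :: "'s::topological_space set" and U :: "'i \<Rightarrow> 's set" and f :: "'i \<Rightarrow> 's \<Rightarrow> 'k"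
  assumes cover: "x \<in> S \<Longrightarrow> \<exists>i. x \<in> U i"
    and openin_U: "openin (top_of_set S) (U i)"
    and f_closed: "x \<in> U i \<Longrightarrow> f i x \<in> carrier K"
    and transition: "x \<in> U i \<Longrightarrow> x \<in> U j \<Longrightarrow>
      \<exists>N. openin (top_of_set S) N \<and> x \<in> N \<and>
        (\<forall>y\<in>N. y \<in> U i \<longrightarrow> y \<in> U j \<longrightarrow> f i y \<otimes> inv (f j y) = f i x \<otimes> inv (f j x))"
begin

text \<open>
  The cocycle \<open>f\<^sub>i f\<^sub>j\<inverse>\<close> defines a covering of \<open>S\<close> with fibre \<open>K\<close>; \<open>F\<close> is the fibre coordinate of a
  continuous lift of \<open>h\<close>. The sections \<open>f\<^sub>i\<close> themselves need not be continuous.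
\<close>

definition horizontal :: "'c::topological_space set \<Rightarrow> ('c \<Rightarrow> 's) \<Rightarrow> ('c \<Rightarrow> 'k) \<Rightarrow> bool" where
  "horizontal C h F \<longleftrightarrow> F \<in> C \<rightarrow> carrier K \<and>
    (\<forall>x\<in>C. \<forall>i. h x \<in> U i \<longrightarrow>
      (\<exists>N. open N \<and> x \<in> N \<and>
        (\<forall>y. y \<in> N \<longrightarrow> y \<in> C \<longrightarrow> h y \<in> U i \<longrightarrow> F y \<otimes> inv (f i (h y)) = F x \<otimes> inv (f i (h x)))))"

lemma horizontal_closed: "horizontal C h F \<Longrightarrow> x \<in> C \<Longrightarrow> F x \<in> carrier K"
  by (auto simp: horizontal_def)

lemma horizontalD:
  assumes "horizontal C h F" "x \<in> C" "h x \<in> U i"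
  obtains N where "open N" "x \<in> N"
    "\<And>y. y \<in> N \<Longrightarrow> y \<in> C \<Longrightarrow> h y \<in> U i \<Longrightarrow> F y \<otimes> inv (f i (h y)) = F x \<otimes> inv (f i (h x))"
  using assms unfolding horizontal_def by blast

lemma horizontalI:
  assumes "\<And>x. x \<in> C \<Longrightarrow> F x \<in> carrier K"
    and "\<And>x i. x \<in> C \<Longrightarrow> h x \<in> U i \<Longrightarrow> \<exists>N. open N \<and> x \<in> N \<and>
        (\<forall>y. y \<in> N \<longrightarrow> y \<in> C \<longrightarrow> h y \<in> U i \<longrightarrow> F y \<otimes> inv (f i (h y)) = F x \<otimes> inv (f i (h x)))"
  shows "horizontal C h F"
  unfolding horizontal_def by (intro conjI funcsetI ballI allI impI) (rule assms; assumption)+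

lemma horizontal_empty: "horizontal {} h F"
  by (auto simp: horizontal_def)

lemma horizontal_compose:
  assumes F: "horizontal C h F" and u: "continuous_on D u" "u ` D \<subseteq> C"
  shows "horizontal D (h \<circ> u) (F \<circ> u)"
proof (rule horizontalI)
  fix x assume "x \<in> D"
  then show "(F \<circ> u) x \<in> carrier K"
    using F u by (auto intro: horizontal_closed)
next
  fix x i assume x: "x \<in> D" "(h \<circ> u) x \<in> U i"
  then obtain N where N: "open N" "u x \<in> N"
    "\<And>y. y \<in> N \<Longrightarrow> y \<in> C \<Longrightarrow> h y \<in> U i \<Longrightarrow> F y \<otimes> inv (f i (h y)) = F (u x) \<otimes> inv (f i (h (u x)))"
    using horizontalD[OF F, of "u x" i] u by auto
  obtain A where A: "open A" "x \<in> A" "\<forall>y\<in>D. y \<in> A \<longrightarrow> u y \<in> N"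
    using u(1) x(1) N(1,2) unfolding continuous_on_topological by metis
  show "\<exists>N. open N \<and> x \<in> N \<and> (\<forall>y. y \<in> N \<longrightarrow> y \<in> D \<longrightarrow> (h \<circ> u) y \<in> U i \<longrightarrow>
      (F \<circ> u) y \<otimes> inv f i ((h \<circ> u) y) = (F \<circ> u) x \<otimes> inv f i ((h \<circ> u) x))"
    using A N u(2) by (intro exI[of _ A]) (auto intro!: N(3))
qed

lemma horizontal_mult:
  assumes F: "horizontal C h F" and k: "k \<in> carrier K" and h: "h ` C \<subseteq> S"
  shows "horizontal C h (\<lambda>x. k \<otimes> F x)"
proof (rule horizontalI)
  fix x assume "x \<in> C"
  then show "k \<otimes> F x \<in> carrier K"
    using F k by (auto intro: horizontal_closed)
next
  fix x i assume x: "x \<in> C" "h x \<in> U i"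
  obtain N where N: "open N" "x \<in> N"
    "\<And>y. y \<in> N \<Longrightarrow> y \<in> C \<Longrightarrow> h y \<in> U i \<Longrightarrow> F y \<otimes> inv (f i (h y)) = F x \<otimes> inv (f i (h x))"
    using horizontalD[OF F x] by blast
  have "k \<otimes> F y \<otimes> inv (f i (h y)) = k \<otimes> F x \<otimes> inv (f i (h x))"
    if "y \<in> N" "y \<in> C" "h y \<in> U i" for y
    using that N(3)[OF that] x k horizontal_closed[OF F] f_closed by (simp add: K.m_assoc)
  then show "\<exists>N. open N \<and> x \<in> N \<and> (\<forall>y. y \<in> N \<longrightarrow> y \<in> C \<longrightarrow> h y \<in> U i \<longrightarrow>
      k \<otimes> F y \<otimes> inv f i (h y) = k \<otimes> F x \<otimes> inv f i (h x))"
    using N by blast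
qed

lemma horizontal_cong:
  assumes "horizontal C h F" "\<And>x. x \<in> C \<Longrightarrow> F x = F' x" "\<And>x. x \<in> C \<Longrightarrow> h x = h' x"
  shows "horizontal C h' F'"
proof (rule horizontalI)
  fix x i assume x: "x \<in> C" "h' x \<in> U i"
  then obtain N where "open N" "x \<in> N"
    "\<And>y. y \<in> N \<Longrightarrow> y \<in> C \<Longrightarrow> h y \<in> U i \<Longrightarrow> F y \<otimes> inv (f i (h y)) = F x \<otimes> inv (f i (h x))"
    using horizontalD[OF assms(1), of x i] assms(3) by metis
  then show "\<exists>N. open N \<and> x \<in> N \<and> (\<forall>y. y \<in> N \<longrightarrow> y \<in> C \<longrightarrow> h' y \<in> U i \<longrightarrow>
      F' y \<otimes> inv f i (h' y) = F' x \<otimes> inv f i (h' x))"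
    using assms(2,3) x(1) by (intro exI[of _ N]) metis
qed (use assms horizontal_closed[OF assms(1)] in metis)

lemma horizontal_unique:
  assumes C: "connected C" and h: "continuous_on C h" "h ` C \<subseteq> S"
    and F: "horizontal C h F" and F': "horizontal C h F'" and xy: "x \<in> C" "y \<in> C"
  shows "F' x \<otimes> inv (F x) = F' y \<otimes> inv (F y)"
proof -
  let ?c = "\<lambda>x. F' x \<otimes> inv (F x)"
  have "?c constant_on C"
  proof (rule locally_constant_imp_constant[OF C])
    fix a assume a: "a \<in> C"
    then obtain i where i: "h a \<in> U i"
      using h(2) cover by blast
    obtain N where N: "open N" "a \<in> N"
      "\<And>y. y \<in> N \<Longrightarrow> y \<in> C \<Longrightarrow> h y \<in> U i \<Longrightarrow> F y \<otimes> inv (f i (h y)) = F a \<otimes> inv (f i (h a))"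
      using horizontalD[OF F a i] by blast
    obtain N' where N': "open N'" "a \<in> N'"
      "\<And>y. y \<in> N' \<Longrightarrow> y \<in> C \<Longrightarrow> h y \<in> U i \<Longrightarrow> F' y \<otimes> inv (f i (h y)) = F' a \<otimes> inv (f i (h a))"
      using horizontalD[OF F' a i] by blast
    have o: "openin (top_of_set C) (C \<inter> h -` U i)"
      using h openin_U by (metis continuous_openin_preimage image_subset_iff_funcset)
    show "\<exists>T. openin (top_of_set C) T \<and> a \<in> T \<and> (\<forall>x\<in>T. ?c x = ?c a)"
    proof (intro exI conjI ballI)
      show "openin (top_of_set C) ((C \<inter> h -` U i) \<inter> (C \<inter> N) \<inter> (C \<inter> N'))"
        by (intro openin_Int o openin_open_Int N(1) N'(1))
      show "a \<in> (C \<inter> h -` U i) \<inter> (C \<inter> N) \<inter> (C \<inter> N')"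
        using a i N N' by auto
      fix y assume "y \<in> (C \<inter> h -` U i) \<inter> (C \<inter> N) \<inter> (C \<inter> N')"
      then have y: "y \<in> C" "h y \<in> U i" "y \<in> N" "y \<in> N'"
        by auto
      have split: "?c z = (F' z \<otimes> inv (f i (h z))) \<otimes> inv (F z \<otimes> inv (f i (h z)))"
        if "z \<in> C" "h z \<in> U i" for z
        using horizontal_closed[OF F that(1)] horizontal_closed[OF F' that(1)] f_closed[OF that(2)]
        by (simp add: K.inv_mult_group K.m_assoc K.inv_solve_left' flip: K.m_assoc[of "inv (f i (h z))"])
      show "?c y = ?c a"
        using N(3)[OF y(3,1,2)] N'(3)[OF y(4,1,2)] split[OF y(1,2)] split[OF a i] by simp
    qed
  qed
  then show ?thesis
    using xy by (auto simp: constant_on_def)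
qed

lemma horizontal_difference:
  assumes "connected C" "continuous_on C h" "h ` C \<subseteq> S"
    and F: "horizontal C h F" and F': "horizontal C h F'" and xy: "x \<in> C" "y \<in> C"
  shows "inv (F' x) \<otimes> F' y = inv (F x) \<otimes> F y"
proof -
  have c: "F x \<in> carrier K" "F y \<in> carrier K" "F' x \<in> carrier K" "F' y \<in> carrier K"
    using horizontal_closed[OF F] horizontal_closed[OF F'] xy by auto
  have "F' y = F' x \<otimes> inv (F x) \<otimes> F y"
    using horizontal_unique[OF assms] c by (metis K.inv_closed K.inv_solve_right K.m_closed)
  then show ?thesis
    using c by (simp add: K.m_assoc[symmetric])
qed

lemma horizontal_local:
  assumes h: "continuous_on C h" "h ` C \<subseteq> U i"
  shows "horizontal C h (f i \<circ> h)"
proof (rule horizontalI)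
  fix x j assume x: "x \<in> C" "h x \<in> U j"
  have xi: "h x \<in> U i"
    using x h by auto
  obtain N where N: "openin (top_of_set S) N" "h x \<in> N"
    "\<forall>y\<in>N. y \<in> U i \<longrightarrow> y \<in> U j \<longrightarrow> f i y \<otimes> inv (f j y) = f i (h x) \<otimes> inv (f j (h x))"
    using transition[OF xi x(2)] by blast
  obtain M where M: "open M" "N = S \<inter> M"
    using N(1) by (auto simp: openin_open)
  obtain A where A: "open A" "x \<in> A" "\<forall>y\<in>C. y \<in> A \<longrightarrow> h y \<in> M"
    using h(1) x(1) M N(2) unfolding continuous_on_topological by (metis IntE)
  have "h y \<in> N" if "y \<in> A" "y \<in> C" for y
    using that A M h(2) openin_imp_subset[OF openin_U[of i]] by blast
  then show "\<exists>N. open N \<and> x \<in> N \<and> (\<forall>y. y \<in> N \<longrightarrow> y \<in> C \<longrightarrow> h y \<in> U j \<longrightarrow>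
      (f i \<circ> h) y \<otimes> inv f j (h y) = (f i \<circ> h) x \<otimes> inv f j (h x))"
    using A N(3) h(2) by (intro exI[of _ A]) auto
qed (use h f_closed in auto)

lemma horizontal_glue:
  assumes h: "continuous_on (C1 \<union> C2) h" "h ` (C1 \<union> C2) \<subseteq> S"
    and closed: "closed C1" "closed C2" and conn: "connected (C1 \<inter> C2)"
    and F1: "horizontal C1 h F1" and F2: "horizontal C2 h F2"
  shows "\<exists>F. horizontal (C1 \<union> C2) h F"
proof -
  have "\<exists>F2'. horizontal C2 h F2' \<and> (\<forall>x\<in>C1 \<inter> C2. F1 x = F2' x)"
  proof (cases "C1 \<inter> C2 = {}")
    case True
    then show ?thesis
      using F2 by auto
  next
    case False
    then obtain b where b: "b \<in> C1" "b \<in> C2"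
      by blast
    define k where "k = F1 b \<otimes> inv (F2 b)"
    have k: "k \<in> carrier K"
      using b horizontal_closed[OF F1] horizontal_closed[OF F2] by (simp add: k_def)
    have "F1 x = k \<otimes> F2 x" if x: "x \<in> C1 \<inter> C2" for x
    proof -
      have "horizontal (C1 \<inter> C2) h F1" "horizontal (C1 \<inter> C2) h F2"
        using horizontal_compose[OF F1, of "C1 \<inter> C2" id] horizontal_compose[OF F2, of "C1 \<inter> C2" id]
        by (auto simp: continuous_on_id)
      moreover have "continuous_on (C1 \<inter> C2) h" "h ` (C1 \<inter> C2) \<subseteq> S"
        using h by (auto intro: continuous_on_subset)
      ultimately have "F1 x \<otimes> inv (F2 x) = k"
        unfolding k_def using horizontal_unique[OF conn _ _ _ _ x] b by blast
      then show ?thesis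
        using x horizontal_closed[OF F1] horizontal_closed[OF F2] k by (auto simp: K.m_assoc)
    qed
    then show ?thesis
      using horizontal_mult[OF F2 k] h by (intro exI[of _ "\<lambda>x. k \<otimes> F2 x"]) auto
  qed
  then obtain F2' where F2': "horizontal C2 h F2'" and eq: "\<And>x. x \<in> C1 \<Longrightarrow> x \<in> C2 \<Longrightarrow> F1 x = F2' x"
    by auto
  let ?F = "\<lambda>x. if x \<in> C1 then F1 x else F2' x"
  have 1: "horizontal C1 h ?F"
    using F1 by (rule horizontal_cong) auto
  have 2: "horizontal C2 h ?F"
    using F2' by (rule horizontal_cong) (auto simp: eq)
  have loc: "\<exists>N. open N \<and> x \<in> N \<and> (\<forall>y. y \<in> N \<longrightarrow> y \<in> C \<longrightarrow> h y \<in> U i \<longrightarrow>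
      ?F y \<otimes> inv f i (h y) = ?F x \<otimes> inv f i (h x))"
    if "closed C" "horizontal C h ?F" "h x \<in> U i" for C x i
  proof (cases "x \<in> C")
    case True
    then show ?thesis
      using horizontalD[OF that(2) _ that(3)] by metis
  next
    case False
    then show ?thesis
      using that(1) by (intro exI[of _ "- C"]) auto
  qed
  have "horizontal (C1 \<union> C2) h ?F"
  proof (rule horizontalI)
    fix x assume "x \<in> C1 \<union> C2"
    then show "?F x \<in> carrier K"
      using horizontal_closed[OF 1, of x] horizontal_closed[OF 2, of x] by blast
  next
    fix x i assume x: "x \<in> C1 \<union> C2" "h x \<in> U i"
    obtain N1 where N1: "open N1" "x \<in> N1" "\<And>y. y \<in> N1 \<Longrightarrow> y \<in> C1 \<Longrightarrow> h y \<in> U i \<Longrightarrow>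
      ?F y \<otimes> inv f i (h y) = ?F x \<otimes> inv f i (h x)"
      using loc[OF closed(1) 1 x(2)] by blast
    obtain N2 where N2: "open N2" "x \<in> N2" "\<And>y. y \<in> N2 \<Longrightarrow> y \<in> C2 \<Longrightarrow> h y \<in> U i \<Longrightarrow>
      ?F y \<otimes> inv f i (h y) = ?F x \<otimes> inv f i (h x)"
      using loc[OF closed(2) 2 x(2)] by blast
    show "\<exists>N. open N \<and> x \<in> N \<and> (\<forall>y. y \<in> N \<longrightarrow> y \<in> C1 \<union> C2 \<longrightarrow> h y \<in> U i \<longrightarrow>
      ?F y \<otimes> inv f i (h y) = ?F x \<otimes> inv f i (h x))"
      by (intro exI[of _ "N1 \<inter> N2"] conjI allI impI)
        (use N1 N2 in blast)+
  qed
  then show ?thesis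
    by blast
qed

lemma horizontal_square_exists:
  fixes h :: "real \<times> real \<Rightarrow> 's"
  assumes h: "continuous_on ({0..1} \<times> {0..1}) h" "h ` ({0..1} \<times> {0..1}) \<subseteq> S"
  shows "\<exists>F. horizontal ({0..1} \<times> {0..1}) h F"
proof -
  let ?Q = "{0..1::real} \<times> {0..1::real}"
  have "\<exists>V. open V \<and> ?Q \<inter> h -` U i = ?Q \<inter> V" for i
  proof -
    have "h \<in> ?Q \<rightarrow> S"
      using h(2) by (simp only: image_subset_iff_funcset)
    from continuous_openin_preimage[OF h(1) this openin_U, of i] show ?thesis
      by (auto simp only: openin_open)
  qed
  then have "\<forall>i. \<exists>V. open V \<and> ?Q \<inter> h -` U i = ?Q \<inter> V"
    by (rule allI)
  from choice[OF this] have "\<exists>V. \<forall>i. open (V i) \<and> ?Q \<inter> h -` U i = ?Q \<inter> V i" .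
  then obtain V where V: "\<And>i. open (V i)" "\<And>i. ?Q \<inter> h -` U i = ?Q \<inter> V i"
    by blast
  have "compact ?Q"
    by (intro compact_Times) auto
  moreover have "?Q \<subseteq> \<Union> (range V)"
  proof
    fix z assume z: "z \<in> ?Q"
    then obtain i where "h z \<in> U i"
      using h(2) cover by blast
    then show "z \<in> \<Union> (range V)"
      using z V(2)[of i] by blast
  qed
  ultimately have "\<exists>e>0. \<forall>z\<in>?Q. \<exists>G\<in>range V. ball z e \<subseteq> G"
    by (rule Heine_Borel_lemma) (use V(1) in auto)
  then obtain e where e: "e > 0" "\<And>z. z \<in> ?Q \<Longrightarrow> \<exists>i. ball z e \<subseteq> V i"
    by (metis rangeE)
  have small: "\<exists>F. horizontal (({a..b} \<times> {c..d}) \<inter> ?Q) h F"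
    if "b - a < e / 2" "d - c < e / 2" for a b c d
  proof (cases "({a..b} \<times> {c..d}) \<inter> ?Q = {}")
    case True
    then show ?thesis
      using horizontal_empty by metis
  next
    case False
    then obtain x y where xy: "(x, y) \<in> ?Q" "x \<in> {a..b}" "y \<in> {c..d}"
      by blast
    obtain i where i: "ball (x, y) e \<subseteq> V i"
      using e(2)[OF xy(1)] by blast
    have "({a..b} \<times> {c..d}) \<inter> ?Q \<subseteq> ball (x, y) e"
    proof (clarify)
      fix x' y' assume "x' \<in> {a..b}" "y' \<in> {c..d}"
      then have "\<bar>x - x'\<bar> < e / 2" "\<bar>y - y'\<bar> < e / 2"
        using that xy(2,3) by (auto simp: abs_less_iff simp del: less_divide_eq_numeral1)
      moreover have "dist (x, y) (x', y') \<le> \<bar>x - x'\<bar> + \<bar>y - y'\<bar>"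
        unfolding dist_Pair_Pair by (metis dist_real_def sqrt_sum_squares_le_sum_abs abs_abs)
      ultimately show "(x', y') \<in> ball (x, y) e"
        by auto
    qed
    then have "h ` (({a..b} \<times> {c..d}) \<inter> ?Q) \<subseteq> U i"
      using i V(2)[of i] by blast
    moreover have "continuous_on (({a..b} \<times> {c..d}) \<inter> ?Q) h"
      using h(1) by (rule continuous_on_subset) auto
    ultimately show ?thesis
      using horizontal_local by blast
  qed
  have glue: "\<exists>F. horizontal (A \<inter> ?Q \<union> B \<inter> ?Q) h F"
    if "closed A" "closed B" "convex (A \<inter> B)"
      "\<exists>F. horizontal (A \<inter> ?Q) h F" "\<exists>F. horizontal (B \<inter> ?Q) h F" for A B
  proof -
    have "connected ((A \<inter> ?Q) \<inter> (B \<inter> ?Q))"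
    proof (rule convex_connected)
      have "convex ((A \<inter> B) \<inter> ?Q)"
        by (rule convex_Int[OF that(3)]) (auto intro: convex_Times)
      then show "convex ((A \<inter> ?Q) \<inter> (B \<inter> ?Q))"
        by (simp add: Int_ac)
    qed
    moreover have "closed (A \<inter> ?Q)" "closed (B \<inter> ?Q)"
      using that(1,2) by (auto intro!: closed_Int closed_Times)
    moreover have "continuous_on (A \<inter> ?Q \<union> B \<inter> ?Q) h" "h ` (A \<inter> ?Q \<union> B \<inter> ?Q) \<subseteq> S"
      using h by (auto intro: continuous_on_subset)
    ultimately show ?thesis
      using that(4,5) horizontal_glue by blast
  qed
  have strip: "\<exists>F. horizontal (({0..1} \<times> {c..d}) \<inter> ?Q) h F" if cd: "d - c < e / 2" for c d
  proof (rule Bolzano[of 0 1 "\<lambda>a b. \<exists>F. horizontal (({a..b} \<times> {c..d}) \<inter> ?Q) h F"], goal_cases)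
    case trans: (2 a b c')
    have "{a..b} \<times> {c..d} \<inter> {b..c'} \<times> {c..d} = {b} \<times> {c..d}"
      using trans by auto
    then have "convex ({a..b} \<times> {c..d} \<inter> {b..c'} \<times> {c..d})"
      by (metis convex_Times convex_singleton convex_real_interval(5))
    moreover have "closed ({a..b} \<times> {c..d})" "closed ({b..c'} \<times> {c..d})"
      by (auto intro!: closed_Times)
    ultimately have "\<exists>F. horizontal (({a..b} \<times> {c..d}) \<inter> ?Q \<union> ({b..c'} \<times> {c..d}) \<inter> ?Q) h F"
      by (intro glue trans(1,2))
    moreover have "({a..b} \<times> {c..d}) \<inter> ?Q \<union> ({b..c'} \<times> {c..d}) \<inter> ?Q = ({a..c'} \<times> {c..d}) \<inter> ?Q"
      using trans by auto
    ultimately show ?case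
      by simp
  next
    case (3 x)
    then show ?case
      using small[OF _ cd] e(1) by (intro exI[of _ "e / 2"]) auto
  qed simp
  have "\<exists>F. horizontal (({0..1} \<times> {0..1}) \<inter> ?Q) h F"
  proof (rule Bolzano[of 0 1 "\<lambda>a b. \<exists>F. horizontal (({0..1} \<times> {a..b}) \<inter> ?Q) h F"], goal_cases)
    case trans: (2 a b c)
    have "{0..1} \<times> {a..b} \<inter> {0..1} \<times> {b..c} = {0..1::real} \<times> {b}"
      using trans by auto
    then have "convex ({0..1::real} \<times> {a..b} \<inter> {0..1} \<times> {b..c})"
      by (metis convex_Times convex_singleton convex_real_interval(5))
    moreover have "closed ({0..1::real} \<times> {a..b})" "closed ({0..1::real} \<times> {b..c})"
      by (auto intro!: closed_Times)
    ultimately have "\<exists>F. horizontal (({0..1} \<times> {a..b}) \<inter> ?Q \<union> ({0..1} \<times> {b..c}) \<inter> ?Q) h F"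
      by (intro glue trans(1,2))
    moreover have "({0..1} \<times> {a..b}) \<inter> ?Q \<union> ({0..1} \<times> {b..c}) \<inter> ?Q = ({0..1} \<times> {a..c}) \<inter> ?Q"
      using trans by auto
    ultimately show ?case
      by simp
  next
    case (3 x)
    then show ?case
      using strip e(1) by (intro exI[of _ "e / 2"]) auto
  qed simp
  then show ?thesis
    by simp
qed

definition transport :: "(real \<Rightarrow> 's) \<Rightarrow> 'k" where
  "transport p = (SOME k. \<exists>F. horizontal {0..1} p F \<and> k = inv (F 0) \<otimes> F 1)"

lemma transport_eq:
  assumes p: "path p" "path_image p \<subseteq> S" and F: "horizontal {0..1} p F"
  shows "transport p = inv (F 0) \<otimes> F 1"
  unfolding transport_def
proof (rule some1_equality)
  show "\<exists>!k. \<exists>F. horizontal {0..1} p F \<and> k = inv (F 0) \<otimes> F 1"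
  proof (intro ex1I exI conjI)
    fix k assume "\<exists>F. horizontal {0..1} p F \<and> k = inv (F 0) \<otimes> F 1"
    then obtain F' where "horizontal {0..1} p F'" "k = inv (F' 0) \<otimes> F' 1"
      by blast
    then show "k = inv (F 0) \<otimes> F 1"
      using horizontal_difference[of "{0..1}" p F F' 0 1] p F by (auto simp: path_def path_image_def)
  qed (use F in auto)
qed (use F in blast)

lemma horizontal_path_exists:
  assumes p: "path p" "path_image p \<subseteq> S"
  shows "\<exists>F. horizontal {0..1} p F"
proof -
  have "continuous_on ({0..1::real} \<times> {0..1}) (p \<circ> snd)"
    using p by (intro continuous_on_compose continuous_intros) (auto simp: path_def)
  moreover have "(p \<circ> snd) ` ({0..1::real} \<times> {0..1}) \<subseteq> S"
    using p by (auto simp: path_image_def)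
  ultimately obtain F where "horizontal ({0..1::real} \<times> {0..1}) (p \<circ> snd) F"
    using horizontal_square_exists by blast
  then have "horizontal {0..1} ((p \<circ> snd) \<circ> (\<lambda>t. (0::real, t))) (F \<circ> (\<lambda>t. (0, t)))"
    by (rule horizontal_compose) (auto intro!: continuous_intros)
  then show ?thesis
    by (auto simp: comp_def)
qed

lemma transport_closed:
  assumes "path p" "path_image p \<subseteq> S"
  shows "transport p \<in> carrier K"
proof -
  obtain F where F: "horizontal {0..1} p F"
    using horizontal_path_exists[OF assms] by blast
  then show ?thesis
    using transport_eq[OF assms F] horizontal_closed[OF F] by simp
qed

lemma transport_join:
  assumes p: "path p" "path_image p \<subseteq> S" and q: "path q" "path_image q \<subseteq> S"
    and "pathfinish p = pathstart q"
  shows "transport (p +++ q) = transport p \<otimes> transport q"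
proof -
  have pq: "path (p +++ q)" "path_image (p +++ q) \<subseteq> S"
    using assms by (auto simp: path_image_join)
  then obtain F where F: "horizontal {0..1} (p +++ q) F"
    using horizontal_path_exists by blast
  have "horizontal {0..1} ((p +++ q) \<circ> (\<lambda>t. t / 2)) (F \<circ> (\<lambda>t. t / 2))"
    using F by (rule horizontal_compose) (auto intro!: continuous_intros)
  then have "horizontal {0..1} p (F \<circ> (\<lambda>t. t / 2))"
    by (rule horizontal_cong) (auto simp: joinpaths_def)
  then have 1: "transport p = inv (F 0) \<otimes> F (1/2)"
    using transport_eq[OF p] by fastforce
  have "horizontal {0..1} ((p +++ q) \<circ> (\<lambda>t. (1 + t) / 2)) (F \<circ> (\<lambda>t. (1 + t) / 2))"
    using F by (rule horizontal_compose) (auto intro!: continuous_intros)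
  then have "horizontal {0..1} q (F \<circ> (\<lambda>t. (1 + t) / 2))"
  proof (rule horizontal_cong)
    fix t :: real assume "t \<in> {0..1}"
    then show "((p +++ q) \<circ> (\<lambda>t. (1 + t) / 2)) t = q t"
      using assms(5) by (cases "t = 0") (auto simp: joinpaths_def pathfinish_def pathstart_def add_divide_distrib)
  qed simp
  then have 2: "transport q = inv (F (1/2)) \<otimes> F 1"
    using transport_eq[OF q] by fastforce
  have "F 0 \<in> carrier K" "F (1/2) \<in> carrier K" "F 1 \<in> carrier K"
    by (auto intro!: horizontal_closed[OF F])
  then show ?thesis
    unfolding 1 2 transport_eq[OF pq F] by (simp add: K.m_assoc flip: K.m_assoc[of "F (1/2)"])
qed

lemma transport_homotopic:
  assumes "homotopic_paths S p q"
  shows "transport p = transport q"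
proof -
  have pq: "path p" "path_image p \<subseteq> S" "path q" "path_image q \<subseteq> S"
    using homotopic_paths_imp_path[OF assms] homotopic_paths_imp_subset[OF assms] by auto
  obtain h :: "real \<times> real \<Rightarrow> 's" where h: "continuous_on ({0..1} \<times> {0..1}) h" "h \<in> {0..1} \<times> {0..1} \<rightarrow> S"
    "\<And>x. x \<in> {0..1} \<Longrightarrow> h (0, x) = p x" "\<And>x. x \<in> {0..1} \<Longrightarrow> h (1, x) = q x"
    "\<And>t. t \<in> {0..1} \<Longrightarrow> h (t, 0) = pathstart p" "\<And>t. t \<in> {0..1} \<Longrightarrow> h (t, 1) = pathfinish p"
    using assms unfolding homotopic_paths pathstart_def pathfinish_def comp_def by (elim exE conjE) (simp add: that)
  obtain F where F: "horizontal ({0..1} \<times> {0..1}) h F"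
    using horizontal_square_exists h(1,2) by (metis image_subset_iff_funcset)
  have slice: "horizontal {0..1} (h \<circ> u) (F \<circ> u)"
    if "continuous_on {0..1} u" "u ` {0..1} \<subseteq> {0..1} \<times> {0..1}" for u :: "real \<Rightarrow> real \<times> real"
    using F that by (rule horizontal_compose)
  have "horizontal {0..1} p (F \<circ> (\<lambda>t. (0, t)))"
    by (rule horizontal_cong[OF slice[of "\<lambda>t. (0, t)"]]) (auto intro!: continuous_intros simp: h)
  from transport_eq[OF pq(1,2) this] have 1: "transport p = inv (F (0, 0)) \<otimes> F (0, 1)"
    by simp
  have "horizontal {0..1} q (F \<circ> (\<lambda>t. (1, t)))"
    by (rule horizontal_cong[OF slice[of "\<lambda>t. (1, t)"]]) (auto intro!: continuous_intros simp: h)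
  from transport_eq[OF pq(3,4) this] have 2: "transport q = inv (F (1, 0)) \<otimes> F (1, 1)"
    by simp
  have side: "F (0, t) = F (1, t)" if t: "t \<in> {0, 1}" for t
  proof -
    have const: "h (u, t) = h (0, t)" if "u \<in> {0..1}" for u
    proof -
      have "h (u, t) = h (0, t)" if "t = 0"
        unfolding that using h(5)[of u] h(5)[of 0] \<open>u \<in> {0..1}\<close> by simp
      moreover have "h (u, t) = h (0, t)" if "t = 1"
        unfolding that using h(6)[of u] h(6)[of 0] \<open>u \<in> {0..1}\<close> by simp
      ultimately show ?thesis
        using t by blast
    qed
    have hS: "h (0, t) \<in> S"
      using h(2) t by auto
    have F': "horizontal {0..1} (\<lambda>u. h (0, t)) (F \<circ> (\<lambda>u. (u, t)))"
    proof (rule horizontal_cong[OF slice[of "\<lambda>u. (u, t)"]])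
      show "continuous_on {0..1} (\<lambda>u. (u, t))"
        by (intro continuous_intros)
      show "(\<lambda>u. (u, t)) ` {0..1} \<subseteq> {0..1} \<times> {0..1}"
        using t by auto
      show "(h \<circ> (\<lambda>u. (u, t))) u = h (0, t)" if "u \<in> {0..1}" for u
        unfolding comp_def using that by (rule const)
    qed simp
    obtain i where "h (0, t) \<in> U i"
      using cover[OF hS] by blast
    then have "horizontal {0..1::real} (\<lambda>u. h (0, t)) (f i \<circ> (\<lambda>u. h (0, t)))"
      by (intro horizontal_local) (auto intro!: continuous_intros)
    then have "inv (F (0, t)) \<otimes> F (1, t) = inv (f i (h (0, t))) \<otimes> f i (h (0, t))"
      using horizontal_difference[of "{0..1::real}" "\<lambda>u. h (0, t)" "f i \<circ> (\<lambda>u. h (0, t))" _ 0 1, OF _ _ _ _ F'] hS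
      by auto
    moreover have "F (0, t) \<in> carrier K" "F (1, t) \<in> carrier K" "f i (h (0, t)) \<in> carrier K"
      using t \<open>h (0, t) \<in> U i\<close> by (auto intro!: horizontal_closed[OF F] f_closed)
    ultimately show ?thesis
      by (metis K.inv_closed K.inv_equality K.inv_inv K.l_inv)
  qed
  show ?thesis
    unfolding 1 2 using side by simp
qed

end

lemma (in group_cocycle) horizontal_hom_image:
  assumes F: "horizontal C h F" and K': "group K'" and \<psi>: "\<psi> \<in> hom K K'"
  shows "group_cocycle.horizontal K' U (\<lambda>i x. \<psi> (f i x)) C h (\<psi> \<circ> F)"
proof -
  interpret group_hom K K' \<psi>
    using K' \<psi> by (simp add: group_hom_def group_hom_axioms_def K.group_axioms)
  interpret K': group_cocycle K' S U "\<lambda>i x. \<psi> (f i x)"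
  proof
    fix x i j assume x: "x \<in> U i" "x \<in> U j"
    obtain N where N: "openin (top_of_set S) N" "x \<in> N"
      "\<forall>y\<in>N. y \<in> U i \<longrightarrow> y \<in> U j \<longrightarrow> f i y \<otimes> inv (f j y) = f i x \<otimes> inv (f j x)"
      using transition[OF x] by blast
    have e: "\<psi> (f i y) \<otimes>\<^bsub>K'\<^esub> inv\<^bsub>K'\<^esub> \<psi> (f j y) = \<psi> (f i y \<otimes> inv (f j y))" if "y \<in> U i" "y \<in> U j" for y
      using that f_closed by simp
    show "\<exists>N. openin (top_of_set S) N \<and> x \<in> N \<and> (\<forall>y\<in>N. y \<in> U i \<longrightarrow> y \<in> U j \<longrightarrow>
      \<psi> (f i y) \<otimes>\<^bsub>K'\<^esub> inv\<^bsub>K'\<^esub> \<psi> (f j y) = \<psi> (f i x) \<otimes>\<^bsub>K'\<^esub> inv\<^bsub>K'\<^esub> \<psi> (f j x))"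
    proof (intro exI[of _ N] conjI ballI impI)
      fix y assume y: "y \<in> N" "y \<in> U i" "y \<in> U j"
      show "\<psi> (f i y) \<otimes>\<^bsub>K'\<^esub> inv\<^bsub>K'\<^esub> \<psi> (f j y) = \<psi> (f i x) \<otimes>\<^bsub>K'\<^esub> inv\<^bsub>K'\<^esub> \<psi> (f j x)"
        unfolding e[OF y(2,3)] e[OF x] using N(3) y by metis
    qed (use N(1,2) in auto)
  qed (use cover openin_U f_closed in auto)
  show ?thesis
  proof (rule K'.horizontalI)
    show "(\<psi> \<circ> F) x \<in> carrier K'" if "x \<in> C" for x
      using horizontal_closed[OF F that] by simp
    fix x i assume x: "x \<in> C" "h x \<in> U i"
    obtain N where N: "open N" "x \<in> N"
      "\<And>y. y \<in> N \<Longrightarrow> y \<in> C \<Longrightarrow> h y \<in> U i \<Longrightarrow> F y \<otimes> inv (f i (h y)) = F x \<otimes> inv (f i (h x))"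
      using horizontalD[OF F x] by blast
    have e: "(\<psi> \<circ> F) y \<otimes>\<^bsub>K'\<^esub> inv\<^bsub>K'\<^esub> \<psi> (f i (h y)) = \<psi> (F y \<otimes> inv (f i (h y)))"
      if "y \<in> C" "h y \<in> U i" for y
      using that f_closed horizontal_closed[OF F] by simp
    show "\<exists>N. open N \<and> x \<in> N \<and> (\<forall>y. y \<in> N \<longrightarrow> y \<in> C \<longrightarrow> h y \<in> U i \<longrightarrow>
        (\<psi> \<circ> F) y \<otimes>\<^bsub>K'\<^esub> inv\<^bsub>K'\<^esub> \<psi> (f i (h y)) = (\<psi> \<circ> F) x \<otimes>\<^bsub>K'\<^esub> inv\<^bsub>K'\<^esub> \<psi> (f i (h x)))"
    proof (intro exI[of _ N] conjI allI impI)
      fix y assume y: "y \<in> N" "y \<in> C" "h y \<in> U i"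
      show "(\<psi> \<circ> F) y \<otimes>\<^bsub>K'\<^esub> inv\<^bsub>K'\<^esub> \<psi> (f i (h y)) = (\<psi> \<circ> F) x \<otimes>\<^bsub>K'\<^esub> inv\<^bsub>K'\<^esub> \<psi> (f i (h x))"
        unfolding e[OF y(2,3)] e[OF x] N(3)[OF y] ..
    qed (use N(1,2) in auto)
  qed
qed

section \<open>The surface as a quotient of the polar rectangle\<close>

definition polar :: "nat \<Rightarrow> real \<times> real \<Rightarrow> complex" where
  "polar g z = of_real (fst z) * cis (2 * pi * snd z / real (4 * g))"

definition polar_rectangle :: "nat \<Rightarrow> (real \<times> real) set" where
  "polar_rectangle g = {0..1} \<times> {0..real (4 * g)}"

definition gluing_invariant :: "nat \<Rightarrow> (real \<times> real \<Rightarrow> 'b) \<Rightarrow> bool" where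
  "gluing_invariant g F \<longleftrightarrow>
    (\<forall>\<theta>\<in>{0..real (4 * g)}. F (0, \<theta>) = F (0, 0)) \<and>
    (\<forall>r\<in>{0..1}. F (r, real (4 * g)) = F (r, 0)) \<and>
    (\<forall>k<4 * g. k mod 4 < 2 \<longrightarrow> (\<forall>t\<in>{0..1}. F (1, real k + t) = F (1, real k + 3 - t)))"

lemma gluing_invariantI:
  assumes "\<And>\<theta>. \<theta> \<in> {0..real (4 * g)} \<Longrightarrow> F (0, \<theta>) = F (0, 0)"
    and "\<And>r. r \<in> {0..1} \<Longrightarrow> F (r, real (4 * g)) = F (r, 0)"
    and "\<And>k t. k < 4 * g \<Longrightarrow> k mod 4 < 2 \<Longrightarrow> t \<in> {0..1} \<Longrightarrow> F (1, real k + t) = F (1, real k + 3 - t)"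
  shows "gluing_invariant g F"
  unfolding gluing_invariant_def by (intro conjI ballI allI impI; rule assms; assumption)

lemma gluing_invariantD:
  assumes "gluing_invariant g F"
  shows "\<theta> \<in> {0..real (4 * g)} \<Longrightarrow> F (0, \<theta>) = F (0, 0)"
    and "r \<in> {0..1} \<Longrightarrow> F (r, real (4 * g)) = F (r, 0)"
    and "k < 4 * g \<Longrightarrow> k mod 4 < 2 \<Longrightarrow> t \<in> {0..1} \<Longrightarrow> F (1, real k + t) = F (1, real k + 3 - t)"
  using assms unfolding gluing_invariant_def by blast+

lemma gluing_invariant_comp: "gluing_invariant g F \<Longrightarrow> gluing_invariant g (\<lambda>z. h (F z))"
  unfolding gluing_invariant_def by (intro conjI ballI allI impI; rule arg_cong[where f = h]; blast)

lemma polygon_side_polar: "polygon_side g k t = polar g (1, real k + t)"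
  by (simp add: polygon_side_def polar_def)

lemma side_index_bound:
  assumes "k < 4 * g" "k mod 4 < 2"
  shows "real k + 3 \<le> real (4 * g)"
proof -
  have "k + 3 \<le> 4 * g"
    using assms by presburger
  then show ?thesis
    by linarith
qed

lemma polar_surj:
  assumes g: "g > 0"
  shows "polar g ` polar_rectangle g = cball 0 1"
proof
  show "polar g ` polar_rectangle g \<subseteq> cball 0 1"
    by (auto simp: polar_def polar_rectangle_def norm_mult)
  show "cball 0 1 \<subseteq> polar g ` polar_rectangle g"
  proof
    fix w :: complex assume w: "w \<in> cball 0 1"
    let ?z = "(cmod w, real (4 * g) * Arg2pi w / (2 * pi))"
    have "polar g ?z = of_real (cmod w) * cis (Arg2pi w)"
      using g by (simp add: polar_def)
    also have "\<dots> = w"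
      using Arg2pi_eq[of w] by (simp add: cis_conv_exp)
    finally have "polar g ?z = w" .
    moreover have "real (4 * g) * Arg2pi w / (2 * pi) \<le> real (4 * g)"
      using mult_left_mono[OF less_imp_le[OF Arg2pi_lt_2pi[of w]], of "real (4 * g)"]
      by (simp add: field_simps)
    then have "?z \<in> polar_rectangle g"
      using w Arg2pi_ge_0[of w] by (auto simp: polar_rectangle_def)
    ultimately show "w \<in> polar g ` polar_rectangle g"
      by force
  qed
qed

lemma polar_eq_cases:
  assumes g: "g > 0" and z: "z \<in> polar_rectangle g" "z' \<in> polar_rectangle g"
    and eq: "polar g z = polar g z'"
  shows "z = z' \<or> fst z = 0 \<and> fst z' = 0 \<or>
    fst z = fst z' \<and> {snd z, snd z'} = {0, real (4 * g)}"
proof -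
  have "cmod (polar g z) = fst z" "cmod (polar g z') = fst z'"
    using z by (auto simp: polar_def polar_rectangle_def norm_mult)
  then have r: "fst z = fst z'"
    using eq by simp
  show ?thesis
  proof (cases "fst z = 0")
    case True
    then show ?thesis
      using r by simp
  next
    case False
    have "cis (2 * pi * snd z / real (4 * g)) = cis (2 * pi * snd z' / real (4 * g))"
      using eq r False by (simp add: polar_def)
    then have "sin (2 * pi * snd z / real (4 * g)) = sin (2 * pi * snd z' / real (4 * g)) \<and>
        cos (2 * pi * snd z / real (4 * g)) = cos (2 * pi * snd z' / real (4 * g))"
      by (simp only: complex_eq_iff cis.sel)
    then obtain n :: int where "2 * pi * snd z / real (4 * g) = 2 * pi * snd z' / real (4 * g) + 2 * pi * n"
      unfolding sin_cos_eq_iff by blast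
    then have "2 * pi * snd z = 2 * pi * (snd z' + n * real (4 * g))"
      using g by (simp add: field_simps)
    then have n: "snd z = snd z' + n * real (4 * g)"
      by simp
    have b: "0 \<le> snd z" "snd z \<le> real (4 * g)" "0 \<le> snd z'" "snd z' \<le> real (4 * g)"
      using z by (auto simp: polar_rectangle_def)
    have "real_of_int n * real (4 * g) \<le> 1 * real (4 * g)" "(- 1) * real (4 * g) \<le> real_of_int n * real (4 * g)"
      using n b by linarith+
    then have "real_of_int n \<le> 1" "- 1 \<le> real_of_int n"
      using g by (auto simp only: mult_le_cancel_right of_nat_0_less_iff)
    then have "n = -1 \<or> n = 0 \<or> n = 1"
      by linarith
    then show ?thesis
      using n b r by (auto simp: prod_eq_iff)
  qed
qed

locale polygon =
  fixes g :: nat and S :: "'s::topological_space set" and q :: "real \<times> real \<Rightarrow> 's"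
  assumes g_pos: "g > 0"
    and quotient: "quotient_map (top_of_set (polar_rectangle g)) (top_of_set S) q"
    and q_invariant: "gluing_invariant g q"
    and fibre: "z \<in> polar_rectangle g \<Longrightarrow> z' \<in> polar_rectangle g \<Longrightarrow> q z = q z' \<Longrightarrow>
      gluing_invariant g P \<Longrightarrow> P z = (P z' :: bool)"

lemma closed_orientable_surface_polygon:
  assumes "closed_orientable_surface g S"
  shows "\<exists>q. polygon g S q"
proof -
  obtain q0 where g: "g > 0"
    and q0: "quotient_map (top_of_set (cball 0 1)) (top_of_set S) q0"
    and fib: "\<And>z w. z \<in> cball 0 1 \<Longrightarrow> w \<in> cball 0 1 \<Longrightarrow> q0 z = q0 w \<longleftrightarrow> equivclp (side_gluing g) z w"
    using assms by (auto simp: closed_orientable_surface_def)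
  let ?R = "polar_rectangle g"
  have in_R: "(1, real k + t) \<in> ?R" "(1, real k + 3 - t) \<in> ?R"
    if "k < 4 * g" "k mod 4 < 2" "t \<in> {0..1}" for k t
    using side_index_bound[OF that(1,2)] that(3) by (auto simp: polar_rectangle_def)
  have sg: "side_gluing g (polar g (1, real k + t)) (polar g (1, real k + 3 - t))"
    if k: "k < 4 * g" "k mod 4 < 2" "t \<in> {0..1}" for k t
    unfolding side_gluing_def
  proof (intro exI conjI bexI)
    show "k div 4 < g"
      using k by auto
    show "k mod 4 \<in> {0, 1}"
      using k by auto
    have "4 * (k div 4) + k mod 4 = k"
      by simp
    then show "polar g (1, real k + t) = polygon_side g (4 * (k div 4) + k mod 4) t"
      "polar g (1, real k + 3 - t) = polygon_side g (4 * (k div 4) + k mod 4 + 2) (1 - t)"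
      by (simp_all add: polygon_side_polar algebra_simps)
  qed (use k in auto)
  have "compact ?R"
    unfolding polar_rectangle_def by (intro compact_Times) auto
  moreover have cont: "continuous_on ?R (polar g)"
    unfolding polar_def by (intro continuous_intros) (use g in auto)
  ultimately have pq: "quotient_map (top_of_set ?R) (top_of_set (cball 0 1)) (polar g)"
    using polar_surj[OF g]
    by (intro continuous_imp_quotient_map)
      (auto simp: compact_space_subtopology Hausdorff_space_subtopology)
  have "polygon g S (q0 \<circ> polar g)"
  proof
    show "g > 0"
      by (rule g)
    show "quotient_map (top_of_set ?R) (top_of_set S) (q0 \<circ> polar g)"
      using pq q0 by (rule quotient_map_compose)
    show "gluing_invariant g (q0 \<circ> polar g)"
    proof (rule gluing_invariantI)
      fix k and t :: real assume k: "k < 4 * g" "k mod 4 < 2" "t \<in> {0..1}"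
      have "polar g (1, real k + t) \<in> cball 0 1" "polar g (1, real k + 3 - t) \<in> cball 0 1"
        using polar_surj[OF g] in_R[OF k] by blast+
      then show "(q0 \<circ> polar g) (1, real k + t) = (q0 \<circ> polar g) (1, real k + 3 - t)"
        using fib r_into_equivclp[of "side_gluing g", OF sg[OF k]] by simp
    qed (use g in \<open>simp_all add: polar_def\<close>)
  next
    fix z z' and P :: "real \<times> real \<Rightarrow> bool"
    assume z: "z \<in> ?R" "z' \<in> ?R" and eq: "(q0 \<circ> polar g) z = (q0 \<circ> polar g) z'"
      and P: "gluing_invariant g P"
    have P_polar: "P y = P y'" if y: "y \<in> ?R" "y' \<in> ?R" "polar g y = polar g y'" for y y'
    proof -
      have 0: "P (0, b) = P (0, 0)" if "(0, b) \<in> ?R" for b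
        using gluing_invariantD(1)[OF P, of b] that by (simp add: polar_rectangle_def)
      have 1: "P (a, real (4 * g)) = P (a, 0)" if "(a, b) \<in> ?R" for a b
        using gluing_invariantD(2)[OF P, of a] that by (simp add: polar_rectangle_def)
      obtain a b a' b' where ab: "y = (a, b)" "y' = (a', b')"
        by fastforce
      consider "y = y'" | "a = 0" "a' = 0" | "a = a'" "b = 0" "b' = real (4 * g)"
        | "a = a'" "b' = 0" "b = real (4 * g)"
        using polar_eq_cases[OF g y] ab by (auto simp: doubleton_eq_iff)
      then show ?thesis
      proof cases
        case 2
        then show ?thesis
          using 0[of b] 0[of b'] y(1,2) ab by metis
      next
        case 3
        then show ?thesis
          using 1[of a b] y(1) ab by metis
      next
        case 4
        then show ?thesis
          using 1[of a b] y(1) ab by metis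
      qed simp
    qed
    define P' where "P' w = (\<exists>y\<in>?R. polar g y = w \<and> P y)" for w
    have P': "P' (polar g y) = P y" if "y \<in> ?R" for y
    proof
      assume "P' (polar g y)"
      then obtain y' where "y' \<in> ?R" "polar g y' = polar g y" "P y'"
        unfolding P'_def by blast
      then show "P y"
        using P_polar[of y' y] that by blast
    qed (use that P'_def in blast)
    have glued: "P' w = P' w'" if "side_gluing g w w'" for w w'
    proof -
      obtain i j t where ij: "i < g" "j \<in> {0, 1}" "t \<in> {0..1}"
        "w = polygon_side g (4 * i + j) t" "w' = polygon_side g (4 * i + j + 2) (1 - t)"
        using \<open>side_gluing g w w'\<close> unfolding side_gluing_def by blast
      define k where "k = 4 * i + j"
      have k: "k < 4 * g" "k mod 4 < 2"
        using ij by (auto simp: k_def)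
      have w: "w = polar g (1, real k + t)" "w' = polar g (1, real k + 3 - t)"
        using ij by (auto simp: k_def polygon_side_polar algebra_simps)
      have "P (1, real k + t) = P (1, real k + 3 - t)"
        using gluing_invariantD(3)[OF P k ij(3)] .
      then show ?thesis
        using P' in_R[OF k ij(3)] w by simp
    qed
    have "equivclp (side_gluing g) (polar g z) (polar g z')"
    proof -
      have "polar g z \<in> cball 0 1" "polar g z' \<in> cball 0 1"
        using polar_surj[OF g] z by blast+
      then show ?thesis
        using fib eq by simp
    qed
    then have "P' (polar g z) = P' (polar g z')"
      by (induction rule: equivclp_induct) (use glued in blast)+
    then show "P z = P z'"
      using P' z by simp
  qed
  then show ?thesis
    by blast
qed

datatype chart = Center | Edge | Vertex

definition chart_offset :: "chart \<Rightarrow> real" where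
  "chart_offset i = (if i = Vertex then 1 / 2 else 0)"

context polygon
begin

abbreviation R :: "(real \<times> real) set" where "R \<equiv> polar_rectangle g"

lemma q_image: "q ` R = S"
  using quotient by (auto simp: quotient_map_def)

lemma q_continuous: "continuous_on R q"
  using quotient_imp_continuous_map[OF quotient] by auto

lemma q_glued:
  "\<theta> \<in> {0..real (4 * g)} \<Longrightarrow> q (0, \<theta>) = q (0, 0)"
  "r \<in> {0..1} \<Longrightarrow> q (r, real (4 * g)) = q (r, 0)"
  "k < 4 * g \<Longrightarrow> k mod 4 < 2 \<Longrightarrow> t \<in> {0..1} \<Longrightarrow> q (1, real k + t) = q (1, real k + 3 - t)"
  using gluing_invariantD[OF q_invariant] by blast+

lemma side_points_in_R:
  assumes "k < 4 * g" "k mod 4 < 2" "t \<in> {0..1}"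
  shows "(1, real k + t) \<in> R" "(1, real k + 3 - t) \<in> R"
  using side_index_bound[OF assms(1,2)] assms(3) by (auto simp: polar_rectangle_def)

lemma invariant_fibre:
  assumes "gluing_invariant g F" "z \<in> R" "z' \<in> R" "q z = q z'"
  shows "F z = F z'"
proof -
  have "gluing_invariant g (\<lambda>y. F y = F z)"
    using assms(1) by (rule gluing_invariant_comp)
  from fibre[OF assms(2-4) this] show ?thesis
    by metis
qed

definition chart_domain :: "chart \<Rightarrow> (real \<times> real) set" where
  "chart_domain i =
    {z \<in> R. if i = Center then fst z < 1 else 0 < fst z \<and> snd z + chart_offset i \<notin> \<int>}"

definition centre :: "chart \<Rightarrow> real \<times> real \<Rightarrow> real \<times> real" where
  "centre i z =
    (if i = Center then (0, snd z)
     else (1, of_int \<lfloor>snd z + chart_offset i\<rfloor> + 1 / 2 - chart_offset i))"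

lemma chart_domain_subset: "chart_domain i \<subseteq> R"
  by (auto simp: chart_domain_def)

lemma chart_domain_cover: "z \<in> R \<Longrightarrow> \<exists>i. z \<in> chart_domain i"
proof -
  assume z: "z \<in> R"
  have "z \<in> chart_domain Center \<or> z \<in> chart_domain Edge \<or> z \<in> chart_domain Vertex"
  proof (rule ccontr)
    assume "\<not> ?thesis"
    then have "snd z \<in> \<int>" "snd z + 1 / 2 \<in> \<int>"
      using z by (auto simp: chart_domain_def chart_offset_def split: if_splits)
    then have "(snd z + 1 / 2) - snd z \<in> \<int>"
      by (rule Ints_diff[rotated])
    then show False
      by (simp add: fraction_not_in_Ints)
  qed
  then show ?thesis
    by blast
qed

lemma openin_chart_domain: "openin (top_of_set R) (chart_domain i)"
proof -
  have "open {z :: real \<times> real. fst z < 1}" "open {z :: real \<times> real. 0 < fst z}"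
    by (intro open_Collect_less continuous_intros)+
  moreover have "open ((\<lambda>z :: real \<times> real. snd z + chart_offset i) -` (- \<int>))"
    by (intro open_vimage continuous_intros) (auto simp: closed_Ints open_Compl)
  ultimately have o: "open {z :: real \<times> real. fst z < 1}"
    "open ({z :: real \<times> real. 0 < fst z} \<inter> (\<lambda>z. snd z + chart_offset i) -` (- \<int>))"
    by auto
  have "chart_domain i = R \<inter> (if i = Center then {z. fst z < 1}
      else {z. 0 < fst z} \<inter> (\<lambda>z. snd z + chart_offset i) -` (- \<int>))"
    by (auto simp: chart_domain_def)
  then show ?thesis
    using o by (auto intro!: openin_open_Int)
qed

lemma centre_glued:
  assumes k: "k < 4 * g" "k mod 4 < 2" and t: "t \<in> {0..1}"
    and z: "(1, real k + t) \<in> chart_domain i \<or> (1, real k + 3 - t) \<in> chart_domain i"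
  obtains t' where "t' \<in> {0, 1 / 2, 1}" "centre i (1, real k + t) = (1, real k + t')"
    "centre i (1, real k + 3 - t) = (1, real k + 3 - t')"
    "(1, real k + t) \<in> chart_domain i" "(1, real k + 3 - t) \<in> chart_domain i"
proof -
  have i: "i = Edge \<or> i = Vertex"
    using z by (cases i) (auto simp: chart_domain_def)
  have Ints: "real k + t + c \<in> \<int> \<longleftrightarrow> t + c \<in> \<int>" "real k + 3 - t + c \<in> \<int> \<longleftrightarrow> - t + c \<in> \<int>" for c
  proof -
    have "real k + t + c = real k + (t + c)" "real k + 3 - t + c = real (k + 3) + (- t + c)"
      by auto
    then show "real k + t + c \<in> \<int> \<longleftrightarrow> t + c \<in> \<int>" "real k + 3 - t + c \<in> \<int> \<longleftrightarrow> - t + c \<in> \<int>"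
      by (simp_all only: add_in_Ints_iff_left Ints_of_nat)
  qed
  have half: "- t + 1 / 2 \<in> \<int> \<longleftrightarrow> t + 1 / 2 \<in> \<int>"
  proof -
    have "- t + 1 / 2 = 1 - (t + 1 / 2)"
      by simp
    then show ?thesis
      by (metis Ints_1 Ints_diff diff_diff_eq2 add_diff_cancel_left')
  qed
  have R: "(1, real k + t) \<in> R" "(1, real k + 3 - t) \<in> R"
    using side_points_in_R[OF k t] .
  show ?thesis
  proof (cases "i = Edge")
    case True
    then have dom: "(1, real k + t) \<in> chart_domain i \<longleftrightarrow> t \<notin> \<int>"
      "(1, real k + 3 - t) \<in> chart_domain i \<longleftrightarrow> t \<notin> \<int>"
      using R Ints[of 0] by (auto simp: chart_domain_def chart_offset_def)
    with z have "t \<notin> \<int>"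
      by blast
    then have "0 < t" "t < 1"
      using t by (auto simp: less_le)
    then have "\<lfloor>real k + t\<rfloor> = int k" "\<lfloor>real k + 3 - t\<rfloor> = int k + 2"
      by (auto simp: floor_eq_iff)
    then show ?thesis
      using True dom \<open>t \<notin> \<int>\<close> by (intro that[of "1 / 2"]) (auto simp: centre_def chart_offset_def)
  next
    case False
    then have V: "i = Vertex"
      using i by auto
    then have dom: "(1, real k + t) \<in> chart_domain i \<longleftrightarrow> t + 1 / 2 \<notin> \<int>"
      "(1, real k + 3 - t) \<in> chart_domain i \<longleftrightarrow> t + 1 / 2 \<notin> \<int>"
      using R Ints[of "1 / 2"] half by (auto simp: chart_domain_def chart_offset_def)
    with z have nt: "t + 1 / 2 \<notin> \<int>"
      by blast
    have "t \<noteq> 1 / 2"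
    proof
      assume "t = 1 / 2"
      then have "t + 1 / 2 = 1"
        by simp
      then show False
        using nt Ints_1 by metis
    qed
    then consider "t < 1 / 2" | "t > 1 / 2"
      by linarith
    then show ?thesis
    proof cases
      case 1
      then have "\<lfloor>real k + t + 1 / 2\<rfloor> = int k" "\<lfloor>real k + 3 - t + 1 / 2\<rfloor> = int k + 3"
        using t by (auto simp: floor_eq_iff)
      then show ?thesis
        using V dom nt by (intro that[of 0]) (auto simp: centre_def chart_offset_def)
    next
      case 2
      then have "\<lfloor>real k + t + 1 / 2\<rfloor> = int k + 1" "\<lfloor>real k + 3 - t + 1 / 2\<rfloor> = int k + 2"
        using t by (auto simp: floor_eq_iff)
      then show ?thesis
        using V dom nt by (intro that[of 1]) (auto simp: centre_def chart_offset_def)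
    qed
  qed
qed

lemma chart_domain_origin: "(0, \<theta>) \<in> chart_domain i \<longleftrightarrow> i = Center \<and> \<theta> \<in> {0..real (4 * g)}"
  by (auto simp: chart_domain_def polar_rectangle_def)

lemma chart_domain_seam: "(r, real (4 * g)) \<in> chart_domain i \<longleftrightarrow> (r, 0) \<in> chart_domain i"
proof -
  have "real (4 * g) + c \<in> \<int> \<longleftrightarrow> c \<in> \<int>" for c
    by (simp only: add_in_Ints_iff_left Ints_of_nat)
  then show ?thesis
    by (simp add: chart_domain_def polar_rectangle_def)
qed

lemma centre_seam:
  assumes "(r, 0) \<in> chart_domain i"
  shows "centre i (r, 0) = (if i = Center then (0, 0) else (1, 0))"
    "centre i (r, real (4 * g)) = (if i = Center then (0, real (4 * g)) else (1, real (4 * g)))"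
proof -
  have "i \<noteq> Edge"
    using assms by (auto simp: chart_domain_def chart_offset_def)
  moreover have "\<lfloor>real (4 * g) + 1 / 2\<rfloor> = int (4 * g)"
    by (simp only: floor_eq_iff) auto
  ultimately show "centre i (r, 0) = (if i = Center then (0, 0) else (1, 0))"
    "centre i (r, real (4 * g)) = (if i = Center then (0, real (4 * g)) else (1, real (4 * g)))"
    by (cases i; simp add: centre_def chart_offset_def)+
qed

lemma invariant_on_charts:
  assumes A: "A = chart_domain i \<inter> chart_domain j"
    and origin: "\<And>\<theta>. (0, \<theta>) \<in> A \<Longrightarrow> \<kappa> (0, \<theta>) = \<kappa> (0, 0)"
    and seam: "\<And>r. (r, 0) \<in> A \<Longrightarrow> \<kappa> (r, real (4 * g)) = \<kappa> (r, 0)"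
    and side: "\<And>k t. k < 4 * g \<Longrightarrow> k mod 4 < 2 \<Longrightarrow> t \<in> {0..1} \<Longrightarrow> (1, real k + t) \<in> A \<Longrightarrow>
      (1, real k + 3 - t) \<in> A \<Longrightarrow> \<kappa> (1, real k + t) = \<kappa> (1, real k + 3 - t)"
  shows "gluing_invariant g (\<lambda>z. if z \<in> A then Some (\<kappa> z) else None)"
proof (rule gluing_invariantI)
  fix \<theta> assume "\<theta> \<in> {0..real (4 * g)}"
  then show "(if (0, \<theta>) \<in> A then Some (\<kappa> (0, \<theta>)) else None) = (if (0, 0) \<in> A then Some (\<kappa> (0, 0)) else None)"
    using origin[of \<theta>] by (auto simp: A chart_domain_origin)
next
  fix r :: real
  show "(if (r, real (4 * g)) \<in> A then Some (\<kappa> (r, real (4 * g))) else None) =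
      (if (r, 0) \<in> A then Some (\<kappa> (r, 0)) else None)"
    using seam[of r] by (simp add: A chart_domain_seam del: of_nat_mult)
next
  fix k and t :: real assume k: "k < 4 * g" "k mod 4 < 2" "t \<in> {0..1}"
  have "(1, real k + t) \<in> chart_domain l \<longleftrightarrow> (1, real k + 3 - t) \<in> chart_domain l" for l
    using centre_glued[OF k, of l] by metis
  then have "(1, real k + t) \<in> A \<longleftrightarrow> (1, real k + 3 - t) \<in> A"
    by (simp add: A)
  then show "(if (1, real k + t) \<in> A then Some (\<kappa> (1, real k + t)) else None) =
      (if (1, real k + 3 - t) \<in> A then Some (\<kappa> (1, real k + 3 - t)) else None)"
    using side[OF k] by simp
qed

lemma chart_domain_saturated:
  assumes "z \<in> R" "z' \<in> R" "q z = q z'" "z \<in> chart_domain i"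
  shows "z' \<in> chart_domain i"
proof -
  have "gluing_invariant g (\<lambda>z. if z \<in> chart_domain i then Some () else None)"
    using invariant_on_charts[of "chart_domain i" i i "\<lambda>_. ()"] by simp
  from invariant_fibre[OF this assms(1-3)] show ?thesis
    using assms(4) by (auto split: if_splits)
qed

definition chart_image :: "chart \<Rightarrow> 's set" where
  "chart_image i = q ` chart_domain i"

lemma q_in_chart_image: "z \<in> R \<Longrightarrow> q z \<in> chart_image i \<longleftrightarrow> z \<in> chart_domain i"
  unfolding chart_image_def using chart_domain_saturated[of _ z i] chart_domain_subset
  by (metis image_iff subsetD)

lemma openin_image_saturated:
  assumes "openin (top_of_set R) B" "\<And>z z'. z \<in> B \<Longrightarrow> z' \<in> R \<Longrightarrow> q z = q z' \<Longrightarrow> z' \<in> B"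
  shows "openin (top_of_set S) (q ` B)"
proof -
  have B: "B \<subseteq> R"
    using assms(1) by (rule openin_imp_subset)
  then have "q ` B \<subseteq> S"
    using q_image by blast
  moreover have "{z \<in> R. q z \<in> q ` B} = B"
    using assms(2) B by (auto simp: image_iff)
  moreover have "\<forall>U. U \<subseteq> S \<longrightarrow> openin (top_of_set R) {z \<in> R. q z \<in> U} = openin (top_of_set S) U"
    using quotient unfolding quotient_map_def topspace_euclidean_subtopology by blast
  ultimately show ?thesis
    using assms(1) by (metis (no_types))
qed

lemma openin_chart_image: "openin (top_of_set S) (chart_image i)"
  unfolding chart_image_def
  by (rule openin_image_saturated[OF openin_chart_domain])
    (rule chart_domain_saturated[OF subsetD[OF chart_domain_subset]])

lemma descend_locally_constant:
  assumes A: "A = chart_domain i \<inter> chart_domain j" "z \<in> A"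
    and inv: "gluing_invariant g (\<lambda>z. if z \<in> A then Some (\<kappa> z) else None)"
    and loc: "\<And>z. z \<in> A \<Longrightarrow> \<exists>N. open N \<and> z \<in> N \<and> (\<forall>y\<in>N. y \<in> A \<longrightarrow> \<kappa> y = \<kappa> z)"
  obtains M where "openin (top_of_set S) M" "q z \<in> M"
    "\<And>z'. z' \<in> R \<Longrightarrow> q z' \<in> M \<Longrightarrow> z' \<in> A \<and> \<kappa> z' = \<kappa> z"
proof -
  define B where "B = {z' \<in> A. \<kappa> z' = \<kappa> z}"
  have oA: "openin (top_of_set R) A"
    unfolding A by (intro openin_Int openin_chart_domain)
  have AR: "A \<subseteq> R"
    using oA by (rule openin_imp_subset)
  have "openin (top_of_set R) B"
  proof (subst openin_subopen, intro ballI)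
    fix y assume y: "y \<in> B"
    then obtain N where N: "open N" "y \<in> N" "\<forall>x\<in>N. x \<in> A \<longrightarrow> \<kappa> x = \<kappa> y"
      using loc[of y] by (auto simp: B_def)
    have "openin (top_of_set R) (A \<inter> (R \<inter> N))"
      by (intro openin_Int oA openin_open_Int N(1))
    moreover have "y \<in> A \<inter> (R \<inter> N)" "A \<inter> (R \<inter> N) \<subseteq> B"
      using y N AR by (auto simp: B_def)
    ultimately show "\<exists>T. openin (top_of_set R) T \<and> y \<in> T \<and> T \<subseteq> B"
      by blast
  qed
  moreover have sat: "y' \<in> B" if "y \<in> B" "y' \<in> R" "q y = q y'" for y y'
    using invariant_fibre[OF inv, of y y'] that AR by (auto simp: B_def split: if_splits)
  ultimately have "openin (top_of_set S) (q ` B)"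
    by (rule openin_image_saturated)
  moreover have "q z \<in> q ` B"
    using A by (auto simp: B_def)
  moreover have "z' \<in> A \<and> \<kappa> z' = \<kappa> z" if "z' \<in> R" "q z' \<in> q ` B" for z'
  proof -
    have "z' \<in> B"
      using that sat by (metis imageE)
    then show ?thesis
      by (simp add: B_def)
  qed
  ultimately show ?thesis
    using that by blast
qed

lemma centre_locally_constant:
  assumes "z \<in> chart_domain i" "i \<noteq> Center"
  shows "\<exists>N. open N \<and> z \<in> N \<and> (\<forall>y\<in>N. centre i y = centre i z)"
proof -
  let ?n = "\<lfloor>snd z + chart_offset i\<rfloor>"
  let ?N = "{y :: real \<times> real. of_int ?n < snd y + chart_offset i} \<inter> {y. snd y + chart_offset i < of_int ?n + 1}"
  have "open ?N"
    by (intro open_Int open_Collect_less continuous_intros)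
  moreover have "of_int ?n \<noteq> snd z + chart_offset i"
    using assms by (metis (mono_tags, lifting) Ints_of_int chart_domain_def mem_Collect_eq)
  then have "z \<in> ?N"
    using floor_correct[of "snd z + chart_offset i"] by (auto intro: le_neq_trans)
  moreover have "centre i y = centre i z" if "y \<in> ?N" for y
  proof -
    have "\<lfloor>snd y + chart_offset i\<rfloor> = ?n"
      using that by (auto simp: floor_eq_iff)
    then show ?thesis
      using assms(2) by (simp add: centre_def)
  qed
  ultimately show ?thesis
    by blast
qed

end

section \<open>Homomorphisms from the surface group\<close>

lemma path_class_eqI: "homotopic_paths S p p' \<Longrightarrow> path_class S p = path_class S p'"
  unfolding path_class_def by (blast intro: homotopic_paths_sym homotopic_paths_trans)

lemma homotopic_paths_const_left:
  assumes "path p" "path_image p \<subseteq> S" "pathstart p = x"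
  shows "homotopic_paths S ((\<lambda>_. x) +++ p) p"
proof (rule homotopic_paths_sym)
  let ?f = "\<lambda>t::real. max 0 (2 * t - 1)"
  show "homotopic_paths S p ((\<lambda>_. x) +++ p)"
  proof (rule homotopic_paths_reparametrize[where f = ?f])
    show "continuous_on {0..1} ?f"
      by (intro continuous_intros)
    show "?f \<in> {0..1} \<rightarrow> {0..1}" "?f 0 = 0" "?f 1 = 1"
      by auto
    show "((\<lambda>_. x) +++ p) t = p (?f t)" for t
      using assms by (auto simp: joinpaths_def pathstart_def)
  qed (use assms in auto)
qed

lemma path_convex_image:
  fixes k :: "'c::real_normed_vector \<Rightarrow> 's::topological_space"
  assumes k: "continuous_on C k" "k ` C \<subseteq> S" and C: "convex C" and ab: "a \<in> C" "b \<in> C"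
  shows "path (k \<circ> linepath a b)" "path_image (k \<circ> linepath a b) \<subseteq> S"
proof -
  have seg: "path_image (linepath a b) \<subseteq> C"
    using ab C by (simp add: closed_segment_subset)
  then show "path (k \<circ> linepath a b)"
    by (intro path_continuous_image[OF path_linepath continuous_on_subset[OF k(1)]])
  show "path_image (k \<circ> linepath a b) \<subseteq> S"
    unfolding path_image_compose using seg k(2) by blast
qed

lemma homotopic_paths_convex_triangle:
  fixes k :: "'c::real_normed_vector \<Rightarrow> 's::topological_space"
  assumes k: "continuous_on C k" "k ` C \<subseteq> S" and C: "convex C" and abc: "a \<in> C" "b \<in> C" "c \<in> C"
  shows "homotopic_paths S ((k \<circ> linepath a b) +++ (k \<circ> linepath b c)) (k \<circ> linepath a c)"
proof -
  have seg: "closed_segment a b \<subseteq> C" "closed_segment b c \<subseteq> C" "closed_segment a c \<subseteq> C"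
    by (intro closed_segment_subset abc C)+
  have "homotopic_paths C (linepath a b +++ linepath b c) (linepath a c)"
  proof (rule homotopic_paths_linear)
    fix t :: real assume "t \<in> {0..1}"
    then have "(linepath a b +++ linepath b c) t \<in> path_image (linepath a b +++ linepath b c)"
      "linepath a c t \<in> path_image (linepath a c)"
      by (auto simp: path_image_def)
    then have "(linepath a b +++ linepath b c) t \<in> C" "linepath a c t \<in> C"
      using seg by (auto simp: path_image_join)
    then show "closed_segment ((linepath a b +++ linepath b c) t) (linepath a c t) \<subseteq> C"
      using C by (simp add: closed_segment_subset)
  qed auto
  from homotopic_paths_continuous_image[OF this k(1)] k(2) show ?thesis
    by (auto simp: path_compose_join image_subset_iff_funcset)
qed

lemma linepath_const: "k \<circ> linepath a a = (\<lambda>_. k a)"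
  by (auto simp: linepath_def algebra_simps simp flip: scaleR_left_distrib)

context group_cocycle
begin

definition holonomy :: "(real \<Rightarrow> 's) set \<Rightarrow> 'k" where
  "holonomy P = transport (SOME p. homotopic_paths S p p \<and> P = path_class S p)"

lemma holonomy_path_class:
  assumes "path p" "path_image p \<subseteq> S"
  shows "holonomy (path_class S p) = transport p"
proof -
  let ?Q = "\<lambda>p'. homotopic_paths S p' p' \<and> path_class S p = path_class S p'"
  have "?Q p"
    using assms by simp
  then have "?Q (SOME p'. ?Q p')"
    by (rule someI[of ?Q])
  then have "homotopic_paths S p (SOME p'. ?Q p')"
    unfolding path_class_def by blast
  then show ?thesis
    unfolding holonomy_def by (simp add: transport_homotopic)
qed

lemma holonomy_hom: "holonomy \<in> hom (fundamental_group S s) K"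
proof (rule homI)
  fix P assume "P \<in> carrier (fundamental_group S s)"
  then show "holonomy P \<in> carrier K"
    by (auto simp: fundamental_group_def loops_def holonomy_path_class transport_closed)
next
  fix P Q assume "P \<in> carrier (fundamental_group S s)" "Q \<in> carrier (fundamental_group S s)"
  then obtain p p' where p: "p \<in> loops S s" "P = path_class S p" "p' \<in> loops S s" "Q = path_class S p'"
    by (auto simp: fundamental_group_def)
  then have "path p" "path_image p \<subseteq> S" "path p'" "path_image p' \<subseteq> S" "pathfinish p = pathstart p'"
    "path (p +++ p')" "path_image (p +++ p') \<subseteq> S"
    by (auto simp: loops_def path_image_join)
  then show "holonomy (P \<otimes>\<^bsub>fundamental_group S s\<^esub> Q) = holonomy P \<otimes> holonomy Q"
    using p by (simp add: fundamental_group_mult holonomy_path_class transport_join)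
qed

end

text \<open>
  Crossing from side \<open>k\<close> to its partner \<open>k + 2\<close> multiplies by \<open>\<alpha> k\<close>, and \<open>\<nu> m\<close> is the label of the sector at
  vertex \<open>m\<close>. The conditions at the two ends of each side determine \<open>\<nu>\<close> from \<open>\<alpha>\<close>, and \<open>\<nu> (4 * g) = \<one>\<close> is
  then the relation of the surface group.
\<close>

definition side_relation ::
    "('k, 'm) monoid_scheme \<Rightarrow> nat \<Rightarrow> (nat \<Rightarrow> 'k) \<Rightarrow> (nat \<Rightarrow> 'k) \<Rightarrow> bool" where
  "side_relation K g \<alpha> \<nu> \<longleftrightarrow>
    range \<alpha> \<subseteq> carrier K \<and> range \<nu> \<subseteq> carrier K \<and> \<nu> 0 = \<one>\<^bsub>K\<^esub> \<and> \<nu> (4 * g) = \<one>\<^bsub>K\<^esub> \<and>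
    (\<forall>k<4 * g. k mod 4 < 2 \<longrightarrow>
      \<nu> (k + 3) = \<nu> k \<otimes>\<^bsub>K\<^esub> \<alpha> k \<and> \<nu> (k + 2) = \<nu> (k + 1) \<otimes>\<^bsub>K\<^esub> \<alpha> k)"

definition sheet :: "('k, 'm) monoid_scheme \<Rightarrow> (nat \<Rightarrow> 'k) \<Rightarrow> (nat \<Rightarrow> 'k) \<Rightarrow> real \<times> real \<Rightarrow> 'k" where
  "sheet K \<alpha> \<nu> z =
    (if fst z = 0 then \<one>\<^bsub>K\<^esub>
     else let k = nat \<lfloor>snd z\<rfloor> in
       if snd z \<in> \<int> then \<nu> k else if k mod 4 < 2 then \<one>\<^bsub>K\<^esub> else \<alpha> (k - 2))"

lemma sheet_simps:
  "sheet K \<alpha> \<nu> (0, \<theta>) = \<one>\<^bsub>K\<^esub>"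
  "sheet K \<alpha> \<nu> (1, real k) = \<nu> k"
  "sheet K \<alpha> \<nu> (1, real k + 1 / 2) = (if k mod 4 < 2 then \<one>\<^bsub>K\<^esub> else \<alpha> (k - 2))"
proof -
  have "real k + 1 / 2 \<notin> \<int>"
    by (simp add: add_in_Ints_iff_left fraction_not_in_Ints)
  moreover have "nat \<lfloor>real k + 1 / 2\<rfloor> = k"
    by (simp add: floor_eq_iff nat_eq_iff)
  ultimately show "sheet K \<alpha> \<nu> (1, real k + 1 / 2) = (if k mod 4 < 2 then \<one>\<^bsub>K\<^esub> else \<alpha> (k - 2))"
    by (simp add: sheet_def Let_def)
qed (simp_all add: sheet_def)

lemma sheet_closed:
  assumes "group K" "side_relation K g \<alpha> \<nu>"
  shows "sheet K \<alpha> \<nu> z \<in> carrier K"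
proof -
  interpret group K by fact
  show ?thesis
    using assms(2) by (auto simp: sheet_def side_relation_def Let_def)
qed

lemma sheet_glued:
  assumes "group K" and rel: "side_relation K g \<alpha> \<nu>" and k: "k < 4 * g" "k mod 4 < 2"
    and t: "t \<in> {0, 1 / 2, 1}"
  shows "sheet K \<alpha> \<nu> (1, real k + 3 - t) = sheet K \<alpha> \<nu> (1, real k + t) \<otimes>\<^bsub>K\<^esub> \<alpha> k"
proof -
  interpret group K by fact
  have \<alpha>: "\<alpha> k \<in> carrier K"
    using rel by (auto simp: side_relation_def)
  consider "t = 0" | "t = 1 / 2" | "t = 1"
    using t by blast
  then show ?thesis
  proof cases
    case 1
    have "(1, real k + 3 - t) = (1::real, real (k + 3))" "(1, real k + t) = (1::real, real k)"
      using 1 by auto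
    then show ?thesis
      using rel k by (simp only: sheet_simps side_relation_def)
  next
    case 2
    have e: "(1, real k + 3 - t) = (1::real, real (k + 2) + 1 / 2)" "(1, real k + t) = (1::real, real k + 1 / 2)"
      using 2 by auto
    have "\<not> (k + 2) mod 4 < 2"
      using k(2) by presburger
    then show ?thesis
      unfolding e sheet_simps using k \<alpha> by simp
  next
    case 3
    have "(1, real k + 3 - t) = (1::real, real (k + 2))" "(1, real k + t) = (1::real, real (k + 1))"
      using 3 by auto
    then show ?thesis
      using rel k by (simp only: sheet_simps side_relation_def)
  qed
qed

context polygon
begin

definition rep :: "'s \<Rightarrow> real \<times> real" where
  "rep x = (SOME z. z \<in> R \<and> q z = x)"

lemma rep:
  assumes "x \<in> S"
  shows rep_in: "rep x \<in> R" and q_rep: "q (rep x) = x"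
proof -
  have "\<exists>z. z \<in> R \<and> q z = x"
    using assms q_image by blast
  then have "rep x \<in> R \<and> q (rep x) = x"
    unfolding rep_def by (rule someI_ex)
  then show "rep x \<in> R" "q (rep x) = x"
    by auto
qed

lemma q_in_S: "z \<in> R \<Longrightarrow> q z \<in> S"
  using q_image by blast

lemma chart_image_subset: "chart_image i \<subseteq> S"
  using openin_imp_subset[OF openin_chart_image] .

lemma rep_in_chart: "x \<in> S \<Longrightarrow> rep x \<in> chart_domain i \<longleftrightarrow> x \<in> chart_image i"
  using q_in_chart_image[of "rep x" i] rep by simp

definition local_section ::
    "('k, 'm) monoid_scheme \<Rightarrow> (nat \<Rightarrow> 'k) \<Rightarrow> (nat \<Rightarrow> 'k) \<Rightarrow> chart \<Rightarrow> 's \<Rightarrow> 'k" where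
  "local_section K \<alpha> \<nu> i x = sheet K \<alpha> \<nu> (centre i (rep x))"

lemma sheet_centre_locally_constant:
  assumes "z \<in> chart_domain i"
  shows "\<exists>N. open N \<and> z \<in> N \<and> (\<forall>y\<in>N. sheet K \<alpha> \<nu> (centre i y) = sheet K \<alpha> \<nu> (centre i z))"
proof (cases "i = Center")
  case True
  then show ?thesis
    by (intro exI[of _ UNIV]) (simp add: centre_def sheet_simps)
next
  case False
  from centre_locally_constant[OF assms this] show ?thesis
    by metis
qed

lemma sheet_transition_invariant:
  assumes K: "group K" and rel: "side_relation K g \<alpha> \<nu>" and A: "A = chart_domain i \<inter> chart_domain j"
  defines "\<kappa> \<equiv> \<lambda>z. sheet K \<alpha> \<nu> (centre i z) \<otimes>\<^bsub>K\<^esub> inv\<^bsub>K\<^esub> sheet K \<alpha> \<nu> (centre j z)"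
  shows "gluing_invariant g (\<lambda>z. if z \<in> A then Some (\<kappa> z) else None)"
proof (rule invariant_on_charts[OF A])
  interpret group K by fact
  fix \<theta> assume "(0, \<theta>) \<in> A"
  then have "i = Center" "j = Center"
    by (auto simp: A chart_domain_origin)
  then show "\<kappa> (0, \<theta>) = \<kappa> (0, 0)"
    by (simp add: \<kappa>_def centre_def sheet_simps)
next
  fix r assume r: "(r, 0) \<in> A"
  have "\<nu> 0 = \<nu> (4 * g)"
    using rel by (simp add: side_relation_def)
  then have "sheet K \<alpha> \<nu> (centre l (r, real (4 * g))) = sheet K \<alpha> \<nu> (centre l (r, 0))"
    if "(r, 0) \<in> chart_domain l" for l
    using centre_seam[OF that] sheet_simps(2)[of K \<alpha> \<nu> 0] sheet_simps(2)[of K \<alpha> \<nu> "4 * g"]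
    by (simp add: sheet_simps(1) del: of_nat_mult)
  then show "\<kappa> (r, real (4 * g)) = \<kappa> (r, 0)"
    using r by (simp add: \<kappa>_def A del: of_nat_mult)
next
  interpret group K by fact
  fix k and t :: real
  assume k: "k < 4 * g" "k mod 4 < 2" "t \<in> {0..1}" and t: "(1, real k + t) \<in> A"
  have s: "sheet K \<alpha> \<nu> (centre l (1, real k + 3 - t)) =
      sheet K \<alpha> \<nu> (centre l (1, real k + t)) \<otimes>\<^bsub>K\<^esub> \<alpha> k"
    if l: "(1, real k + t) \<in> chart_domain l" for l
  proof -
    obtain t' where t': "t' \<in> {0, 1 / 2, 1}" "centre l (1, real k + t) = (1, real k + t')"
      "centre l (1, real k + 3 - t) = (1, real k + 3 - t')"
      using centre_glued[OF k disjI1[OF l]] by metis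
    show ?thesis
      unfolding t'(2,3) by (rule sheet_glued[OF K rel k(1,2) t'(1)])
  qed
  have "\<alpha> k \<in> carrier K"
    using rel by (auto simp: side_relation_def)
  then have "x \<otimes>\<^bsub>K\<^esub> inv\<^bsub>K\<^esub> y = (x \<otimes>\<^bsub>K\<^esub> \<alpha> k) \<otimes>\<^bsub>K\<^esub> inv\<^bsub>K\<^esub> (y \<otimes>\<^bsub>K\<^esub> \<alpha> k)"
    if "x \<in> carrier K" "y \<in> carrier K" for x y
    using that by (simp add: inv_mult_group m_assoc flip: m_assoc[of "\<alpha> k"])
  then show "\<kappa> (1, real k + t) = \<kappa> (1, real k + 3 - t)"
    using s[of i] s[of j] t sheet_closed[OF K rel] unfolding \<kappa>_def A by (metis IntD1 IntD2)
qed

lemma sheet_transition_descends: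
  assumes K: "group K" and rel: "side_relation K g \<alpha> \<nu>"
    and z: "z \<in> chart_domain i" "z \<in> chart_domain j"
  obtains M where "openin (top_of_set S) M" "q z \<in> M"
    "\<And>z'. z' \<in> R \<Longrightarrow> q z' \<in> M \<Longrightarrow>
      sheet K \<alpha> \<nu> (centre i z') \<otimes>\<^bsub>K\<^esub> inv\<^bsub>K\<^esub> sheet K \<alpha> \<nu> (centre j z') =
      sheet K \<alpha> \<nu> (centre i z) \<otimes>\<^bsub>K\<^esub> inv\<^bsub>K\<^esub> sheet K \<alpha> \<nu> (centre j z)"
proof -
  let ?\<kappa> = "\<lambda>z. sheet K \<alpha> \<nu> (centre i z) \<otimes>\<^bsub>K\<^esub> inv\<^bsub>K\<^esub> sheet K \<alpha> \<nu> (centre j z)"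
  have "\<exists>N. open N \<and> y \<in> N \<and> (\<forall>x\<in>N. x \<in> chart_domain i \<inter> chart_domain j \<longrightarrow> ?\<kappa> x = ?\<kappa> y)"
    if y: "y \<in> chart_domain i \<inter> chart_domain j" for y
  proof -
    obtain N where N: "open N" "y \<in> N" "\<forall>x\<in>N. sheet K \<alpha> \<nu> (centre i x) = sheet K \<alpha> \<nu> (centre i y)"
      using sheet_centre_locally_constant[of y i K \<alpha> \<nu>] y by blast
    obtain N' where N': "open N'" "y \<in> N'" "\<forall>x\<in>N'. sheet K \<alpha> \<nu> (centre j x) = sheet K \<alpha> \<nu> (centre j y)"
      using sheet_centre_locally_constant[of y j K \<alpha> \<nu>] y by blast
    show ?thesis
    proof (intro exI[of _ "N \<inter> N'"] conjI ballI impI)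
      fix x assume "x \<in> N \<inter> N'"
      then have "sheet K \<alpha> \<nu> (centre i x) = sheet K \<alpha> \<nu> (centre i y)"
        "sheet K \<alpha> \<nu> (centre j x) = sheet K \<alpha> \<nu> (centre j y)"
        using N(3) N'(3) by blast+
      then show "?\<kappa> x = ?\<kappa> y"
        by (simp only:)
    qed (use N(1,2) N'(1,2) in auto)
  qed
  note loc = this
  obtain M where "openin (top_of_set S) M" "q z \<in> M"
    "\<And>z'. z' \<in> R \<Longrightarrow> q z' \<in> M \<Longrightarrow> z' \<in> chart_domain i \<inter> chart_domain j \<and> ?\<kappa> z' = ?\<kappa> z"
    by (rule descend_locally_constant[OF refl IntI[OF z] sheet_transition_invariant[OF K rel refl] loc])
      (assumption, (rule that; assumption))
  then show ?thesis
    by (intro that[of M]) blast+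
qed

lemma group_cocycle_local_section:
  assumes K: "group K" and rel: "side_relation K g \<alpha> \<nu>"
  shows "group_cocycle K S chart_image (local_section K \<alpha> \<nu>)"
proof -
  interpret group K by fact
  show ?thesis
  proof
    fix x assume x: "x \<in> S"
    then show "\<exists>i. x \<in> chart_image i"
      using chart_domain_cover[OF rep_in] rep_in_chart by blast
  next
    fix i
    show "openin (top_of_set S) (chart_image i)"
      by (rule openin_chart_image)
  next
    fix x i
    show "local_section K \<alpha> \<nu> i x \<in> carrier K"
      unfolding local_section_def by (rule sheet_closed[OF K rel])
  next
    fix x i j assume x: "x \<in> chart_image i" "x \<in> chart_image j"
    have xS: "x \<in> S"
      using x chart_image_subset by blast
    then have "rep x \<in> chart_domain i" "rep x \<in> chart_domain j"
      using x rep_in_chart by auto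
    then obtain M where M: "openin (top_of_set S) M" "q (rep x) \<in> M"
      "\<And>z'. z' \<in> R \<Longrightarrow> q z' \<in> M \<Longrightarrow>
        sheet K \<alpha> \<nu> (centre i z') \<otimes>\<^bsub>K\<^esub> inv\<^bsub>K\<^esub> sheet K \<alpha> \<nu> (centre j z') =
        sheet K \<alpha> \<nu> (centre i (rep x)) \<otimes>\<^bsub>K\<^esub> inv\<^bsub>K\<^esub> sheet K \<alpha> \<nu> (centre j (rep x))"
      using sheet_transition_descends[OF K rel] by blast
    show "\<exists>N. openin (top_of_set S) N \<and> x \<in> N \<and> (\<forall>y\<in>N. y \<in> chart_image i \<longrightarrow> y \<in> chart_image j \<longrightarrow>
      local_section K \<alpha> \<nu> i y \<otimes>\<^bsub>K\<^esub> inv\<^bsub>K\<^esub> local_section K \<alpha> \<nu> j y =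
      local_section K \<alpha> \<nu> i x \<otimes>\<^bsub>K\<^esub> inv\<^bsub>K\<^esub> local_section K \<alpha> \<nu> j x)"
    proof (intro exI conjI ballI impI)
      show "openin (top_of_set S) M" "x \<in> M"
        using M(1,2) q_rep[OF xS] by simp_all
      fix y assume y: "y \<in> M"
      then have "y \<in> S"
        using openin_imp_subset[OF M(1)] by blast
      then show "local_section K \<alpha> \<nu> i y \<otimes>\<^bsub>K\<^esub> inv\<^bsub>K\<^esub> local_section K \<alpha> \<nu> j y =
        local_section K \<alpha> \<nu> i x \<otimes>\<^bsub>K\<^esub> inv\<^bsub>K\<^esub> local_section K \<alpha> \<nu> j x"
        unfolding local_section_def using M(3)[of "rep y"] rep[of y] y by simp
    qed
  qed
qed

definition lifted_sheet ::
    "('k, 'm) monoid_scheme \<Rightarrow> (nat \<Rightarrow> 'k) \<Rightarrow> (nat \<Rightarrow> 'k) \<Rightarrow> real \<times> real \<Rightarrow> 'k" where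
  "lifted_sheet K \<alpha> \<nu> z = (let i = SOME i. z \<in> chart_domain i in
    inv\<^bsub>K\<^esub> sheet K \<alpha> \<nu> (centre i z) \<otimes>\<^bsub>K\<^esub> sheet K \<alpha> \<nu> (centre i (rep (q z))))"

lemma lifted_sheet_eq:
  assumes K: "group K" and rel: "side_relation K g \<alpha> \<nu>" and z: "z \<in> chart_domain i"
  shows "lifted_sheet K \<alpha> \<nu> z =
    inv\<^bsub>K\<^esub> sheet K \<alpha> \<nu> (centre i z) \<otimes>\<^bsub>K\<^esub> local_section K \<alpha> \<nu> i (q z)"
proof -
  interpret group K by fact
  let ?f = "\<lambda>i z. sheet K \<alpha> \<nu> (centre i z)"
  define j where "j = (SOME i. z \<in> chart_domain i)"
  have j: "z \<in> chart_domain j"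
    unfolding j_def using z by (rule someI)
  have zR: "z \<in> R"
    using z chart_domain_subset by blast
  let ?z = "rep (q z)"
  have z': "?z \<in> R" "q ?z = q z"
    using rep[OF q_in_S[OF zR]] by auto
  have "?z \<in> chart_domain i \<inter> chart_domain j"
    using chart_domain_saturated[OF zR z'(1) z'(2)[symmetric]] z j by blast
  then have "?f i z \<otimes>\<^bsub>K\<^esub> inv\<^bsub>K\<^esub> ?f j z = ?f i ?z \<otimes>\<^bsub>K\<^esub> inv\<^bsub>K\<^esub> ?f j ?z"
    using invariant_fibre[OF sheet_transition_invariant[OF K rel refl, of i j] zR z'(1) z'(2)[symmetric]] z j
    by simp
  moreover have c: "?f l y \<in> carrier K" for l y
    using sheet_closed[OF K rel] .
  ultimately have "?f i ?z = ?f i z \<otimes>\<^bsub>K\<^esub> inv\<^bsub>K\<^esub> ?f j z \<otimes>\<^bsub>K\<^esub> ?f j ?z"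
    by (simp add: m_assoc)
  then have "inv\<^bsub>K\<^esub> ?f i z \<otimes>\<^bsub>K\<^esub> ?f i ?z = inv\<^bsub>K\<^esub> ?f j z \<otimes>\<^bsub>K\<^esub> ?f j ?z"
    using c by (simp add: m_assoc flip: m_assoc[of "inv\<^bsub>K\<^esub> ?f i z"])
  then show ?thesis
    by (simp add: lifted_sheet_def local_section_def flip: j_def)
qed

lemma lifted_sheet_rep:
  assumes K: "group K" and rel: "side_relation K g \<alpha> \<nu>" and x: "x \<in> S"
  shows "lifted_sheet K \<alpha> \<nu> (rep x) = \<one>\<^bsub>K\<^esub>"
proof -
  interpret group K by fact
  obtain i where "rep x \<in> chart_domain i"
    using chart_domain_cover[OF rep_in[OF x]] by blast
  then show ?thesis
    using lifted_sheet_eq[OF K rel] q_rep[OF x] sheet_closed[OF K rel]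
    by (simp add: local_section_def)
qed

lemma lifted_sheet_horizontal:
  assumes K: "group K" and rel: "side_relation K g \<alpha> \<nu>"
  shows "group_cocycle.horizontal K chart_image (local_section K \<alpha> \<nu>) R q (lifted_sheet K \<alpha> \<nu>)"
proof -
  interpret group_cocycle K S chart_image "local_section K \<alpha> \<nu>"
    by (rule group_cocycle_local_section[OF K rel])
  let ?f = "\<lambda>i z. sheet K \<alpha> \<nu> (centre i z)"
  have c: "?f i z \<in> carrier K" "local_section K \<alpha> \<nu> i y \<in> carrier K" for i z y
    using sheet_closed[OF K rel] by (auto simp: local_section_def)
  show ?thesis
  proof (rule horizontalI)
    fix z assume "z \<in> R"
    then show "lifted_sheet K \<alpha> \<nu> z \<in> carrier K"
      using chart_domain_cover lifted_sheet_eq[OF K rel] c by (metis K.inv_closed K.m_closed)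
  next
    fix z i assume z: "z \<in> R" "q z \<in> chart_image i"
    have eq: "lifted_sheet K \<alpha> \<nu> y \<otimes>\<^bsub>K\<^esub> inv\<^bsub>K\<^esub> local_section K \<alpha> \<nu> i (q y) = inv\<^bsub>K\<^esub> ?f i y"
      if "y \<in> chart_domain i" for y
      using lifted_sheet_eq[OF K rel that] c by (simp add: K.m_assoc)
    have zi: "z \<in> chart_domain i"
      using q_in_chart_image z by blast
    obtain N where N: "open N" "z \<in> N" "\<forall>y\<in>N. ?f i y = ?f i z"
      using sheet_centre_locally_constant[OF zi] by blast
    then show "\<exists>N. open N \<and> z \<in> N \<and> (\<forall>y. y \<in> N \<longrightarrow> y \<in> R \<longrightarrow> q y \<in> chart_image i \<longrightarrow>
        lifted_sheet K \<alpha> \<nu> y \<otimes>\<^bsub>K\<^esub> inv\<^bsub>K\<^esub> local_section K \<alpha> \<nu> i (q y) =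
        lifted_sheet K \<alpha> \<nu> z \<otimes>\<^bsub>K\<^esub> inv\<^bsub>K\<^esub> local_section K \<alpha> \<nu> i (q z))"
    proof (intro exI[of _ N] conjI allI impI)
      fix y assume y: "y \<in> N" "y \<in> R" "q y \<in> chart_image i"
      then have "y \<in> chart_domain i"
        using q_in_chart_image by blast
      from eq[OF this] eq[OF zi] N(3) y(1)
      show "lifted_sheet K \<alpha> \<nu> y \<otimes>\<^bsub>K\<^esub> inv\<^bsub>K\<^esub> local_section K \<alpha> \<nu> i (q y) =
        lifted_sheet K \<alpha> \<nu> z \<otimes>\<^bsub>K\<^esub> inv\<^bsub>K\<^esub> local_section K \<alpha> \<nu> i (q z)"
        by simp
    qed (use N(1,2) in auto)
  qed
qed

lemma convex_R: "convex R"
  unfolding polar_rectangle_def by (intro convex_Times) auto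

lemma path_q_linepath:
  assumes "a \<in> R" "b \<in> R"
  shows "path (q \<circ> linepath a b)" "path_image (q \<circ> linepath a b) \<subseteq> S"
  by (rule path_convex_image[OF q_continuous equalityD1[OF q_image] convex_R assms])+

lemma transport_q_linepath:
  assumes K: "group K" and rel: "side_relation K g \<alpha> \<nu>" and ab: "a \<in> R" "b \<in> R"
  shows "group_cocycle.transport K chart_image (local_section K \<alpha> \<nu>) (q \<circ> linepath a b) =
    inv\<^bsub>K\<^esub> lifted_sheet K \<alpha> \<nu> a \<otimes>\<^bsub>K\<^esub> lifted_sheet K \<alpha> \<nu> b"
proof -
  interpret group_cocycle K S chart_image "local_section K \<alpha> \<nu>"
    by (rule group_cocycle_local_section[OF K rel])
  have "linepath a b ` {0..1} \<subseteq> R"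
    using closed_segment_subset[OF ab convex_R] path_image_linepath[of a b] by (simp add: path_image_def)
  then have "horizontal {0..1} (q \<circ> linepath a b) (lifted_sheet K \<alpha> \<nu> \<circ> linepath a b)"
    by (intro horizontal_compose[OF lifted_sheet_horizontal[OF K rel]] continuous_on_linepath)
  from transport_eq[OF path_q_linepath[OF ab] this] show ?thesis
    by (simp add: linepath_def)
qed

end

section \<open>The tautological cocycle\<close>

context polygon
begin

lemma R_vertex: "m \<le> 4 * g \<Longrightarrow> (1, real m) \<in> R"
  by (auto simp: polar_rectangle_def simp del: of_nat_mult)

definition anchor :: "real \<times> real \<Rightarrow> real \<times> real" where
  "anchor c =
    (if fst c = 0 then (0, 0)
     else if snd c \<in> \<int> then (1, 0)
     else if nat \<lfloor>snd c\<rfloor> mod 4 < 2 then c else (1, snd c - 2))"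

lemma anchor_simps:
  "anchor (0, \<theta>) = (0, 0)"
  "anchor (1, real m) = (1, 0)"
  "anchor (1, real k + 1 / 2) = (1, if k mod 4 < 2 then real k + 1 / 2 else real k - 3 / 2)"
proof -
  have "real k + 1 / 2 \<notin> \<int>"
    by (simp add: add_in_Ints_iff_left fraction_not_in_Ints)
  moreover have "nat \<lfloor>real k + 1 / 2\<rfloor> = k"
    by (simp add: floor_eq_iff nat_eq_iff)
  ultimately show "anchor (1, real k + 1 / 2) = (1, if k mod 4 < 2 then real k + 1 / 2 else real k - 3 / 2)"
    by (simp add: anchor_def)
qed (simp_all add: anchor_def)

lemma anchor_glued:
  assumes k: "k mod 4 < 2" and t: "t \<in> {0, 1 / 2, 1}"
  shows "anchor (1, real k + 3 - t) = anchor (1, real k + t)"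
proof -
  consider "t = 0" | "t = 1 / 2" | "t = 1"
    using t by blast
  then show ?thesis
  proof cases
    case 1
    then have "(1, real k + 3 - t) = (1::real, real (k + 3))" "(1, real k + t) = (1::real, real k)"
      by auto
    then show ?thesis
      by (simp only: anchor_simps)
  next
    case 2
    then have e: "(1, real k + 3 - t) = (1::real, real (k + 2) + 1 / 2)" "(1, real k + t) = (1::real, real k + 1 / 2)"
      by auto
    have "\<not> (k + 2) mod 4 < 2"
      using k by presburger
    then show ?thesis
      unfolding e anchor_simps using k by simp
  next
    case 3
    then have "(1, real k + 3 - t) = (1::real, real (k + 2))" "(1, real k + t) = (1::real, real (k + 1))"
      by auto
    then show ?thesis
      by (simp only: anchor_simps)
  qed
qed

lemma centre_cases:
  assumes z: "z \<in> chart_domain i"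
  obtains \<theta> where "i = Center" "centre i z = (0, \<theta>)" "\<theta> \<in> {0..real (4 * g)}"
    | k where "i = Edge" "k < 4 * g" "centre i z = (1, real k + 1 / 2)"
    | m where "i = Vertex" "m \<le> 4 * g" "centre i z = (1, real m)"
proof (cases i)
  case Center
  then show ?thesis
    using z by (intro that(1)[of "snd z"]) (auto simp: chart_domain_def centre_def polar_rectangle_def)
next
  case Edge
  have b: "0 \<le> snd z" "snd z \<le> real (4 * g)" "snd z \<notin> \<int>"
    using z Edge by (auto simp: chart_domain_def polar_rectangle_def chart_offset_def)
  moreover have "snd z \<noteq> real (4 * g)"
    using b(3) Ints_of_nat by metis
  ultimately have "\<lfloor>snd z\<rfloor> < int (4 * g)" "0 \<le> \<lfloor>snd z\<rfloor>"
    by (simp_all add: floor_less_iff del: of_nat_mult)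
  then show ?thesis
    using Edge by (intro that(2)[of "nat \<lfloor>snd z\<rfloor>"]) (simp_all only: nat_less_iff, simp_all add: centre_def chart_offset_def)
next
  case Vertex
  have b: "0 \<le> snd z" "snd z \<le> real (4 * g)"
    using z by (auto simp: chart_domain_def polar_rectangle_def)
  then have "\<lfloor>snd z + 1 / 2\<rfloor> \<le> int (4 * g)" "0 \<le> \<lfloor>snd z + 1 / 2\<rfloor>"
    by (simp_all only: floor_le_iff le_floor_iff)
  then show ?thesis
    using Vertex by (intro that(3)[of "nat \<lfloor>snd z + 1 / 2\<rfloor>"]) (auto simp: centre_def chart_offset_def)
qed

lemma q_vertex: "m \<le> 4 * g \<Longrightarrow> q (1, real m) = q (1, 0)"
proof -
  have block: "q (1, real (4 * i + j)) = q (1, real (4 * i))" if "i < g" "j \<le> 4" for i j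
  proof -
    have k: "4 * i < 4 * g" "(4 * i) mod 4 < 2" "4 * i + 1 < 4 * g" "(4 * i + 1) mod 4 < (2::nat)"
      using that by auto
    have "q (1, real (4 * i)) = q (1, real (4 * i + 3))"
      using q_glued(3)[OF k(1,2), of 0] by simp
    moreover have "q (1, real (4 * i + 1)) = q (1, real (4 * i + 2))"
      using q_glued(3)[OF k(1,2), of 1] by (simp add: add.commute)
    moreover have "q (1, real (4 * i + 1)) = q (1, real (4 * i + 4))"
      using q_glued(3)[OF k(3,4), of 0] by (simp add: add.commute)
    moreover have "q (1, real (4 * i + 2)) = q (1, real (4 * i + 3))"
      using q_glued(3)[OF k(3,4), of 1] by (simp add: add.commute)
    moreover have "j \<in> {0, 1, 2, 3, 4}"
      using that(2) by auto
    ultimately show ?thesis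
      by (elim insertE emptyE) (simp_all only: add_0_right)
  qed
  have origin: "q (1, real (4 * i)) = q (1, 0)" if "i \<le> g" for i
    using that
  proof (induction i)
    case (Suc i)
    then show ?case
      using block[of i 4] by (simp add: add.commute)
  qed simp
  assume m: "m \<le> 4 * g"
  show ?thesis
  proof (cases "m = 4 * g")
    case True
    then show ?thesis
      using origin[of g] by simp
  next
    case False
    then have "m div 4 < g" "m mod 4 \<le> 4"
      using m by auto
    then show ?thesis
      using block[of "m div 4" "m mod 4"] origin[of "m div 4"] by simp
  qed
qed

lemma centre_in_R:
  assumes "z \<in> chart_domain i"
  shows "centre i z \<in> R"
  using assms
proof (cases rule: centre_cases)
  case (2 k)
  then have "real k + 1 \<le> real (4 * g)"
    by linarith
  then show ?thesis
    using 2 by (simp add: polar_rectangle_def)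
qed (use R_vertex in \<open>auto simp: polar_rectangle_def\<close>)

lemma anchor_descends:
  assumes z: "z \<in> chart_domain i"
  obtains M where "openin (top_of_set S) M" "q z \<in> M"
    "\<And>z'. z' \<in> R \<Longrightarrow> q z' \<in> M \<Longrightarrow> anchor (centre i z') = anchor (centre i z)"
proof -
  have inv: "gluing_invariant g (\<lambda>z. if z \<in> chart_domain i \<inter> chart_domain i then Some (anchor (centre i z)) else None)"
  proof (rule invariant_on_charts[OF refl])
    fix \<theta> assume "(0, \<theta>) \<in> chart_domain i \<inter> chart_domain i"
    then show "anchor (centre i (0, \<theta>)) = anchor (centre i (0, 0))"
      by (simp add: chart_domain_origin centre_def anchor_simps)
  next
    fix r assume "(r, 0) \<in> chart_domain i \<inter> chart_domain i"
    then show "anchor (centre i (r, real (4 * g))) = anchor (centre i (r, 0))"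
      using anchor_simps(2)[of "4 * g"] anchor_simps(2)[of 0]
      by (simp add: centre_seam anchor_simps(1) del: of_nat_mult)
  next
    fix k and t :: real
    assume k: "k < 4 * g" "k mod 4 < 2" "t \<in> {0..1}"
      and t: "(1, real k + t) \<in> chart_domain i \<inter> chart_domain i"
    obtain t' where t': "t' \<in> {0, 1 / 2, 1}" "centre i (1, real k + t) = (1, real k + t')"
      "centre i (1, real k + 3 - t) = (1, real k + 3 - t')"
      using centre_glued[OF k, of i] t by (metis IntD1)
    show "anchor (centre i (1, real k + t)) = anchor (centre i (1, real k + 3 - t))"
      unfolding t' using anchor_glued[OF k(2) t'(1)] by simp
  qed
  have loc: "\<exists>N. open N \<and> y \<in> N \<and> (\<forall>x\<in>N. x \<in> chart_domain i \<inter> chart_domain i \<longrightarrow>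
      anchor (centre i x) = anchor (centre i y))"
    if "y \<in> chart_domain i \<inter> chart_domain i" for y
  proof (cases "i = Center")
    case True
    then show ?thesis
      by (intro exI[of _ UNIV]) (simp add: centre_def anchor_simps)
  next
    case False
    then show ?thesis
      using centre_locally_constant[of y i] that by (metis IntD1)
  qed
  show ?thesis
    by (rule descend_locally_constant[OF refl IntI[OF z z] inv loc])
      (assumption, rule that, assumption, assumption, blast)
qed

end

locale based_polygon = polygon g S q
  for g :: nat and S :: "'s::topological_space set" and q :: "real \<times> real \<Rightarrow> 's" +
  fixes s :: 's
  assumes s_in: "s \<in> S"
begin

abbreviation G where "G \<equiv> fundamental_group S s"

sublocale G: group G
  by (rule group_fundamental_group[OF s_in])

definition base :: "real \<times> real" where "base = rep s"

lemma base: "base \<in> R" "q base = s" "rep s = base"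
  using rep[OF s_in] by (simp_all add: base_def)

definition loop_class :: "(real \<Rightarrow> 's) \<Rightarrow> (real \<Rightarrow> 's) set" where
  "loop_class p =
    path_class S ((q \<circ> linepath base (rep (pathstart p))) +++ (p +++ (q \<circ> linepath (rep (pathfinish p)) base)))"

lemma spokes:
  assumes "x \<in> S"
  shows "path (q \<circ> linepath base (rep x))" "path_image (q \<circ> linepath base (rep x)) \<subseteq> S"
    "path (q \<circ> linepath (rep x) base)" "path_image (q \<circ> linepath (rep x) base) \<subseteq> S"
    "pathstart (q \<circ> linepath base (rep x)) = s" "pathfinish (q \<circ> linepath base (rep x)) = x"
    "pathstart (q \<circ> linepath (rep x) base) = x" "pathfinish (q \<circ> linepath (rep x) base) = s"
  using path_q_linepath base rep[OF assms] by (auto simp: pathstart_compose pathfinish_compose)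

lemma path_ends_in:
  assumes "path_image p \<subseteq> S"
  shows "pathstart p \<in> S" "pathfinish p \<in> S"
  using assms pathstart_in_path_image pathfinish_in_path_image by blast+

lemma loop_class_loop:
  assumes "path p" "path_image p \<subseteq> S"
  shows "(q \<circ> linepath base (rep (pathstart p))) +++ (p +++ (q \<circ> linepath (rep (pathfinish p)) base)) \<in> loops S s"
  using assms spokes[OF path_ends_in(1)[OF assms(2)]] spokes[OF path_ends_in(2)[OF assms(2)]]
  by (auto simp: loops_def path_image_join)

lemma loop_class_closed: "path p \<Longrightarrow> path_image p \<subseteq> S \<Longrightarrow> loop_class p \<in> carrier G"
  using loop_class_loop by (auto simp: loop_class_def fundamental_group_def)

lemma loop_class_homotopic:
  assumes "homotopic_paths S p p'"
  shows "loop_class p = loop_class p'"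
proof -
  have p: "path p" "path_image p \<subseteq> S"
    using homotopic_paths_imp_path[OF assms] homotopic_paths_imp_subset[OF assms] by auto
  have e: "pathstart p' = pathstart p" "pathfinish p' = pathfinish p"
    using homotopic_paths_imp_pathstart[OF assms] homotopic_paths_imp_pathfinish[OF assms] by auto
  show ?thesis
    unfolding loop_class_def e
    using assms spokes[OF path_ends_in(1)[OF p(2)]] spokes[OF path_ends_in(2)[OF p(2)]]
    by (intro path_class_eqI homotopic_paths_join) auto
qed

lemma loop_class_cong:
  assumes "path p" "path_image p \<subseteq> S" "\<And>t. t \<in> {0..1} \<Longrightarrow> p t = p' t"
  shows "loop_class p = loop_class p'"
  using assms by (intro loop_class_homotopic homotopic_paths_eq)

lemma loop_class_join:
  assumes p: "path p" "path_image p \<subseteq> S" and p': "path p'" "path_image p' \<subseteq> S"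
    and e: "pathfinish p = pathstart p'"
  shows "loop_class (p +++ p') = loop_class p \<otimes>\<^bsub>G\<^esub> loop_class p'"
proof -
  let ?m = "pathfinish p"
  let ?i = "q \<circ> linepath base (rep (pathstart p))" and ?o = "q \<circ> linepath (rep ?m) base"
  let ?i' = "q \<circ> linepath base (rep ?m)" and ?o' = "q \<circ> linepath (rep (pathfinish p')) base"
  let ?r = "p' +++ ?o'"
  have m: "?m \<in> S"
    using path_ends_in p by blast
  note sp = spokes[OF path_ends_in(1)[OF p(2)]] spokes[OF m] spokes[OF path_ends_in(2)[OF p'(2)]]
  have r: "path ?r" "path_image ?r \<subseteq> S" "pathstart ?r = ?m"
    using p' e sp by (auto simp: path_image_join)
  have "homotopic_paths S (?o +++ ?i') (q \<circ> linepath (rep ?m) (rep ?m))"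
    using homotopic_paths_convex_triangle[OF q_continuous _ convex_R] q_image base rep_in[OF m] by blast
  then have "homotopic_paths S (?o +++ ?i') (\<lambda>_. ?m)"
    by (simp only: linepath_const q_rep[OF m])
  then have "homotopic_paths S ((?o +++ ?i') +++ ?r) ((\<lambda>_. ?m) +++ ?r)"
    by (rule homotopic_paths_join) (use r sp in simp_all)
  then have "homotopic_paths S ((?o +++ ?i') +++ ?r) ?r"
    using homotopic_paths_const_left[OF r] homotopic_paths_trans by blast
  moreover have "homotopic_paths S (?o +++ (?i' +++ ?r)) ((?o +++ ?i') +++ ?r)"
    using r sp by (intro homotopic_paths_assoc) auto
  ultimately have 1: "homotopic_paths S (?o +++ (?i' +++ ?r)) ?r"
    using homotopic_paths_trans by blast
  have "homotopic_paths S (?i +++ ((p +++ ?o) +++ (?i' +++ ?r))) ((?i +++ (p +++ ?o)) +++ (?i' +++ ?r))"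
    using p r sp by (intro homotopic_paths_assoc) (auto simp: path_image_join)
  moreover have "homotopic_paths S (?i +++ (p +++ (?o +++ (?i' +++ ?r)))) (?i +++ ((p +++ ?o) +++ (?i' +++ ?r)))"
    using p r sp by (intro homotopic_paths_join homotopic_paths_assoc) (auto simp: path_image_join)
  moreover have "homotopic_paths S (?i +++ (p +++ (?o +++ (?i' +++ ?r)))) (?i +++ (p +++ ?r))"
    by (rule homotopic_paths_join[OF _ homotopic_paths_join[OF _ 1]]) (use p sp in simp_all)
  moreover have "homotopic_paths S (?i +++ (p +++ ?r)) (?i +++ ((p +++ p') +++ ?o'))"
    using p p' e r sp by (intro homotopic_paths_join homotopic_paths_assoc) (auto simp: path_image_join)
  ultimately have "homotopic_paths S ((?i +++ (p +++ ?o)) +++ (?i' +++ ?r)) (?i +++ ((p +++ p') +++ ?o'))"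
    by (meson homotopic_paths_sym homotopic_paths_trans)
  then have "path_class S ((?i +++ (p +++ ?o)) +++ (?i' +++ ?r)) = path_class S (?i +++ ((p +++ p') +++ ?o'))"
    by (rule path_class_eqI)
  then show ?thesis
    unfolding loop_class_def
    using fundamental_group_mult[OF loop_class_loop[OF p] loop_class_loop[OF p']] e by simp
qed

lemma path_const: "x \<in> S \<Longrightarrow> path (\<lambda>_. x)" "x \<in> S \<Longrightarrow> path_image (\<lambda>_::real. x) \<subseteq> S"
  by (auto simp: path_def path_image_def)

lemma loop_class_const:
  assumes "x \<in> S"
  shows "loop_class (\<lambda>_. x) = \<one>\<^bsub>G\<^esub>"
proof -
  have "(\<lambda>_. x) +++ (\<lambda>_. x) = (\<lambda>_. x)"
    by (auto simp: joinpaths_def)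
  then have "loop_class (\<lambda>_. x) = loop_class (\<lambda>_. x) \<otimes>\<^bsub>G\<^esub> loop_class (\<lambda>_. x)"
    using loop_class_join[of "\<lambda>_. x" "\<lambda>_. x"] path_const[OF assms]
    by (simp add: pathstart_def pathfinish_def)
  then show ?thesis
    using loop_class_closed[OF path_const[OF assms]] by (metis G.l_cancel_one')
qed

lemma loop_class_triangle:
  fixes k :: "'c::real_normed_vector \<Rightarrow> 's"
  assumes k: "continuous_on C k" "k ` C \<subseteq> S" "convex C" and abc: "a \<in> C" "b \<in> C" "c \<in> C"
  shows "loop_class (k \<circ> linepath a b) \<otimes>\<^bsub>G\<^esub> loop_class (k \<circ> linepath b c) = loop_class (k \<circ> linepath a c)"
proof -
  have "loop_class ((k \<circ> linepath a b) +++ (k \<circ> linepath b c)) =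
      loop_class (k \<circ> linepath a b) \<otimes>\<^bsub>G\<^esub> loop_class (k \<circ> linepath b c)"
    using path_convex_image[OF k] abc by (intro loop_class_join) (auto simp: pathstart_compose pathfinish_compose)
  then show ?thesis
    using loop_class_homotopic[OF homotopic_paths_convex_triangle[OF k abc]] by simp
qed

lemma loop_class_of_loop:
  assumes p: "p \<in> loops S s"
  shows "loop_class p = path_class S p"
proof -
  have p': "path p" "path_image p \<subseteq> S" "pathstart p = s" "pathfinish p = s"
    using p by (auto simp: loops_def)
  have "homotopic_paths S (p +++ (\<lambda>_. s)) p"
  proof -
    have "reversepath p \<in> loops S s"
      using p by (auto simp: loops_def)
    then have "homotopic_paths S (reversepath ((\<lambda>_. s) +++ reversepath p)) (reversepath (reversepath p))"
      by (intro homotopic_paths_reversepath_D homotopic_paths_const_join)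
    moreover have "reversepath (\<lambda>_. s) = (\<lambda>_. s)"
      by (auto simp: reversepath_def)
    ultimately show ?thesis
      using p'(4) by (subst (asm) reversepath_joinpaths) (auto simp: pathfinish_def pathstart_def reversepath_def)
  qed
  then have "homotopic_paths S ((\<lambda>_. s) +++ (p +++ (\<lambda>_. s))) ((\<lambda>_. s) +++ p)"
    using p' path_const[OF s_in]
    by (intro homotopic_paths_join) (auto simp: pathstart_def pathfinish_def joinpaths_def)
  then have "homotopic_paths S ((\<lambda>_. s) +++ (p +++ (\<lambda>_. s))) p"
    using homotopic_paths_const_join[OF p] homotopic_paths_trans by blast
  then show ?thesis
    unfolding loop_class_def p'(3,4) base(3) linepath_const base(2) by (rule path_class_eqI)
qed

definition spoke_class :: "real \<times> real \<Rightarrow> (real \<Rightarrow> 's) set" where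
  "spoke_class z = loop_class (q \<circ> linepath base z)"

lemma spoke_class_closed: "z \<in> R \<Longrightarrow> spoke_class z \<in> carrier G"
  unfolding spoke_class_def by (intro loop_class_closed path_q_linepath base)

lemma loop_class_q_linepath:
  assumes ab: "a \<in> R" "b \<in> R"
  shows "loop_class (q \<circ> linepath a b) = inv\<^bsub>G\<^esub> spoke_class a \<otimes>\<^bsub>G\<^esub> spoke_class b"
proof -
  have "spoke_class a \<otimes>\<^bsub>G\<^esub> loop_class (q \<circ> linepath a b) = spoke_class b"
    unfolding spoke_class_def
    by (rule loop_class_triangle[OF q_continuous _ convex_R]) (use ab base q_image in auto)
  then show ?thesis
    using spoke_class_closed ab loop_class_closed[OF path_q_linepath[OF ab]]
    by (metis G.inv_solve_left)
qed

lemma spoke_class_rep: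
  assumes x: "x \<in> S"
  shows "spoke_class (rep x) = \<one>\<^bsub>G\<^esub>"
proof -
  let ?p = "q \<circ> linepath base (rep x)"
  have "homotopic_paths S (?p +++ (q \<circ> linepath (rep x) base)) (q \<circ> linepath base base)"
    using homotopic_paths_convex_triangle[OF q_continuous _ convex_R] q_image base rep_in[OF x] by blast
  then have "homotopic_paths S (?p +++ (q \<circ> linepath (rep x) base)) (\<lambda>_. s)"
    by (simp add: linepath_const base)
  then have "homotopic_paths S ((\<lambda>_. s) +++ (?p +++ (q \<circ> linepath (rep x) base))) ((\<lambda>_. s) +++ (\<lambda>_. s))"
    using spokes[OF x] path_const[OF s_in] by (intro homotopic_paths_join) (auto simp: pathstart_def pathfinish_def joinpaths_def)
  moreover have "(\<lambda>_. s) +++ (\<lambda>_. s) = (\<lambda>_. s)"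
    by (auto simp: joinpaths_def)
  ultimately show ?thesis
    unfolding spoke_class_def loop_class_def spokes(5,6)[OF x] base(3) linepath_const base(2)
    by (simp add: fundamental_group_def path_class_eqI)
qed

definition side_loop :: "nat \<Rightarrow> (real \<Rightarrow> 's) set" where
  "side_loop k = (if k < 4 * g \<and> k mod 4 < 2
    then spoke_class (1, real k + 1 / 2) \<otimes>\<^bsub>G\<^esub> inv\<^bsub>G\<^esub> spoke_class (1, real k + 5 / 2) else \<one>\<^bsub>G\<^esub>)"

definition vertex_loop :: "nat \<Rightarrow> (real \<Rightarrow> 's) set" where
  "vertex_loop m = (if m \<le> 4 * g
    then spoke_class (1, 0) \<otimes>\<^bsub>G\<^esub> inv\<^bsub>G\<^esub> spoke_class (1, real m) else \<one>\<^bsub>G\<^esub>)"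

lemma spoke_class_glued:
  assumes k: "k < 4 * g" "k mod 4 < 2" and u: "u \<in> {0..1}" and v: "v \<in> {0..1}"
  shows "inv\<^bsub>G\<^esub> spoke_class (1, real k + u) \<otimes>\<^bsub>G\<^esub> spoke_class (1, real k + v) =
    inv\<^bsub>G\<^esub> spoke_class (1, real k + 3 - u) \<otimes>\<^bsub>G\<^esub> spoke_class (1, real k + 3 - v)"
proof -
  note R = side_points_in_R[OF k u] side_points_in_R[OF k v]
  have "loop_class (q \<circ> linepath (1, real k + u) (1, real k + v)) =
      loop_class (q \<circ> linepath (1, real k + 3 - u) (1, real k + 3 - v))"
  proof (rule loop_class_cong)
    fix t :: real assume t: "t \<in> {0..1}"
    let ?w = "(1 - t) * u + t * v"
    have w: "?w \<in> {0..1}"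
      using t u v convex_bound_le[of u 1 v "1 - t" t] by auto
    have "linepath (1, real k + u) (1, real k + v) t = (1 :: real, real k + ?w)"
      "linepath (1, real k + 3 - u) (1, real k + 3 - v) t = (1 :: real, real k + 3 - ?w)"
      by (auto simp: linepath_def algebra_simps)
    then show "(q \<circ> linepath (1, real k + u) (1, real k + v)) t =
        (q \<circ> linepath (1, real k + 3 - u) (1, real k + 3 - v)) t"
      using q_glued(3)[OF k w] by simp
  qed (use path_q_linepath R in auto)
  then show ?thesis
    using loop_class_q_linepath R by simp
qed

lemma spoke_class_origin:
  assumes \<theta>: "\<theta> \<in> {0..real (4 * g)}"
  shows "spoke_class (0, \<theta>) = spoke_class (0, 0)"
proof -
  have R: "(0, 0) \<in> R" "(0, \<theta>) \<in> R"
    using \<theta> by (auto simp: polar_rectangle_def)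
  have "loop_class (q \<circ> linepath (0, 0) (0, \<theta>)) = loop_class (\<lambda>_. q (0, 0))"
  proof (rule loop_class_cong)
    fix t :: real assume t: "t \<in> {0..1}"
    then have "t * \<theta> \<in> {0..real (4 * g)}"
      using \<theta> mult_left_le_one_le[of \<theta> t] by auto
    moreover have "linepath (0, 0) (0, \<theta>) t = (0 :: real, t * \<theta>)"
      by (simp add: linepath_def)
    ultimately show "(q \<circ> linepath (0, 0) (0, \<theta>)) t = q (0, 0)"
      using q_glued(1)[of "t * \<theta>"] by simp
  qed (use path_q_linepath R in auto)
  also have "\<dots> = \<one>\<^bsub>G\<^esub>"
    using R q_in_S by (intro loop_class_const)
  finally have "inv\<^bsub>G\<^esub> spoke_class (0, 0) \<otimes>\<^bsub>G\<^esub> spoke_class (0, \<theta>) = \<one>\<^bsub>G\<^esub>"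
    using loop_class_q_linepath[OF R] by simp
  then show ?thesis
    using spoke_class_closed R by (metis G.inv_closed G.inv_equality G.inv_inv G.inv_comm)
qed

lemma spoke_class_seam: "spoke_class (1, real (4 * g)) = spoke_class (1, 0)"
proof -
  have R: "(0, 0) \<in> R" "(0, real (4 * g)) \<in> R" "(1, 0) \<in> R" "(1, real (4 * g)) \<in> R"
    by (auto simp: polar_rectangle_def)
  have "loop_class (q \<circ> linepath (0, real (4 * g)) (1, real (4 * g))) =
      loop_class (q \<circ> linepath (0, 0) (1, 0))"
  proof (rule loop_class_cong)
    fix t :: real assume t: "t \<in> {0..1}"
    have "linepath (0, real (4 * g)) (1, real (4 * g)) t = (t, real (4 * g))"
      "linepath (0, 0) (1, 0) t = (t, 0 :: real)"
      by (simp_all add: linepath_def algebra_simps)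
    then show "(q \<circ> linepath (0, real (4 * g)) (1, real (4 * g))) t = (q \<circ> linepath (0, 0) (1, 0)) t"
      using q_glued(2)[OF t] by (simp only: comp_def)
  qed (use path_q_linepath R in auto)
  then have "inv\<^bsub>G\<^esub> spoke_class (0, 0) \<otimes>\<^bsub>G\<^esub> spoke_class (1, real (4 * g)) =
      inv\<^bsub>G\<^esub> spoke_class (0, 0) \<otimes>\<^bsub>G\<^esub> spoke_class (1, 0)"
    using loop_class_q_linepath R spoke_class_origin[of "real (4 * g)"] by simp
  then show ?thesis
    using spoke_class_closed R by (metis G.inv_closed G.Units_l_cancel G.Units_eq)
qed

lemma side_relation_loops: "side_relation G g side_loop vertex_loop"
  unfolding side_relation_def
proof (intro conjI allI impI)
  let ?D = spoke_class
  have half: "(1, real k + 1 / 2) \<in> R" "(1, real k + 5 / 2) \<in> R" if "k < 4 * g" "k mod 4 < 2" for k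
    using side_points_in_R[OF that, of "1 / 2"] by (auto simp: add.commute)
  show "range side_loop \<subseteq> carrier G"
    using half spoke_class_closed by (auto simp: side_loop_def)
  show "range vertex_loop \<subseteq> carrier G"
    using R_vertex R_vertex[of 0] spoke_class_closed by (auto simp: vertex_loop_def)
  have 0: "?D (1, 0) \<in> carrier G"
    using R_vertex[of 0] spoke_class_closed by simp
  then show "vertex_loop 0 = \<one>\<^bsub>G\<^esub>"
    by (simp add: vertex_loop_def)
  show "vertex_loop (4 * g) = \<one>\<^bsub>G\<^esub>"
    using 0 spoke_class_seam by (simp add: vertex_loop_def del: of_nat_mult)
  fix k assume k: "k < 4 * g" "k mod 4 < 2"
  then have le: "k + 3 \<le> 4 * g"
    by presburger
  have step: "?D (1, 0) \<otimes>\<^bsub>G\<^esub> inv\<^bsub>G\<^esub> ?D (1, real k + 3 - u) =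
      ?D (1, 0) \<otimes>\<^bsub>G\<^esub> inv\<^bsub>G\<^esub> ?D (1, real k + u) \<otimes>\<^bsub>G\<^esub> side_loop k" if u: "u \<in> {0..1}" for u
  proof -
    have c: "?D (1, real k + u) \<in> carrier G" "?D (1, real k + 3 - u) \<in> carrier G"
      "?D (1, real k + 1 / 2) \<in> carrier G" "?D (1, real k + 5 / 2) \<in> carrier G"
      using side_points_in_R[OF k u] half[OF k] spoke_class_closed by auto
    have "inv\<^bsub>G\<^esub> ?D (1, real k + u) \<otimes>\<^bsub>G\<^esub> ?D (1, real k + 1 / 2) =
        inv\<^bsub>G\<^esub> ?D (1, real k + 3 - u) \<otimes>\<^bsub>G\<^esub> ?D (1, real k + 5 / 2)"
      using spoke_class_glued[OF k u, of "1 / 2"] by (simp add: add.commute)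
    then have "inv\<^bsub>G\<^esub> ?D (1, real k + 3 - u) =
        inv\<^bsub>G\<^esub> ?D (1, real k + u) \<otimes>\<^bsub>G\<^esub> (?D (1, real k + 1 / 2) \<otimes>\<^bsub>G\<^esub> inv\<^bsub>G\<^esub> ?D (1, real k + 5 / 2))"
      using c by (metis G.inv_closed G.inv_solve_right G.m_assoc G.m_closed)
    then show ?thesis
      using c 0 k by (simp add: side_loop_def G.m_assoc)
  qed
  have r: "real (k + 3) = real k + 3 - 0" "real (k + 2) = real k + 3 - 1" "real (k + 1) = real k + 1"
    "real k = real k + 0"
    by auto
  show "vertex_loop (k + 3) = vertex_loop k \<otimes>\<^bsub>G\<^esub> side_loop k"
    using step[of 0] le by (simp add: vertex_loop_def add.commute)
  show "vertex_loop (k + 2) = vertex_loop (k + 1) \<otimes>\<^bsub>G\<^esub> side_loop k"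
    using step[of 1] le by (simp add: vertex_loop_def add.commute)
qed

lemma anchor_centre:
  assumes z: "z \<in> chart_domain i"
  shows "anchor (centre i z) \<in> R" "centre i z \<in> R" "q (anchor (centre i z)) = q (centre i z)"
    "sheet G side_loop vertex_loop (centre i z) =
      spoke_class (anchor (centre i z)) \<otimes>\<^bsub>G\<^esub> inv\<^bsub>G\<^esub> spoke_class (centre i z)"
proof -
  have "anchor (centre i z) \<in> R \<and> centre i z \<in> R \<and> q (anchor (centre i z)) = q (centre i z) \<and>
    sheet G side_loop vertex_loop (centre i z) =
      spoke_class (anchor (centre i z)) \<otimes>\<^bsub>G\<^esub> inv\<^bsub>G\<^esub> spoke_class (centre i z)"
    using z
  proof (cases rule: centre_cases)
    case (1 \<theta>)
    have "(0, 0) \<in> R" "(0, \<theta>) \<in> R"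
      using 1 by (auto simp: polar_rectangle_def)
    then show ?thesis
      using 1 spoke_class_closed q_glued(1)[OF 1(3)] by (simp add: anchor_simps sheet_simps spoke_class_origin[OF 1(3)])
  next
    case (2 k)
    show ?thesis
    proof (cases "k mod 4 < 2")
      case True
      have "(1, real k + 1 / 2) \<in> R"
        using side_points_in_R[OF 2(2) True, of "1 / 2"] by simp
      then show ?thesis
        using 2 True spoke_class_closed by (simp add: anchor_simps sheet_simps)
    next
      case False
      define k' where "k' = k - 2"
      have "k \<ge> 2"
        using False by presburger
      then have k: "k = k' + 2" "k' < 4 * g"
        using 2(2) by (auto simp: k'_def)
      have k'2: "k' mod 4 < 2"
        using False unfolding k(1) by presburger
      have e: "real k + 1 / 2 = real k' + 5 / 2" "real k - 3 / 2 = real k' + 1 / 2"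
        using k(1) by auto
      have mid: "(1, real k' + 1 / 2) \<in> R" "(1, real k' + 5 / 2) \<in> R" "q (1, real k' + 1 / 2) = q (1, real k' + 5 / 2)"
        using side_points_in_R[OF k(2) k'2, of "1 / 2"] q_glued(3)[OF k(2) k'2, of "1 / 2"] by (auto simp: add.commute)
      have "sheet G side_loop vertex_loop (1, real k + 1 / 2) = side_loop k'"
        using False by (simp add: sheet_simps k'_def)
      moreover have "anchor (1, real k + 1 / 2) = (1, real k' + 1 / 2)"
        using False e by (simp add: anchor_simps)
      ultimately show ?thesis
        unfolding 2(3) using mid k(2) k'2 unfolding e(1) by (simp only: side_loop_def) simp
    qed
  next
    case (3 m)
    then show ?thesis
      using R_vertex[of m] R_vertex[of 0] q_vertex[of m] by (simp add: anchor_simps sheet_simps vertex_loop_def)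
  qed
  then show "anchor (centre i z) \<in> R" "centre i z \<in> R" "q (anchor (centre i z)) = q (centre i z)"
    "sheet G side_loop vertex_loop (centre i z) =
      spoke_class (anchor (centre i z)) \<otimes>\<^bsub>G\<^esub> inv\<^bsub>G\<^esub> spoke_class (centre i z)"
    by blast+
qed

end

context polygon
begin

lemma linepath_in_R: "a \<in> R \<Longrightarrow> b \<in> R \<Longrightarrow> t \<in> {0..1} \<Longrightarrow> linepath a b t \<in> R"
  using convex_R by (auto simp: linepath_def convex_alt)

lemma centre_continuous: "continuous_on (chart_domain i) (centre i)"
proof (cases "i = Center")
  case True
  then show ?thesis
    by (auto simp: centre_def intro!: continuous_intros)
next
  case False
  show ?thesis
    unfolding continuous_on_topological
  proof (intro ballI allI impI)
    fix z B assume z: "z \<in> chart_domain i" "open B" "centre i z \<in> B"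
    obtain N where "open N" "z \<in> N" "\<forall>y\<in>N. centre i y = centre i z"
      using centre_locally_constant[OF z(1) False] by blast
    then show "\<exists>A. open A \<and> z \<in> A \<and> (\<forall>y\<in>chart_domain i. y \<in> A \<longrightarrow> centre i y \<in> B)"
      using z(3) by metis
  qed
qed

lemma contraction_fibre:
  assumes z: "z \<in> chart_domain i" "z' \<in> R" "q z = q z'" and u: "u \<in> {0..1}"
  shows "q (linepath z (centre i z) u) = q (linepath z' (centre i z') u)"
proof -
  let ?\<kappa> = "\<lambda>z. q (linepath z (centre i z) u)"
  have lin: "(1 - u) * a + u * b \<in> {0..c}" if "a \<in> {0..c}" "b \<in> {0..c}" for a b c :: real
    using that u convex_bound_le[of a c b "1 - u" u] by auto
  have inv: "gluing_invariant g (\<lambda>z. if z \<in> chart_domain i \<inter> chart_domain i then Some (?\<kappa> z) else None)"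
  proof (rule invariant_on_charts[OF refl])
    fix \<theta> assume "(0, \<theta>) \<in> chart_domain i \<inter> chart_domain i"
    then have i: "i = Center" "\<theta> \<in> {0..real (4 * g)}"
      by (auto simp: chart_domain_origin simp del: of_nat_mult)
    then have "linepath (0, \<theta>) (centre i (0, \<theta>)) u = (0, \<theta>)" "linepath (0, 0) (centre i (0, 0)) u = (0, 0)"
      by (auto simp: centre_def linepath_def algebra_simps)
    then show "?\<kappa> (0, \<theta>) = ?\<kappa> (0, 0)"
      using q_glued(1)[OF i(2)] by simp
  next
    fix r assume "(r, 0) \<in> chart_domain i \<inter> chart_domain i"
    then have r: "(r, 0) \<in> chart_domain i"
      by simp
    then have r01: "r \<in> {0..1}"
      by (auto simp: chart_domain_def polar_rectangle_def)
    define r' where "r' = (1 - u) * r + u * (if i = Center then 0 else 1)"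
    have "r' \<in> {0..1}"
      unfolding r'_def using r01 by (intro lin) auto
    moreover have "linepath (r, 0) (centre i (r, 0)) u = (r', 0)"
      "linepath (r, real (4 * g)) (centre i (r, real (4 * g))) u = (r', real (4 * g))"
      unfolding centre_seam[OF r] by (auto simp: r'_def linepath_def algebra_simps)
    ultimately show "?\<kappa> (r, real (4 * g)) = ?\<kappa> (r, 0)"
      using q_glued(2)[of r'] by (simp only:)
  next
    fix k and t :: real
    assume k: "k < 4 * g" "k mod 4 < 2" "t \<in> {0..1}"
      and t: "(1, real k + t) \<in> chart_domain i \<inter> chart_domain i"
    obtain t' where t': "t' \<in> {0, 1 / 2, 1}" "centre i (1, real k + t) = (1, real k + t')"
      "centre i (1, real k + 3 - t) = (1, real k + 3 - t')"
      using centre_glued[OF k, of i] t by (metis IntD1)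
    define v where "v = (1 - u) * t + u * t'"
    have v: "v \<in> {0..1}"
      unfolding v_def using k(3) t'(1) by (intro lin) auto
    have "linepath (1, real k + t) (1, real k + t') u = (1 :: real, real k + v)"
      "linepath (1, real k + 3 - t) (1, real k + 3 - t') u = (1 :: real, real k + 3 - v)"
      by (auto simp: v_def linepath_def algebra_simps)
    then show "?\<kappa> (1, real k + t) = ?\<kappa> (1, real k + 3 - t)"
      unfolding t' using q_glued(3)[OF k(1,2) v] by simp
  qed
  have "z \<in> R" "z' \<in> chart_domain i"
    using z chart_domain_subset chart_domain_saturated by blast+
  then show ?thesis
    using invariant_fibre[OF inv, of z z'] z by simp
qed

lemma contraction_continuous:
  "continuous_on ({0..1} \<times> chart_image i) (\<lambda>(u, x). q (linepath (rep x) (centre i (rep x)) u))"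
proof -
  let ?I = "top_of_set {0..1::real}" and ?H = "\<lambda>(u, x). q (linepath (rep x) (centre i (rep x)) u)"
  have dom: "chart_domain i \<subseteq> R"
    by (rule chart_domain_subset)
  have "{z \<in> R. q z \<in> chart_image i} = chart_domain i"
    using q_in_chart_image dom by blast
  then have "quotient_map (top_of_set (R \<inter> chart_domain i)) (top_of_set (S \<inter> chart_image i)) q"
    using quotient_map_restriction[OF quotient, of "chart_image i" "chart_domain i"] openin_chart_image
    by (simp add: subtopology_subtopology)
  moreover have "R \<inter> chart_domain i = chart_domain i" "S \<inter> chart_image i = chart_image i"
    using dom chart_image_subset by blast+
  ultimately have "quotient_map (top_of_set (chart_domain i)) (top_of_set (chart_image i)) q"
    by simp
  then have Q: "quotient_map (prod_topology ?I (top_of_set (chart_domain i)))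
      (prod_topology ?I (top_of_set (chart_image i))) (\<lambda>(u, z). (u, q z))"
    by (intro quotient_map_prod_right compact_imp_locally_compact_space)
      (auto simp: compact_space_subtopology Hausdorff_space_subtopology)
  have "continuous_on ({0..1} \<times> chart_domain i) (\<lambda>y. linepath (snd y) (centre i (snd y)) (fst y))"
    unfolding linepath_def
    by (intro continuous_intros continuous_on_compose2[OF centre_continuous]) auto
  moreover have "linepath z (centre i z) u \<in> R" if "z \<in> chart_domain i" "u \<in> {0..1}" for z u
    using that dom centre_in_R linepath_in_R by blast
  ultimately have "continuous_on ({0..1} \<times> chart_domain i) (\<lambda>y. q (linepath (snd y) (centre i (snd y)) (fst y)))"
    by (intro continuous_on_compose2[OF q_continuous]) auto
  moreover have "q (linepath (snd y) (centre i (snd y)) (fst y)) = (?H \<circ> (\<lambda>(u, z). (u, q z))) y"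
    if y: "y \<in> {0..1} \<times> chart_domain i" for y
  proof -
    obtain u z where uz: "y = (u, z)" "u \<in> {0..1}" "z \<in> chart_domain i"
      using y by blast
    have "q z \<in> S"
      using uz(3) dom q_in_S by blast
    then show ?thesis
      using contraction_fibre[OF uz(3) rep_in _ uz(2)] q_rep uz(1) by simp
  qed
  ultimately have "continuous_on ({0..1} \<times> chart_domain i) (?H \<circ> (\<lambda>(u, z). (u, q z)))"
    by (simp cong: continuous_on_cong)
  then have "continuous_map (prod_topology ?I (top_of_set (chart_image i))) euclidean ?H"
    by (intro continuous_compose_quotient_map[OF Q]) simp
  then show ?thesis
    by simp
qed

end

context based_polygon
begin

text \<open>
  A path inside one chart is homotopic to its contraction: out to the centre along one spoke,
  then a constant path, then back along another spoke.
\<close>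

lemma loop_class_in_chart:
  assumes p: "path p" "path_image p \<subseteq> chart_image i"
  shows "loop_class p =
    inv\<^bsub>G\<^esub> local_section G side_loop vertex_loop i (pathstart p) \<otimes>\<^bsub>G\<^esub>
    local_section G side_loop vertex_loop i (pathfinish p)"
proof -
  let ?f = "local_section G side_loop vertex_loop i"
  define H where "H u x = q (linepath (rep x) (centre i (rep x)) u)" for u x
  define k where "k y = H (fst y) (p (snd y))" for y
  let ?Q = "{0..1::real} \<times> {0..1::real}"
  have pc: "p t \<in> chart_image i" if "t \<in> {0..1}" for t
    using p(2) that by (auto simp: path_image_def)
  have pS: "p t \<in> S" if "t \<in> {0..1}" for t
    using pc[OF that] chart_image_subset by blast
  have dom: "rep (p t) \<in> chart_domain i" if "t \<in> {0..1}" for t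
    using rep_in_chart[OF pS[OF that]] pc[OF that] by blast
  have "continuous_on ?Q (\<lambda>y. (fst y, p (snd y)))"
    using p(1) unfolding path_def
    by (intro continuous_intros continuous_on_compose2[OF p(1)[unfolded path_def]]) auto
  then have "continuous_on ?Q ((\<lambda>(u, x). q (linepath (rep x) (centre i (rep x)) u)) \<circ> (\<lambda>y. (fst y, p (snd y))))"
    by (intro continuous_on_compose continuous_on_subset[OF contraction_continuous[of i]]) (use pc in auto)
  then have k_cont: "continuous_on ?Q k"
    by (simp add: k_def H_def comp_def)
  have k_S: "k ` ?Q \<subseteq> S"
  proof clarify
    fix u t :: real assume ut: "u \<in> {0..1}" "t \<in> {0..1}"
    then have "linepath (rep (p t)) (centre i (rep (p t))) u \<in> R"
      using rep_in[OF pS] centre_in_R[OF dom] linepath_in_R by blast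
    then show "k (u, t) \<in> S"
      by (simp add: k_def H_def q_in_S)
  qed
  have cQ: "convex ?Q"
    by (intro convex_Times) auto
  note tri = loop_class_triangle[OF k_cont k_S cQ]
  note path_k = path_convex_image[OF k_cont k_S cQ]
  have closed: "loop_class (k \<circ> linepath a b) \<in> carrier G" if "a \<in> ?Q" "b \<in> ?Q" for a b
    using path_k[OF that] by (rule loop_class_closed)
  have spoke: "loop_class (k \<circ> linepath (0, t) (1, t)) = spoke_class (centre i (rep (p t)))"
    if t: "t \<in> {0..1}" for t
  proof -
    have "loop_class (k \<circ> linepath (0, t) (1, t)) = loop_class (q \<circ> linepath (rep (p t)) (centre i (rep (p t))))"
    proof (rule loop_class_cong)
      fix u :: real
      have "linepath (0, t) (1, t) u = (u, t)"
        by (simp add: linepath_def algebra_simps)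
      then show "(k \<circ> linepath (0, t) (1, t)) u = (q \<circ> linepath (rep (p t)) (centre i (rep (p t)))) u"
        by (simp add: k_def H_def)
    qed (use path_k t in auto)
    also have "\<dots> = inv\<^bsub>G\<^esub> spoke_class (rep (p t)) \<otimes>\<^bsub>G\<^esub> spoke_class (centre i (rep (p t)))"
      using rep_in[OF pS[OF t]] anchor_centre(2)[OF dom[OF t]] by (rule loop_class_q_linepath)
    also have "\<dots> = spoke_class (centre i (rep (p t)))"
      using spoke_class_rep[OF pS[OF t]] spoke_class_closed[OF anchor_centre(2)[OF dom[OF t]]] by simp
    finally show ?thesis .
  qed
  have anchor: "anchor (centre i (rep (p t))) = anchor (centre i (rep (p 0)))" if "t \<in> {0..1}" for t
  proof -
    have "(\<lambda>t. anchor (centre i (rep (p t)))) constant_on {0..1}"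
    proof (rule locally_constant_imp_constant)
      fix a :: real assume a: "a \<in> {0..1}"
      obtain M where M: "openin (top_of_set S) M" "q (rep (p a)) \<in> M"
        "\<And>z'. z' \<in> R \<Longrightarrow> q z' \<in> M \<Longrightarrow> anchor (centre i z') = anchor (centre i (rep (p a)))"
        using anchor_descends[OF dom[OF a]] by blast
      have "openin (top_of_set {0..1}) ({0..1} \<inter> p -` M)"
        using p(1) pS M(1) unfolding path_def by (intro continuous_openin_preimage[of _ _ S]) auto
      moreover have "a \<in> {0..1} \<inter> p -` M"
        using a M(2) q_rep[OF pS[OF a]] by simp
      moreover have "anchor (centre i (rep (p t))) = anchor (centre i (rep (p a)))"
        if "t \<in> {0..1} \<inter> p -` M" for t
        using M(3)[of "rep (p t)"] rep[OF pS] that by simp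
      ultimately show "\<exists>T. openin (top_of_set {0..1}) T \<and> a \<in> T \<and>
          (\<forall>t\<in>T. anchor (centre i (rep (p t))) = anchor (centre i (rep (p a))))"
        by blast
    qed simp
    then obtain c where "\<And>t. t \<in> {0..1} \<Longrightarrow> anchor (centre i (rep (p t))) = c"
      unfolding constant_on_def by blast
    from this[OF that] this[of 0] show ?thesis
      by simp
  qed
  have top: "loop_class (k \<circ> linepath (1, 0) (1, 1)) = \<one>\<^bsub>G\<^esub>"
  proof -
    let ?c = "q (anchor (centre i (rep (p 0))))"
    have "loop_class (k \<circ> linepath (1, 0) (1, 1)) = loop_class (\<lambda>_. ?c)"
    proof (rule loop_class_cong)
      fix t :: real assume t: "t \<in> {0..1}"
      have "linepath (1, 0) (1, 1) t = (1 :: real, t)"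
        by (simp add: linepath_def)
      then have "(k \<circ> linepath (1, 0) (1, 1)) t = q (centre i (rep (p t)))"
        by (simp add: k_def H_def linepath_1')
      then show "(k \<circ> linepath (1, 0) (1, 1)) t = ?c"
        using anchor_centre(3)[OF dom[OF t]] anchor[OF t] by simp
    qed (use path_k in auto)
    then show ?thesis
      using loop_class_const[OF q_in_S[OF anchor_centre(1)[OF dom[of 0]]]] by simp
  qed
  have "loop_class p = loop_class (k \<circ> linepath (0, 0) (0, 1))"
  proof (rule loop_class_cong)
    fix t :: real assume t: "t \<in> {0..1}"
    have "linepath (0, 0) (0, 1) t = (0 :: real, t)"
      by (simp add: linepath_def)
    then show "p t = (k \<circ> linepath (0, 0) (0, 1)) t"
      using q_rep[OF pS[OF t]] by (simp add: k_def H_def linepath_0')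
  qed (use p chart_image_subset in auto)
  also have "\<dots> \<otimes>\<^bsub>G\<^esub> loop_class (k \<circ> linepath (0, 1) (1, 1)) =
      loop_class (k \<circ> linepath (0, 0) (1, 1))"
    by (rule tri) auto
  also have "loop_class (k \<circ> linepath (0, 0) (1, 1)) =
      loop_class (k \<circ> linepath (0, 0) (1, 0)) \<otimes>\<^bsub>G\<^esub> loop_class (k \<circ> linepath (1, 0) (1, 1))"
    by (rule tri[symmetric]) auto
  also have "\<dots> = loop_class (k \<circ> linepath (0, 0) (1, 0))"
    unfolding top by (intro G.r_one closed) auto
  finally have "loop_class p \<otimes>\<^bsub>G\<^esub> loop_class (k \<circ> linepath (0, 1) (1, 1)) =
      loop_class (k \<circ> linepath (0, 0) (1, 0))" .
  then have "loop_class p \<otimes>\<^bsub>G\<^esub> spoke_class (centre i (rep (p 1))) = spoke_class (centre i (rep (p 0)))"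
    by (simp only: spoke atLeastAtMost_iff zero_le_one order_refl)
  moreover have c: "spoke_class (centre i (rep (p 0))) \<in> carrier G" "spoke_class (centre i (rep (p 1))) \<in> carrier G"
    "spoke_class (anchor (centre i (rep (p 0)))) \<in> carrier G" "loop_class p \<in> carrier G"
    using anchor_centre(1,2)[OF dom] spoke_class_closed
      loop_class_closed[OF p(1) order_trans[OF p(2) chart_image_subset]] by auto
  ultimately have "loop_class p = spoke_class (centre i (rep (p 0))) \<otimes>\<^bsub>G\<^esub> inv\<^bsub>G\<^esub> spoke_class (centre i (rep (p 1)))"
    by (metis G.inv_solve_right)
  moreover have "?f (p 0) = spoke_class (anchor (centre i (rep (p 0)))) \<otimes>\<^bsub>G\<^esub> inv\<^bsub>G\<^esub> spoke_class (centre i (rep (p 0)))"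
    "?f (p 1) = spoke_class (anchor (centre i (rep (p 0)))) \<otimes>\<^bsub>G\<^esub> inv\<^bsub>G\<^esub> spoke_class (centre i (rep (p 1)))"
    using anchor_centre(4)[OF dom[of 0]] anchor_centre(4)[OF dom[of 1]] anchor[of 1]
    by (simp_all add: local_section_def)
  ultimately show ?thesis
    using c by (simp add: pathstart_def pathfinish_def G.inv_mult_group G.m_assoc
        flip: G.m_assoc[of "inv\<^bsub>G\<^esub> spoke_class (anchor (centre i (rep (p 0))))"])
qed

lemma loop_class_horizontal:
  assumes p: "path p" "path_image p \<subseteq> S"
  shows "group_cocycle.horizontal G chart_image (local_section G side_loop vertex_loop) {0..1} p
    (\<lambda>t. loop_class (p \<circ> linepath 0 t))"
proof -
  let ?f = "local_section G side_loop vertex_loop"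
  interpret group_cocycle G S chart_image ?f
    by (rule group_cocycle_local_section[OF G.group_axioms side_relation_loops])
  have pc: "continuous_on {0..1} p" "p ` {0..1} \<subseteq> S"
    using p by (auto simp: path_def path_image_def)
  have c01: "convex {0..1::real}"
    by simp
  note tri = loop_class_triangle[OF pc c01]
  have closed: "loop_class (p \<circ> linepath a b) \<in> carrier G" if "a \<in> {0..1}" "b \<in> {0..1}" for a b
    using path_convex_image[OF pc c01 that] by (rule loop_class_closed)
  show ?thesis
  proof (rule horizontalI)
    show "loop_class (p \<circ> linepath 0 t) \<in> carrier G" if "t \<in> {0..1}" for t
      using that by (intro closed) auto
  next
    fix t i assume t: "t \<in> {0..1}" "p t \<in> chart_image i"
    have "openin (top_of_set {0..1}) ({0..1} \<inter> p -` chart_image i)"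
      using pc openin_chart_image by (intro continuous_openin_preimage[of _ _ S]) auto
    moreover have "t \<in> {0..1} \<inter> p -` chart_image i"
      using t by simp
    ultimately obtain e where e: "e > 0" "\<And>y. y \<in> {0..1} \<Longrightarrow> dist y t < e \<Longrightarrow> p y \<in> chart_image i"
      unfolding openin_euclidean_subtopology_iff by blast
    show "\<exists>N. open N \<and> t \<in> N \<and> (\<forall>y. y \<in> N \<longrightarrow> y \<in> {0..1} \<longrightarrow> p y \<in> chart_image i \<longrightarrow>
        loop_class (p \<circ> linepath 0 y) \<otimes>\<^bsub>G\<^esub> inv\<^bsub>G\<^esub> ?f i (p y) =
        loop_class (p \<circ> linepath 0 t) \<otimes>\<^bsub>G\<^esub> inv\<^bsub>G\<^esub> ?f i (p t))"
    proof (intro exI[of _ "ball t e"] conjI allI impI)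
      fix y assume y: "y \<in> ball t e" "y \<in> {0..1}" "p y \<in> chart_image i"
      have "path_image (linepath t y) \<subseteq> ball t e \<inter> {0..1}"
        using y t e(1) by (simp only: path_image_linepath) (intro closed_segment_subset convex_Int, auto)
      then have "path_image (p \<circ> linepath t y) \<subseteq> chart_image i"
        using e(2) unfolding path_image_compose by (auto simp: dist_commute subset_iff)
      then have "loop_class (p \<circ> linepath t y) = inv\<^bsub>G\<^esub> ?f i (p t) \<otimes>\<^bsub>G\<^esub> ?f i (p y)"
        using loop_class_in_chart[of "p \<circ> linepath t y" i] path_convex_image(1)[OF pc c01 t(1) y(2)]
        by (simp add: pathstart_compose pathfinish_compose)
      moreover have "loop_class (p \<circ> linepath 0 t) \<otimes>\<^bsub>G\<^esub> loop_class (p \<circ> linepath t y) = loop_class (p \<circ> linepath 0 y)"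
        using t y by (intro tri) auto
      ultimately have "loop_class (p \<circ> linepath 0 y) =
          loop_class (p \<circ> linepath 0 t) \<otimes>\<^bsub>G\<^esub> (inv\<^bsub>G\<^esub> ?f i (p t) \<otimes>\<^bsub>G\<^esub> ?f i (p y))"
        by simp
      then show "loop_class (p \<circ> linepath 0 y) \<otimes>\<^bsub>G\<^esub> inv\<^bsub>G\<^esub> ?f i (p y) =
        loop_class (p \<circ> linepath 0 t) \<otimes>\<^bsub>G\<^esub> inv\<^bsub>G\<^esub> ?f i (p t)"
        using closed[of 0 t] t y f_closed by (simp add: G.m_assoc)
    qed (use e in auto)
  qed
qed

lemma loop_transport:
  assumes p: "p \<in> loops S s"
  shows "group_cocycle.transport G chart_image (local_section G side_loop vertex_loop) p = path_class S p"
proof -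
  interpret group_cocycle G S chart_image "local_section G side_loop vertex_loop"
    by (rule group_cocycle_local_section[OF G.group_axioms side_relation_loops])
  have p': "path p" "path_image p \<subseteq> S" "p 0 = s"
    using p by (auto simp: loops_def pathstart_def)
  have "p \<circ> linepath 0 1 = p"
    by (auto simp: linepath_def)
  then show ?thesis
    using transport_eq[OF p'(1,2) loop_class_horizontal[OF p'(1,2)]] loop_class_of_loop[OF p]
      loop_class_const[OF s_in] loop_class_closed[OF p'(1,2)]
    by (simp add: linepath_const p'(3))
qed

definition surface_hom ::
    "('k, 'm) monoid_scheme \<Rightarrow> (nat \<Rightarrow> 'k) \<Rightarrow> (nat \<Rightarrow> 'k) \<Rightarrow> (real \<Rightarrow> 's) set \<Rightarrow> 'k" where
  "surface_hom K \<alpha> \<nu> = group_cocycle.holonomy K S chart_image (local_section K \<alpha> \<nu>)"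

lemma surface_hom_hom:
  assumes "group K" "side_relation K g \<alpha> \<nu>"
  shows "surface_hom K \<alpha> \<nu> \<in> hom G K"
proof -
  interpret group_cocycle K S chart_image "local_section K \<alpha> \<nu>"
    by (rule group_cocycle_local_section[OF assms])
  show ?thesis
    unfolding surface_hom_def by (rule holonomy_hom)
qed

lemma surface_hom_spoke_class:
  assumes K: "group K" "side_relation K g \<alpha> \<nu>" and z: "z \<in> R"
  shows "surface_hom K \<alpha> \<nu> (spoke_class z) = lifted_sheet K \<alpha> \<nu> z"
proof -
  interpret group_cocycle K S chart_image "local_section K \<alpha> \<nu>"
    by (rule group_cocycle_local_section[OF K])
  let ?a = "q \<circ> linepath base base" and ?b = "q \<circ> linepath base z" and ?c = "q \<circ> linepath (rep (q z)) base"
  have qz: "q z \<in> S" "rep (q z) \<in> R" "q (rep (q z)) = q z"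
    using z q_in_S rep by auto
  have sc: "spoke_class z = path_class S (?a +++ (?b +++ ?c))"
    by (simp add: spoke_class_def loop_class_def pathstart_compose pathfinish_compose base)
  note paths = path_q_linepath[OF base(1) base(1)] path_q_linepath[OF base(1) z] path_q_linepath[OF qz(2) base(1)]
  have ends: "pathfinish ?b = pathstart ?c" "pathfinish ?a = pathstart (?b +++ ?c)"
    using qz by (simp_all add: pathstart_compose pathfinish_compose)
  have bc: "path (?b +++ ?c)" "path_image (?b +++ ?c) \<subseteq> S"
    using paths ends by (auto simp: path_image_join)
  have abc: "path (?a +++ (?b +++ ?c))" "path_image (?a +++ (?b +++ ?c)) \<subseteq> S"
    using paths bc ends by (auto simp: path_image_join)
  have "surface_hom K \<alpha> \<nu> (spoke_class z) = transport ?a \<otimes>\<^bsub>K\<^esub> (transport ?b \<otimes>\<^bsub>K\<^esub> transport ?c)"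
    unfolding surface_hom_def sc holonomy_path_class[OF abc]
    using paths bc ends by (simp add: transport_join)
  moreover have "lifted_sheet K \<alpha> \<nu> base = \<one>\<^bsub>K\<^esub>" "lifted_sheet K \<alpha> \<nu> (rep (q z)) = \<one>\<^bsub>K\<^esub>"
    using lifted_sheet_rep[OF K s_in] lifted_sheet_rep[OF K qz(1)] by (simp_all add: base)
  moreover have "lifted_sheet K \<alpha> \<nu> z \<in> carrier K"
    using horizontal_closed[OF lifted_sheet_horizontal[OF K] z] .
  ultimately show ?thesis
    using transport_q_linepath[OF K] base z qz by simp
qed

lemma surface_hom_side_loop:
  assumes K: "group K" "side_relation K g \<alpha> \<nu>" and k: "k < 4 * g" "k mod 4 < 2"
  shows "surface_hom K \<alpha> \<nu> (side_loop k) = \<alpha> k"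
proof -
  interpret group_cocycle K S chart_image "local_section K \<alpha> \<nu>"
    by (rule group_cocycle_local_section[OF K])
  interpret h: group_hom G K "surface_hom K \<alpha> \<nu>"
    by (simp add: group_hom_def group_hom_axioms_def G.group_axioms K(1) surface_hom_hom[OF K])
  have z: "(1, real k + 1 / 2) \<in> R" "(1, real k + 5 / 2) \<in> R"
    and eq: "q (1, real k + 5 / 2) = q (1, real k + 1 / 2)"
    using side_points_in_R[OF k, of "1 / 2"] q_glued(3)[OF k, of "1 / 2"] by (auto simp: add.commute)
  have Edge: "(1, real m + 1 / 2) \<in> chart_domain Edge" "centre Edge (1, real m + 1 / 2) = (1, real m + 1 / 2)"
    if "(1, real m + 1 / 2) \<in> R" for m
  proof -
    have "real m + 1 / 2 \<notin> \<int>"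
      by (simp add: add_in_Ints_iff_left fraction_not_in_Ints)
    then show "(1, real m + 1 / 2) \<in> chart_domain Edge"
      using that by (simp add: chart_domain_def chart_offset_def)
    have "\<lfloor>real m + 1 / 2\<rfloor> = int m"
      by (simp add: floor_eq_iff)
    then show "centre Edge (1, real m + 1 / 2) = (1, real m + 1 / 2)"
      by (simp add: centre_def chart_offset_def)
  qed
  have e: "real k + 5 / 2 = real (k + 2) + 1 / 2"
    by simp
  have "\<not> (k + 2) mod 4 < 2"
    using k by presburger
  then have s: "sheet K \<alpha> \<nu> (1, real k + 1 / 2) = \<one>\<^bsub>K\<^esub>" "sheet K \<alpha> \<nu> (1, real k + 5 / 2) = \<alpha> k"
    unfolding e sheet_simps using k by simp_all
  let ?l = "local_section K \<alpha> \<nu> Edge (q (1, real k + 1 / 2))"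
  have \<alpha>: "\<alpha> k \<in> carrier K" "?l \<in> carrier K"
    using K(2) sheet_closed[OF K] by (auto simp: side_relation_def local_section_def)
  have "lifted_sheet K \<alpha> \<nu> (1, real k + 1 / 2) = ?l"
    using lifted_sheet_eq[OF K Edge(1)[OF z(1)]] Edge(2)[OF z(1)] s \<alpha> by simp
  moreover have "lifted_sheet K \<alpha> \<nu> (1, real k + 5 / 2) = inv\<^bsub>K\<^esub> \<alpha> k \<otimes>\<^bsub>K\<^esub> ?l"
    using lifted_sheet_eq[OF K Edge(1)[OF z(2)[unfolded e]]] Edge(2)[OF z(2)[unfolded e]] s eq
    unfolding e by simp
  ultimately show ?thesis
    using k z \<alpha> spoke_class_closed
    by (simp add: side_loop_def surface_hom_spoke_class[OF K] K.inv_mult_group flip: K.m_assoc)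
qed

lemma surface_hom_section:
  assumes E: "group E" "side_relation E g \<alpha> \<nu>" and \<phi>: "\<phi> \<in> hom E G"
    and lift: "\<And>k. \<phi> (\<alpha> k) = side_loop k" "\<And>m. \<phi> (\<nu> m) = vertex_loop m"
    and P: "P \<in> carrier G"
  shows "\<phi> (surface_hom E \<alpha> \<nu> P) = P"
proof -
  interpret \<phi>: group_hom E G \<phi>
    using E \<phi> by (simp add: group_hom_def group_hom_axioms_def G.group_axioms)
  interpret E: group_cocycle E S chart_image "local_section E \<alpha> \<nu>"
    by (rule group_cocycle_local_section[OF E])
  interpret L: group_cocycle G S chart_image "local_section G side_loop vertex_loop"
    by (rule group_cocycle_local_section[OF G.group_axioms side_relation_loops])
  obtain p where p: "p \<in> loops S s" "P = path_class S p"
    using P by (auto simp: fundamental_group_def)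
  then have p': "path p" "path_image p \<subseteq> S"
    by (auto simp: loops_def)
  obtain F where F: "E.horizontal {0..1} p F"
    using E.horizontal_path_exists[OF p'] by blast
  have "\<phi> (sheet E \<alpha> \<nu> z) = sheet G side_loop vertex_loop z" for z
    by (simp add: sheet_def lift Let_def)
  then have "(\<lambda>i x. \<phi> (local_section E \<alpha> \<nu> i x)) = local_section G side_loop vertex_loop"
    by (simp add: local_section_def fun_eq_iff)
  then have "L.horizontal {0..1} p (\<phi> \<circ> F)"
    using E.horizontal_hom_image[OF F G.group_axioms \<phi>] by simp
  from L.transport_eq[OF p' this] have "L.transport p = \<phi> (E.transport p)"
    using E.transport_eq[OF p' F] E.horizontal_closed[OF F] by simp
  then show ?thesis
    unfolding p(2) surface_hom_def E.holonomy_path_class[OF p'] using loop_transport[OF p(1)] by simp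
qed

end

section \<open>Central extensions\<close>

text \<open>The unique solution of all the conditions in \<open>side_relation\<close> except \<open>\<nu> (4 * g) = \<one>\<close>.\<close>

definition vertex_step :: "('k, 'm) monoid_scheme \<Rightarrow> (nat \<Rightarrow> 'k) \<Rightarrow> nat \<Rightarrow> 'k \<Rightarrow> 'k" where
  "vertex_step K \<alpha> m x =
    (if m mod 4 = 0 then x \<otimes>\<^bsub>K\<^esub> \<alpha> m \<otimes>\<^bsub>K\<^esub> inv\<^bsub>K\<^esub> \<alpha> (m + 1) \<otimes>\<^bsub>K\<^esub> inv\<^bsub>K\<^esub> \<alpha> m
     else if m mod 4 = 3 then x \<otimes>\<^bsub>K\<^esub> inv\<^bsub>K\<^esub> \<alpha> (m - 2) \<otimes>\<^bsub>K\<^esub> inv\<^bsub>K\<^esub> \<alpha> (m - 3) \<otimes>\<^bsub>K\<^esub> \<alpha> (m - 2)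
     else x \<otimes>\<^bsub>K\<^esub> \<alpha> (m - 1))"

primrec vertex_word :: "('k, 'm) monoid_scheme \<Rightarrow> (nat \<Rightarrow> 'k) \<Rightarrow> nat \<Rightarrow> 'k" where
  "vertex_word K \<alpha> 0 = \<one>\<^bsub>K\<^esub>"
| "vertex_word K \<alpha> (Suc m) = vertex_step K \<alpha> m (vertex_word K \<alpha> m)"

lemma mod_4_less_2_cases:
  fixes k :: nat
  assumes "k mod 4 < 2"
  obtains i where "k = 4 * i" | i where "k = 4 * i + 1"
proof -
  have "k = 4 * (k div 4) \<or> k = 4 * (k div 4) + 1"
    using assms by presburger
  then show ?thesis
    using that by blast
qed

context group
begin

lemma vertex_step_closed:
  "range \<alpha> \<subseteq> carrier G \<Longrightarrow> x \<in> carrier G \<Longrightarrow> vertex_step G \<alpha> m x \<in> carrier G"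
  unfolding vertex_step_def image_subset_iff by simp

lemma vertex_word_closed: "range \<alpha> \<subseteq> carrier G \<Longrightarrow> vertex_word G \<alpha> m \<in> carrier G"
  by (induction m) (auto intro: vertex_step_closed)

lemma vertex_step_simps:
  "vertex_step G \<alpha> (4 * i) x = x \<otimes> \<alpha> (4 * i) \<otimes> inv \<alpha> (4 * i + 1) \<otimes> inv \<alpha> (4 * i)"
  "vertex_step G \<alpha> (4 * i + 1) x = x \<otimes> \<alpha> (4 * i)"
  "vertex_step G \<alpha> (4 * i + 2) x = x \<otimes> \<alpha> (4 * i + 1)"
  "vertex_step G \<alpha> (4 * i + 3) x = x \<otimes> inv \<alpha> (4 * i + 1) \<otimes> inv \<alpha> (4 * i) \<otimes> \<alpha> (4 * i + 1)"
proof -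
  have "(4 * i) mod 4 = 0" "(4 * i + 1) mod 4 = 1" "(4 * i + 2) mod 4 = 2" "(4 * i + 3) mod 4 = 3"
    by presburger+
  moreover have "4 * i + 1 - 1 = 4 * i" "4 * i + 2 - 1 = 4 * i + 1" "4 * i + 3 - 2 = 4 * i + 1"
    "4 * i + 3 - 3 = 4 * i"
    by simp_all
  ultimately show
    "vertex_step G \<alpha> (4 * i) x = x \<otimes> \<alpha> (4 * i) \<otimes> inv \<alpha> (4 * i + 1) \<otimes> inv \<alpha> (4 * i)"
    "vertex_step G \<alpha> (4 * i + 1) x = x \<otimes> \<alpha> (4 * i)"
    "vertex_step G \<alpha> (4 * i + 2) x = x \<otimes> \<alpha> (4 * i + 1)"
    "vertex_step G \<alpha> (4 * i + 3) x = x \<otimes> inv \<alpha> (4 * i + 1) \<otimes> inv \<alpha> (4 * i) \<otimes> \<alpha> (4 * i + 1)"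
    unfolding vertex_step_def by simp_all
qed

lemma vertex_word_relation:
  assumes \<alpha>: "range \<alpha> \<subseteq> carrier G" and k: "k mod 4 < 2"
  shows "vertex_word G \<alpha> (k + 3) = vertex_word G \<alpha> k \<otimes> \<alpha> k"
    "vertex_word G \<alpha> (k + 2) = vertex_word G \<alpha> (k + 1) \<otimes> \<alpha> k"
proof -
  let ?w = "vertex_word G \<alpha>"
  have c: "\<alpha> j \<in> carrier G" "?w m \<in> carrier G" for j m
    using \<alpha> vertex_word_closed[OF \<alpha>] by auto
  have w: "?w (4 * i + 1) = ?w (4 * i) \<otimes> \<alpha> (4 * i) \<otimes> inv \<alpha> (4 * i + 1) \<otimes> inv \<alpha> (4 * i)"
    "?w (4 * i + 2) = ?w (4 * i + 1) \<otimes> \<alpha> (4 * i)"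
    "?w (4 * i + 3) = ?w (4 * i + 2) \<otimes> \<alpha> (4 * i + 1)"
    "?w (4 * i + 4) = ?w (4 * i + 3) \<otimes> inv \<alpha> (4 * i + 1) \<otimes> inv \<alpha> (4 * i) \<otimes> \<alpha> (4 * i + 1)" for i
    using vertex_step_simps[of \<alpha> i] vertex_word.simps(2)[of G \<alpha> "4 * i"]
      vertex_word.simps(2)[of G \<alpha> "4 * i + 1"] vertex_word.simps(2)[of G \<alpha> "4 * i + 2"]
      vertex_word.simps(2)[of G \<alpha> "4 * i + 3"]
    by (simp_all add: numeral_eq_Suc)
  have 2: "?w (4 * i + 2) = ?w (4 * i) \<otimes> \<alpha> (4 * i) \<otimes> inv \<alpha> (4 * i + 1)" for i
    unfolding w(2) w(1) using c by (simp add: m_assoc)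
  have 3: "?w (4 * i + 3) = ?w (4 * i) \<otimes> \<alpha> (4 * i)" for i
    unfolding w(3) 2 using c by (simp add: m_assoc)
  have 4: "?w (4 * i + 4) = ?w (4 * i + 1) \<otimes> \<alpha> (4 * i + 1)" for i
    unfolding w(4) 3 w(1) ..
  have "?w (k + 3) = ?w k \<otimes> \<alpha> k \<and> ?w (k + 2) = ?w (k + 1) \<otimes> \<alpha> k"
    using k
  proof (cases rule: mod_4_less_2_cases)
    case (1 i)
    then show ?thesis
      using w(2) 3 by simp
  next
    case (2 i)
    have "k + 3 = 4 * i + 4" "k + 2 = 4 * i + 3" "k + 1 = 4 * i + 2"
      using 2 by simp_all
    then show ?thesis
      using w(3) 4 2 by (simp only:)
  qed
  then show "?w (k + 3) = ?w k \<otimes> \<alpha> k" "?w (k + 2) = ?w (k + 1) \<otimes> \<alpha> k"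
    by blast+
qed

lemma side_relation_vertex_word:
  assumes rel: "side_relation G g \<alpha> \<nu>" and m: "m \<le> 4 * g"
  shows "\<nu> m = vertex_word G \<alpha> m"
proof -
  have c: "\<alpha> j \<in> carrier G" "\<nu> j \<in> carrier G" for j
    using rel by (auto simp: side_relation_def)
  have r: "\<nu> (k + 3) = \<nu> k \<otimes> \<alpha> k" "\<nu> (k + 2) = \<nu> (k + 1) \<otimes> \<alpha> k" if "k < 4 * g" "k mod 4 < 2" for k
    using rel that by (auto simp: side_relation_def)
  have step: "\<nu> (Suc m) = vertex_step G \<alpha> m (\<nu> m)" if m: "m < 4 * g" for m
  proof -
    define i where "i = m div 4"
    have i: "4 * i < 4 * g" "(4 * i) mod 4 < 2" "4 * i + 1 < 4 * g" "(4 * i + 1) mod 4 < (2::nat)"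
      using m unfolding i_def by presburger+
    have r0: "\<nu> (4 * i + 3) = \<nu> (4 * i) \<otimes> \<alpha> (4 * i)" "\<nu> (4 * i + 2) = \<nu> (4 * i + 1) \<otimes> \<alpha> (4 * i)"
      using r[OF i(1,2)] by simp_all
    have "4 * i + 1 + 3 = 4 * i + 4" "4 * i + 1 + 2 = 4 * i + 3" "4 * i + 1 + 1 = 4 * i + 2"
      by simp_all
    then have r1: "\<nu> (4 * i + 4) = \<nu> (4 * i + 1) \<otimes> \<alpha> (4 * i + 1)" "\<nu> (4 * i + 3) = \<nu> (4 * i + 2) \<otimes> \<alpha> (4 * i + 1)"
      using r[OF i(3,4)] by (simp_all only:)
    have 2: "\<nu> (4 * i + 2) = \<nu> (4 * i + 3) \<otimes> inv \<alpha> (4 * i + 1)"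
      using r1(2) c by (simp add: m_assoc)
    have 1: "\<nu> (4 * i + 1) = \<nu> (4 * i + 2) \<otimes> inv \<alpha> (4 * i)"
      using r0(2) c by (simp add: m_assoc)
    have "m = 4 * i \<or> m = 4 * i + 1 \<or> m = 4 * i + 2 \<or> m = 4 * i + 3"
      unfolding i_def by presburger
    moreover have "\<nu> (4 * i + 1) = vertex_step G \<alpha> (4 * i) (\<nu> (4 * i))"
      unfolding vertex_step_simps 1 2 r0(1) ..
    moreover have "\<nu> (4 * i + 2) = vertex_step G \<alpha> (4 * i + 1) (\<nu> (4 * i + 1))"
      unfolding vertex_step_simps r0(2) ..
    moreover have "\<nu> (4 * i + 3) = vertex_step G \<alpha> (4 * i + 2) (\<nu> (4 * i + 2))"
      unfolding vertex_step_simps by (rule r1(2))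
    moreover have "\<nu> (4 * i + 4) = vertex_step G \<alpha> (4 * i + 3) (\<nu> (4 * i + 3))"
      unfolding vertex_step_simps r1(1) 1 2 ..
    ultimately show ?thesis
      by (auto simp: numeral_eq_Suc)
  qed
  show ?thesis
    using m
  proof (induction m)
    case 0
    then show ?case
      using rel by (simp add: side_relation_def)
  next
    case (Suc m)
    then show ?case
      using step by simp
  qed
qed

end

lemma (in group_hom) hom_vertex_word:
  assumes \<alpha>: "range \<alpha> \<subseteq> carrier G"
  shows "h (vertex_word G \<alpha> m) = vertex_word H (\<lambda>k. h (\<alpha> k)) m"
proof (induction m)
  case (Suc m)
  have "\<alpha> k \<in> carrier G" for k
    using \<alpha> by auto
  then have "h (vertex_step G \<alpha> m x) = vertex_step H (\<lambda>k. h (\<alpha> k)) m (h x)" if "x \<in> carrier G" for x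
    using that by (simp add: vertex_step_def)
  then show ?case
    using Suc G.vertex_word_closed[OF \<alpha>] by simp
qed simp

locale central_twist = group +
  fixes t :: "int \<Rightarrow> 'a" and x y :: "'a \<Rightarrow> int"
  assumes t_hom: "t \<in> hom integer_group G"
    and t_central: "z \<in> carrier G \<Longrightarrow> t n \<otimes> z = z \<otimes> t n"
    and x_hom: "x \<in> hom G integer_group" and y_hom: "y \<in> hom G integer_group"
    and x_t: "x (t n) = 0" and y_t: "y (t n) = 0"
begin

definition twist where "twist = G\<lparr>monoid.mult := \<lambda>a b. a \<otimes> b \<otimes> t (x a * y b)\<rparr>"

lemma twist_simps [simp]:
  "carrier twist = carrier G" "\<one>\<^bsub>twist\<^esub> = \<one>" "a \<otimes>\<^bsub>twist\<^esub> b = a \<otimes> b \<otimes> t (x a * y b)"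
  by (simp_all add: twist_def)

lemma t_simps: "t n \<in> carrier G" "t m \<otimes> t n = t (m + n)" "t 0 = \<one>"
proof -
  show "t n \<in> carrier G" "t m \<otimes> t n = t (m + n)"
    using t_hom by (auto simp: hom_def)
  show "t 0 = \<one>"
    using hom_one[OF t_hom group_integer_group is_group] by simp
qed

lemma xy_mult: "a \<in> carrier G \<Longrightarrow> b \<in> carrier G \<Longrightarrow> x (a \<otimes> b) = x a + x b"
    "a \<in> carrier G \<Longrightarrow> b \<in> carrier G \<Longrightarrow> y (a \<otimes> b) = y a + y b"
  using x_hom y_hom by (auto simp: hom_def)

lemma t_move:
  assumes "a \<in> carrier G" "b \<in> carrier G"
  shows "a \<otimes> t m \<otimes> b \<otimes> t n = a \<otimes> b \<otimes> t (m + n)"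
proof -
  have "a \<otimes> t m \<otimes> b \<otimes> t n = a \<otimes> (t m \<otimes> b) \<otimes> t n"
    using assms t_simps by (simp add: m_assoc)
  also have "\<dots> = a \<otimes> b \<otimes> (t m \<otimes> t n)"
    unfolding t_central[OF assms(2)] using assms t_simps(1) by (simp add: m_assoc)
  finally show ?thesis
    by (simp add: t_simps)
qed

lemma group_twist: "group twist"
proof (rule groupI)
  fix a b c assume "a \<in> carrier twist" "b \<in> carrier twist" "c \<in> carrier twist"
  then have abc: "a \<in> carrier G" "b \<in> carrier G" "c \<in> carrier G"
    by simp_all
  have "a \<otimes>\<^bsub>twist\<^esub> b \<otimes>\<^bsub>twist\<^esub> c = a \<otimes> b \<otimes> c \<otimes> t (x a * y b + (x a + x b) * y c)"
    using abc t_simps by (simp add: t_move xy_mult x_t)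
  also have "\<dots> = a \<otimes>\<^bsub>twist\<^esub> (b \<otimes>\<^bsub>twist\<^esub> c)"
    using abc t_simps by (simp add: xy_mult y_t m_assoc algebra_simps)
  finally show "a \<otimes>\<^bsub>twist\<^esub> b \<otimes>\<^bsub>twist\<^esub> c = a \<otimes>\<^bsub>twist\<^esub> (b \<otimes>\<^bsub>twist\<^esub> c)" .
next
  fix a assume "a \<in> carrier twist"
  then have a: "a \<in> carrier G"
    by simp
  have "x (inv a) = - x a"
    using xy_mult(1)[of "inv a" a] hom_one[OF x_hom is_group group_integer_group] a by simp
  then have "(inv a \<otimes> t (x a * y a)) \<otimes>\<^bsub>twist\<^esub> a = \<one>"
    using a t_simps by (simp add: t_move xy_mult x_t)
  then show "\<exists>b\<in>carrier twist. b \<otimes>\<^bsub>twist\<^esub> a = \<one>\<^bsub>twist\<^esub>"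
    using a t_simps by (intro bexI[of _ "inv a \<otimes> t (x a * y a)"]) auto
next
  show "\<one>\<^bsub>twist\<^esub> \<otimes>\<^bsub>twist\<^esub> a = a" if "a \<in> carrier twist" for a
    using that hom_one[OF x_hom is_group group_integer_group] t_simps by simp
qed (use t_simps in auto)

end

lemma integer_hom_mod:
  assumes "X \<in> hom G integer_group" "e > 0"
  shows "(\<lambda>z. X z mod int e) \<in> hom G (integer_mod_group e)"
  using assms by (auto simp: hom_def carrier_integer_mod_group mod_add_eq)

lemma cyclic_integer_mod_group:
  assumes "e > 0"
  shows "cyclic_group (integer_mod_group e)"
proof (rule group.cyclic_group_epimorphic_image[OF group_integer_group _ cyclic_integer_group])
  have "(\<lambda>z. z mod int e) \<in> hom integer_group (integer_mod_group e)"
    using integer_hom_mod[of "\<lambda>z. z" integer_group e] assms by (simp add: hom_def)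
  moreover have "(\<lambda>z. z mod int e) ` UNIV = {0..<int e}"
  proof
    show "{0..<int e} \<subseteq> (\<lambda>z. z mod int e) ` UNIV"
      by (metis atLeastLessThan_iff image_eqI mod_pos_pos_trivial subsetI UNIV_I)
  qed (use assms in auto)
  ultimately show "(\<lambda>z. z mod int e) \<in> epi integer_group (integer_mod_group e)"
    using assms by (simp add: epi_def carrier_integer_mod_group)
qed simp

lemma group_exponent_pos_pow:
  assumes "group A" "finite (carrier A)"
  shows "group_exponent A > 0" "a \<in> carrier A \<Longrightarrow> a [^]\<^bsub>A\<^esub> group_exponent A = \<one>\<^bsub>A\<^esub>"
proof -
  interpret group A by fact
  have "0 < order A \<and> (\<forall>a\<in>carrier A. a [^]\<^bsub>A\<^esub> order A = \<one>\<^bsub>A\<^esub>)"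
    using assms(2) order_gt_0_iff_finite pow_order_eq_1 by auto
  then have "0 < group_exponent A \<and> (\<forall>a\<in>carrier A. a [^]\<^bsub>A\<^esub> group_exponent A = \<one>\<^bsub>A\<^esub>)"
    unfolding group_exponent_def by (rule LeastI)
  then show "group_exponent A > 0" "a \<in> carrier A \<Longrightarrow> a [^]\<^bsub>A\<^esub> group_exponent A = \<one>\<^bsub>A\<^esub>"
    by blast+
qed

lemma central_extension_section:
  fixes P :: "'p monoid" and \<Gamma> :: "'e monoid"
  assumes ext: "central_extension A \<Gamma> P \<iota> \<phi>"
    and rel: "side_relation P g a v" and g: "g > 0"
    and X: "X \<in> hom P integer_group" and Y: "Y \<in> hom P integer_group"
    and XY: "\<And>k. k < 4 * g \<Longrightarrow> k mod 4 < 2 \<Longrightarrow> X (a k) = of_bool (k = 0) \<and> Y (a k) = of_bool (k = 1)"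
    and sect: "\<And>(E :: 'e monoid) \<alpha> \<nu>. group E \<Longrightarrow> \<phi> \<in> hom E P \<Longrightarrow> side_relation E g \<alpha> \<nu> \<Longrightarrow>
      (\<And>k. \<phi> (\<alpha> k) = a k) \<Longrightarrow> (\<And>m. \<phi> (\<nu> m) = v m) \<Longrightarrow>
      \<exists>\<sigma>\<in>hom P E. \<forall>p\<in>carrier P. \<phi> (\<sigma> p) = p"
    and e: "\<And>\<gamma>. \<gamma> \<in> carrier A \<Longrightarrow> \<gamma> [^]\<^bsub>A\<^esub> (e::nat) = \<one>\<^bsub>A\<^esub>"
  obtains \<sigma> where "\<And>p. p \<in> carrier P \<Longrightarrow> \<sigma> p \<in> carrier \<Gamma>" "\<And>p. p \<in> carrier P \<Longrightarrow> \<phi> (\<sigma> p) = p"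
    "\<And>p p'. p \<in> carrier P \<Longrightarrow> p' \<in> carrier P \<Longrightarrow> int e dvd X p \<Longrightarrow>
      \<sigma> (p \<otimes>\<^bsub>P\<^esub> p') = \<sigma> p \<otimes>\<^bsub>\<Gamma>\<^esub> \<sigma> p'"
proof -
  have groups: "group A" "group \<Gamma>" "group P" and \<iota>: "\<iota> \<in> mon A \<Gamma>" and \<phi>: "\<phi> \<in> epi \<Gamma> P"
    and ker: "\<iota> ` carrier A = kernel \<Gamma> P \<phi>"
    and central: "\<And>b z. b \<in> carrier A \<Longrightarrow> z \<in> carrier \<Gamma> \<Longrightarrow> \<iota> b \<otimes>\<^bsub>\<Gamma>\<^esub> z = z \<otimes>\<^bsub>\<Gamma>\<^esub> \<iota> b"
    using ext by (auto simp: central_extension_def group_extension_def)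
  interpret A: group A by fact
  interpret \<Gamma>: group \<Gamma> by fact
  interpret P: group P by fact
  interpret \<iota>: group_hom A \<Gamma> \<iota>
    using \<iota> by (simp add: group_hom_def group_hom_axioms_def groups mon_def)
  interpret \<phi>: group_hom \<Gamma> P \<phi>
    using \<phi> by (simp add: group_hom_def group_hom_axioms_def groups epi_def)
  have surj: "\<exists>z. z \<in> carrier \<Gamma> \<and> \<phi> z = p" if "p \<in> carrier P" for p
  proof -
    have "p \<in> \<phi> ` carrier \<Gamma>"
      using \<phi> that by (simp add: epi_def)
    then show ?thesis
      by (elim imageE) blast
  qed
  define lift where "lift p = (SOME z. z \<in> carrier \<Gamma> \<and> \<phi> z = p)" for p
  have lift: "lift p \<in> carrier \<Gamma>" "\<phi> (lift p) = p" if "p \<in> carrier P" for p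
    using someI_ex[OF surj[OF that]] by (auto simp: lift_def)
  have av: "a k \<in> carrier P" "v k \<in> carrier P" for k
    using rel by (auto simp: side_relation_def)
  define \<alpha> where "\<alpha> k = lift (a k)" for k
  have \<alpha>: "range \<alpha> \<subseteq> carrier \<Gamma>" "\<And>k. \<phi> (\<alpha> k) = a k" "\<And>k. \<alpha> k \<in> carrier \<Gamma>"
    using lift[OF av(1)] by (auto simp: \<alpha>_def)
  define w where "w = vertex_word \<Gamma> \<alpha>"
  have w: "w m \<in> carrier \<Gamma>" for m
    unfolding w_def by (rule \<Gamma>.vertex_word_closed[OF \<alpha>(1)])
  have \<phi>w: "\<phi> (w m) = v m" if "m \<le> 4 * g" for m
    unfolding w_def \<phi>.hom_vertex_word[OF \<alpha>(1)] \<alpha>(2) using P.side_relation_vertex_word[OF rel that] by simp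
  have "w (4 * g) \<in> kernel \<Gamma> P \<phi>"
    using w \<phi>w[of "4 * g"] rel by (simp add: kernel_def side_relation_def)
  then obtain \<gamma> where \<gamma>: "\<gamma> \<in> carrier A" "\<iota> \<gamma> = w (4 * g)"
    using ker by (metis imageE)
  define t where "t n = \<iota> (\<gamma> [^]\<^bsub>A\<^esub> (n::int))" for n
  have \<phi>t: "\<phi> (t n) = \<one>\<^bsub>P\<^esub>" for n
    using ker \<gamma>(1) by (auto simp: t_def kernel_def)
  have X1: "X \<one>\<^bsub>P\<^esub> = 0" "Y \<one>\<^bsub>P\<^esub> = 0"
    using hom_one[OF X P.is_group group_integer_group] hom_one[OF Y P.is_group group_integer_group] by simp_all
  interpret T: central_twist \<Gamma> t "\<lambda>z. X (\<phi> z)" "\<lambda>z. Y (\<phi> z)"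
  proof
    show "t \<in> hom integer_group \<Gamma>"
      using \<gamma>(1) by (auto simp: hom_def t_def A.int_pow_mult)
    show "t n \<otimes>\<^bsub>\<Gamma>\<^esub> z = z \<otimes>\<^bsub>\<Gamma>\<^esub> t n" if "z \<in> carrier \<Gamma>" for z n
      unfolding t_def using central \<gamma>(1) that by simp
    show "(\<lambda>z. X (\<phi> z)) \<in> hom \<Gamma> integer_group" "(\<lambda>z. Y (\<phi> z)) \<in> hom \<Gamma> integer_group"
      using X Y by (auto simp: hom_def)
  qed (simp_all add: \<phi>t X1)
  have \<phi>_twist: "\<phi> \<in> hom T.twist P"
    by (rule homI) (simp_all add: \<phi>t T.t_simps)
  define \<epsilon> :: "nat \<Rightarrow> int" where "\<epsilon> m = (if m = 0 \<or> m = 3 then 0 else - 1)" for m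
  define \<nu> where "\<nu> m = (if m \<le> 4 * g then w m \<otimes>\<^bsub>\<Gamma>\<^esub> t (\<epsilon> m) else lift (v m))" for m
  have \<nu>c: "\<nu> m \<in> carrier \<Gamma>" for m
    using w T.t_simps lift[OF av(2)] by (simp add: \<nu>_def)
  have r: "w (k + 3) = w k \<otimes>\<^bsub>\<Gamma>\<^esub> \<alpha> k" "w (k + 2) = w (k + 1) \<otimes>\<^bsub>\<Gamma>\<^esub> \<alpha> k" if "k mod 4 < 2" for k
    unfolding w_def by (rule \<Gamma>.vertex_word_relation[OF \<alpha>(1) that])+
  have Xw: "X (\<phi> (w 1)) = 0" "X (\<phi> (w 2)) = 1"
  proof -
    have k: "X (a 0) = 1" "X (a 1) = 0"
      using XY[of 0] XY[of 1] g by auto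
    have "w 1 \<otimes>\<^bsub>\<Gamma>\<^esub> \<alpha> 0 = w 2"
      using r(2)[of 0] by (simp add: numeral_2_eq_2)
    then have 2: "X (\<phi> (w 2)) = X (\<phi> (w 1)) + X (a 0)"
      using T.xy_mult(1)[OF w \<alpha>(3)] \<alpha>(2) by metis
    have "w 2 \<otimes>\<^bsub>\<Gamma>\<^esub> \<alpha> 1 = w 3"
      using r(2)[of 1] by (simp add: numeral_2_eq_2 numeral_3_eq_3)
    then have 3: "X (\<phi> (w 3)) = X (\<phi> (w 2)) + X (a 1)"
      using T.xy_mult(1)[OF w \<alpha>(3)] \<alpha>(2) by metis
    have "w 0 \<otimes>\<^bsub>\<Gamma>\<^esub> \<alpha> 0 = w 3"
      using r(1)[of 0] by simp
    then have "X (\<phi> (w 3)) = X (\<phi> (w 0)) + X (a 0)"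
      using T.xy_mult(1)[OF w \<alpha>(3)] \<alpha>(2) by metis
    moreover have "X (\<phi> (w 0)) = 0"
      by (simp add: w_def X1)
    ultimately show "X (\<phi> (w 1)) = 0" "X (\<phi> (w 2)) = 1"
      using 2 3 k by auto
  qed
  have twist_step: "(w m \<otimes>\<^bsub>\<Gamma>\<^esub> t (\<epsilon> m)) \<otimes>\<^bsub>T.twist\<^esub> \<alpha> k =
      w m \<otimes>\<^bsub>\<Gamma>\<^esub> \<alpha> k \<otimes>\<^bsub>\<Gamma>\<^esub> t (\<epsilon> m + X (\<phi> (w m)) * Y (a k))" for m k
    using w \<alpha> T.t_simps by (simp add: T.t_move T.xy_mult T.x_t \<phi>t X1)
  have rel': "side_relation T.twist g \<alpha> \<nu>"
    unfolding side_relation_def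
  proof (intro conjI allI impI)
    show "range \<alpha> \<subseteq> carrier T.twist" "range \<nu> \<subseteq> carrier T.twist"
      using \<alpha> \<nu>c by auto
    show "\<nu> 0 = \<one>\<^bsub>T.twist\<^esub>"
      by (simp add: \<nu>_def \<epsilon>_def w_def T.t_simps)
    have "\<epsilon> (4 * g) = - 1"
      using g by (auto simp: \<epsilon>_def)
    moreover have "w (4 * g) = t 1"
      using \<gamma> by (simp add: t_def)
    ultimately show "\<nu> (4 * g) = \<one>\<^bsub>T.twist\<^esub>"
      by (simp add: \<nu>_def T.t_simps)
    fix k assume k: "k < 4 * g" "k mod 4 < 2"
    then have le: "k + 3 \<le> 4 * g"
      by presburger
    have Yk: "Y (a k) = of_bool (k = 1)"
      using XY[OF k] by simp
    have "k \<noteq> 2" "k \<noteq> 3"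
      using k(2) by auto
    then have "\<epsilon> (k + 3) = \<epsilon> k + X (\<phi> (w k)) * Y (a k)"
      "\<epsilon> (k + 2) = \<epsilon> (k + 1) + X (\<phi> (w (k + 1))) * Y (a k)"
      using Xw by (auto simp: \<epsilon>_def Yk numeral_eq_Suc)
    then show "\<nu> (k + 3) = \<nu> k \<otimes>\<^bsub>T.twist\<^esub> \<alpha> k" "\<nu> (k + 2) = \<nu> (k + 1) \<otimes>\<^bsub>T.twist\<^esub> \<alpha> k"
      using le twist_step[of k k] twist_step[of "k + 1" k] r[OF k(2)]
      by (simp_all add: \<nu>_def del: T.twist_simps)
  qed
  have "\<phi> (\<nu> m) = v m" for m
    using \<phi>w w T.t_simps lift[OF av(2)] av by (simp add: \<nu>_def \<phi>t)
  then obtain \<sigma> where \<sigma>: "\<sigma> \<in> hom P T.twist" "\<forall>p\<in>carrier P. \<phi> (\<sigma> p) = p"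
    using sect[OF T.group_twist \<phi>_twist rel' \<alpha>(2)] by blast
  have \<sigma>c: "\<sigma> p \<in> carrier \<Gamma>" if "p \<in> carrier P" for p
    using \<sigma>(1) that by (auto simp: hom_def)
  show ?thesis
  proof (rule that)
    fix p p' assume p: "p \<in> carrier P" "p' \<in> carrier P" and "int e dvd X p"
    then obtain j where "X p = int e * j"
      by (elim dvdE)
    then have "t (X p * Y p') = \<iota> ((\<gamma> [^]\<^bsub>A\<^esub> int e) [^]\<^bsub>A\<^esub> (j * Y p'))"
      using \<gamma>(1) by (simp add: t_def A.int_pow_pow mult.assoc)
    also have "\<dots> = \<one>\<^bsub>\<Gamma>\<^esub>"
      using e[OF \<gamma>(1)] by (simp add: int_pow_int)
    finally have "t (X p * Y p') = \<one>\<^bsub>\<Gamma>\<^esub>" .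
    moreover have "\<sigma> (p \<otimes>\<^bsub>P\<^esub> p') = \<sigma> p \<otimes>\<^bsub>\<Gamma>\<^esub> \<sigma> p' \<otimes>\<^bsub>\<Gamma>\<^esub> t (X p * Y p')"
      using hom_mult[OF \<sigma>(1) p] \<sigma>(2) p by simp
    ultimately show "\<sigma> (p \<otimes>\<^bsub>P\<^esub> p') = \<sigma> p \<otimes>\<^bsub>\<Gamma>\<^esub> \<sigma> p'"
      using \<sigma>c p by simp
  qed (use \<sigma> \<sigma>c in auto)
qed

lemma trivial_extensionI:
  assumes ext: "central_extension A \<Gamma> G \<iota> \<phi>" and H: "subgroup H G"
    and \<tau>: "\<tau> \<in> hom (G\<lparr>carrier := H\<rparr>) \<Gamma>" "\<And>h. h \<in> H \<Longrightarrow> \<phi> (\<tau> h) = h"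
  shows "trivial_extension A (induced_extension_group \<Gamma> \<phi> H) (G\<lparr>carrier := H\<rparr>) \<iota> \<phi>"
proof -
  have groups: "group A" "group \<Gamma>" "group G" and \<iota>: "\<iota> \<in> mon A \<Gamma>" and \<phi>: "\<phi> \<in> epi \<Gamma> G"
    and ker: "\<iota> ` carrier A = kernel \<Gamma> G \<phi>"
    and central: "\<And>b z. b \<in> carrier A \<Longrightarrow> z \<in> carrier \<Gamma> \<Longrightarrow> \<iota> b \<otimes>\<^bsub>\<Gamma>\<^esub> z = z \<otimes>\<^bsub>\<Gamma>\<^esub> \<iota> b"
    using ext by (auto simp: central_extension_def group_extension_def)
  interpret A: group A by fact
  interpret \<Gamma>: group \<Gamma> by fact
  interpret G: group G by fact
  interpret \<iota>: group_hom A \<Gamma> \<iota>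
    using \<iota> by (simp add: group_hom_def group_hom_axioms_def groups mon_def)
  interpret \<phi>: group_hom \<Gamma> G \<phi>
    using \<phi> by (simp add: group_hom_def group_hom_axioms_def groups epi_def)
  interpret H: subgroup H G by fact
  let ?H = "G\<lparr>carrier := H\<rparr>" and ?K = "induced_extension_group \<Gamma> \<phi> H"
  have grH: "group ?H"
    by (rule G.subgroup_imp_group[OF H])
  interpret \<tau>: group_hom ?H \<Gamma> \<tau>
    using \<tau> by (simp add: group_hom_def group_hom_axioms_def groups grH)
  have \<phi>\<iota>: "\<phi> (\<iota> b) = \<one>\<^bsub>G\<^esub>" if "b \<in> carrier A" for b
    using ker that by (auto simp: kernel_def)
  have \<tau>c: "\<tau> h \<in> carrier \<Gamma>" if "h \<in> H" for h
    using \<tau>.hom_closed that by simp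
  define F where "F = (\<lambda>(b, h). \<iota> b \<otimes>\<^bsub>\<Gamma>\<^esub> \<tau> h)"
  have K: "carrier ?K = {z \<in> carrier \<Gamma>. \<phi> z \<in> H}" "monoid.mult ?K = monoid.mult \<Gamma>"
    by (simp_all add: induced_extension_group_def)
  have \<phi>F: "\<phi> (F (b, h)) = h" if "b \<in> carrier A" "h \<in> H" for b h
    using that \<tau>c \<phi>\<iota> \<tau>(2) H.mem_carrier by (simp add: F_def)
  have "F \<in> iso (A \<times>\<times> ?H) ?K"
  proof (rule isoI)
    show "F \<in> hom (A \<times>\<times> ?H) ?K"
    proof (rule homI)
      fix z assume "z \<in> carrier (A \<times>\<times> ?H)"
      then obtain b h where z: "z = (b, h)" "b \<in> carrier A" "h \<in> H"
        by auto
      then show "F z \<in> carrier ?K"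
        using \<phi>F[of b h] \<tau>c by (simp add: K F_def)
    next
      fix z z' assume "z \<in> carrier (A \<times>\<times> ?H)" "z' \<in> carrier (A \<times>\<times> ?H)"
      then obtain b h b' h' where z: "z = (b, h)" "b \<in> carrier A" "h \<in> H"
        "z' = (b', h')" "b' \<in> carrier A" "h' \<in> H"
        by auto
      note c = \<iota>.hom_closed[OF z(2)] \<iota>.hom_closed[OF z(5)] \<tau>c[OF z(3)] \<tau>c[OF z(6)]
      have "\<tau> (h \<otimes>\<^bsub>G\<^esub> h') = \<tau> h \<otimes>\<^bsub>\<Gamma>\<^esub> \<tau> h'"
        using \<tau>.hom_mult[of h h'] z by simp
      then have "F (z \<otimes>\<^bsub>A \<times>\<times> ?H\<^esub> z') = \<iota> b \<otimes>\<^bsub>\<Gamma>\<^esub> (\<iota> b' \<otimes>\<^bsub>\<Gamma>\<^esub> \<tau> h) \<otimes>\<^bsub>\<Gamma>\<^esub> \<tau> h'"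
        using z c by (simp add: F_def \<Gamma>.m_assoc)
      also have "\<dots> = F z \<otimes>\<^bsub>\<Gamma>\<^esub> F z'"
        unfolding central[OF z(5) c(3)] using z c by (simp add: F_def \<Gamma>.m_assoc)
      finally show "F (z \<otimes>\<^bsub>A \<times>\<times> ?H\<^esub> z') = F z \<otimes>\<^bsub>?K\<^esub> F z'"
        by (simp add: K)
    qed
    show "bij_betw F (carrier (A \<times>\<times> ?H)) (carrier ?K)"
      unfolding bij_betw_def
    proof
      show "inj_on F (carrier (A \<times>\<times> ?H))"
      proof (rule inj_onI)
        fix z z' assume zz: "z \<in> carrier (A \<times>\<times> ?H)" "z' \<in> carrier (A \<times>\<times> ?H)" "F z = F z'"
        then obtain b h b' h' where z: "z = (b, h)" "b \<in> carrier A" "h \<in> H"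
          "z' = (b', h')" "b' \<in> carrier A" "h' \<in> H"
          by auto
        have "h = h'"
          using \<phi>F[OF z(2,3)] \<phi>F[OF z(5,6)] zz(3) z by simp
        then have "\<iota> b = \<iota> b'"
          using zz(3) z \<tau>c by (simp add: F_def)
        then show "z = z'"
          using \<iota> z \<open>h = h'\<close> by (auto simp: mon_def dest: inj_onD)
      qed
      show "F ` carrier (A \<times>\<times> ?H) = carrier ?K"
      proof
        show "F ` carrier (A \<times>\<times> ?H) \<subseteq> carrier ?K"
          using \<phi>F \<tau>c by (auto simp: K) (auto simp: F_def)
        show "carrier ?K \<subseteq> F ` carrier (A \<times>\<times> ?H)"
        proof
          fix z assume "z \<in> carrier ?K"
          then have z: "z \<in> carrier \<Gamma>" "\<phi> z \<in> H"
            by (auto simp: K)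
          let ?b = "z \<otimes>\<^bsub>\<Gamma>\<^esub> inv\<^bsub>\<Gamma>\<^esub> \<tau> (\<phi> z)"
          have "?b \<in> kernel \<Gamma> G \<phi>"
            using z \<tau>c[OF z(2)] \<tau>(2)[OF z(2)] by (simp add: kernel_def)
          then obtain b where b: "b \<in> carrier A" "\<iota> b = ?b"
            using ker by (metis imageE)
          have "F (b, \<phi> z) = z"
            using b z \<tau>c[OF z(2)] by (simp add: F_def \<Gamma>.m_assoc)
          then show "z \<in> F ` carrier (A \<times>\<times> ?H)"
            using b z by (intro image_eqI[of _ _ "(b, \<phi> z)"]) auto
        qed
      qed
    qed
  qed
  note F = this
  let ?\<theta> = "inv_into (carrier (A \<times>\<times> ?H)) F"
  have "?\<theta> \<in> iso ?K (A \<times>\<times> ?H)"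
    by (rule group.iso_set_sym[OF DirProd_group[OF groups(1) grH] F])
  moreover have inv: "?\<theta> (F (b, h)) = (b, h)" if "b \<in> carrier A" "h \<in> H" for b h
    using F that by (intro inv_into_f_f) (auto simp: iso_def bij_betw_def)
  moreover have "?\<theta> (\<iota> b) = (b, \<one>\<^bsub>?H\<^esub>)" if "b \<in> carrier A" for b
  proof -
    have "F (b, \<one>\<^bsub>G\<^esub>) = \<iota> b"
      using that \<tau>.hom_one by (simp add: F_def)
    then show ?thesis
      using inv[OF that H.one_closed] by simp
  qed
  moreover have "snd (?\<theta> z) = \<phi> z" if "z \<in> carrier ?K" for z
  proof -
    have "z \<in> F ` carrier (A \<times>\<times> ?H)"
      using F that by (auto simp: iso_def bij_betw_def)
    then obtain b h where "b \<in> carrier A" "h \<in> H" "z = F (b, h)"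
      by auto
    then show ?thesis
      using inv \<phi>F by simp
  qed
  ultimately show ?thesis
    unfolding trivial_extension_def isomorphic_extensions_def by blast
qed

lemma abelian_side_relations:
  assumes "g > 0"
  shows "side_relation integer_group g (\<lambda>k. of_bool (k = 0)) (\<lambda>m. of_bool (m = 2 \<or> m = 3))"
    "side_relation integer_group g (\<lambda>k. of_bool (k = 1)) (\<lambda>m. - of_bool (m = 1 \<or> m = 2))"
proof -
  have g: "4 * g \<noteq> 2" "4 * g \<noteq> 3" "4 * g \<noteq> 1" "4 * g \<noteq> 0"
    using assms by presburger+
  have k: "k = 0 \<or> k = 1 \<or> k \<ge> 4" if "k mod 4 < 2" for k :: nat
    using that by presburger
  show "side_relation integer_group g (\<lambda>k. of_bool (k = 0)) (\<lambda>m. of_bool (m = 2 \<or> m = 3))"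
    unfolding side_relation_def
  proof (intro conjI allI impI)
    fix k :: nat assume "k mod 4 < 2"
    from k[OF this] show "of_bool (k + 3 = 2 \<or> k + 3 = 3) =
        of_bool (k = 2 \<or> k = 3) \<otimes>\<^bsub>integer_group\<^esub> of_bool (k = 0)"
      "of_bool (k + 2 = 2 \<or> k + 2 = 3) =
        of_bool (k + 1 = 2 \<or> k + 1 = 3) \<otimes>\<^bsub>integer_group\<^esub> of_bool (k = 0)"
      by (elim disjE; simp)+
  qed (use g in simp_all)
  show "side_relation integer_group g (\<lambda>k. of_bool (k = 1)) (\<lambda>m. - of_bool (m = 1 \<or> m = 2))"
    unfolding side_relation_def
  proof (intro conjI allI impI)
    fix k :: nat assume "k mod 4 < 2"
    from k[OF this] show "- of_bool (k + 3 = 1 \<or> k + 3 = 2) =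
        - of_bool (k = 1 \<or> k = 2) \<otimes>\<^bsub>integer_group\<^esub> of_bool (k = 1)"
      "- of_bool (k + 2 = 1 \<or> k + 2 = 2) =
        - of_bool (k + 1 = 1 \<or> k + 1 = 2) \<otimes>\<^bsub>integer_group\<^esub> of_bool (k = 1)"
      by (elim disjE; simp)+
  qed (use g in simp_all)
qed

theorem lemma3p1:
  fixes A :: "'a monoid" and \<Gamma> :: "'e monoid" and G :: "'q monoid"
    and \<iota> :: "'a \<Rightarrow> 'e" and \<phi> :: "'e \<Rightarrow> 'q"
    and S :: "'s::topological_space set" and s :: 's and g :: nat
  assumes "comm_group A" and "finite (carrier A)"
    and "g \<ge> 2" and "closed_orientable_surface g S" and "s \<in> S"
    and "G \<cong> fundamental_group S s"
    and "central_extension A \<Gamma> G \<iota> \<phi>"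
  shows "\<exists>H. subgroup H G \<and> finite (rcosets\<^bsub>G\<^esub> H) \<and> card (rcosets\<^bsub>G\<^esub> H) \<le> group_exponent A \<and>
    trivial_extension A (induced_extension_group \<Gamma> \<phi> H) (G\<lparr>carrier := H\<rparr>) \<iota> \<phi> \<and>
    H \<lhd> G \<and> cyclic_group (G Mod H)"
proof -
  obtain q where "polygon g S q"
    using closed_orientable_surface_polygon[OF assms(4)] by blast
  then interpret B: based_polygon g S q s
    using assms(5) by (simp add: based_polygon_def based_polygon_axioms_def)
  let ?P = "fundamental_group S s"
  have groups: "group A" "group \<Gamma>" "group G" and \<iota>: "\<iota> \<in> mon A \<Gamma>" and \<phi>: "\<phi> \<in> epi \<Gamma> G"
    and ker: "\<iota> ` carrier A = kernel \<Gamma> G \<phi>"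
    using assms(7) by (auto simp: central_extension_def group_extension_def)
  interpret G: group G by fact
  obtain \<psi> where \<psi>: "\<psi> \<in> iso G ?P"
    using assms(6) by (auto simp: is_iso_def)
  interpret \<psi>: group_hom G ?P \<psi>
    using \<psi> by (simp add: group_hom_def group_hom_axioms_def groups B.G.group_axioms iso_def)
  have \<psi>_bij: "inj_on \<psi> (carrier G)" "\<psi> ` carrier G = carrier ?P"
    using \<psi> by (auto simp: iso_def bij_betw_def)
  define \<phi>' where "\<phi>' = \<psi> \<circ> \<phi>"
  have ext: "central_extension A \<Gamma> ?P \<iota> \<phi>'"
  proof -
    have "\<phi>' \<in> epi \<Gamma> ?P"
    proof -
      have "\<phi>' ` carrier \<Gamma> = \<psi> ` \<phi> ` carrier \<Gamma>"
        by (simp only: \<phi>'_def image_comp)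
      then show ?thesis
        using \<phi> \<psi>_bij(2) hom_compose[of \<phi> \<Gamma> G \<psi> ?P] \<psi>.homh by (simp add: epi_def \<phi>'_def)
    qed
    moreover have "kernel \<Gamma> ?P \<phi>' = kernel \<Gamma> G \<phi>"
    proof -
      have "\<psi> (\<phi> z) = \<one>\<^bsub>?P\<^esub> \<longleftrightarrow> \<phi> z = \<one>\<^bsub>G\<^esub>" if "z \<in> carrier \<Gamma>" for z
      proof -
        have "\<phi> z \<in> carrier G"
          using \<phi> that by (auto simp: epi_def hom_def)
        then show ?thesis
          using inj_on_eq_iff[OF \<psi>_bij(1), of "\<phi> z" "\<one>\<^bsub>G\<^esub>"] by simp
      qed
      then show ?thesis
        by (auto simp: kernel_def \<phi>'_def)
    qed
    ultimately show ?thesis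
      using assms(7) ker by (simp add: central_extension_def group_extension_def B.G.group_axioms)
  qed
  have g: "g > 0"
    using assms(3) by simp
  note Z = abelian_side_relations[OF g]
  define X where "X = B.surface_hom integer_group (\<lambda>k. of_bool (k = 0)) (\<lambda>m. of_bool (m = 2 \<or> m = 3))"
  define Y where "Y = B.surface_hom integer_group (\<lambda>k. of_bool (k = 1)) (\<lambda>m. - of_bool (m = 1 \<or> m = 2))"
  have X: "X \<in> hom ?P integer_group" and Y: "Y \<in> hom ?P integer_group"
    unfolding X_def Y_def using B.surface_hom_hom[OF group_integer_group] Z by auto
  have XY: "X (B.side_loop k) = of_bool (k = 0) \<and> Y (B.side_loop k) = of_bool (k = 1)"
    if "k < 4 * g" "k mod 4 < 2" for k
    unfolding X_def Y_def using B.surface_hom_side_loop[OF group_integer_group _ that] Z by auto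
  define e where "e = group_exponent A"
  have e: "e > 0" "\<And>\<gamma>. \<gamma> \<in> carrier A \<Longrightarrow> \<gamma> [^]\<^bsub>A\<^esub> e = \<one>\<^bsub>A\<^esub>"
    using group_exponent_pos_pow[OF groups(1) assms(2)] by (simp_all add: e_def)
  have sect: "\<exists>\<sigma>\<in>hom ?P E. \<forall>p\<in>carrier ?P. \<phi>' (\<sigma> p) = p"
    if E: "group E" "\<phi>' \<in> hom E ?P" "side_relation E g \<alpha> \<nu>"
      "\<And>k. \<phi>' (\<alpha> k) = B.side_loop k" "\<And>m. \<phi>' (\<nu> m) = B.vertex_loop m"
    for E :: "'e monoid" and \<alpha> \<nu>
    using B.surface_hom_hom[OF E(1,3)] B.surface_hom_section[OF E(1,3,2,4,5)] by blast
  obtain \<sigma> where \<sigma>: "\<And>p. p \<in> carrier ?P \<Longrightarrow> \<sigma> p \<in> carrier \<Gamma>" "\<And>p. p \<in> carrier ?P \<Longrightarrow> \<phi>' (\<sigma> p) = p"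
    "\<And>p p'. p \<in> carrier ?P \<Longrightarrow> p' \<in> carrier ?P \<Longrightarrow> int e dvd X p \<Longrightarrow>
      \<sigma> (p \<otimes>\<^bsub>?P\<^esub> p') = \<sigma> p \<otimes>\<^bsub>\<Gamma>\<^esub> \<sigma> p'"
  proof (rule central_extension_section[OF ext B.side_relation_loops g X Y])
    show "X (B.side_loop k) = of_bool (k = 0) \<and> Y (B.side_loop k) = of_bool (k = 1)"
      if "k < 4 * g" "k mod 4 < 2" for k
      by (rule XY[OF that])
    show "\<exists>\<sigma>\<in>hom ?P E. \<forall>p\<in>carrier ?P. \<phi>' (\<sigma> p) = p"
      if "group E" "\<phi>' \<in> hom E ?P" "side_relation E g \<alpha> \<nu>"
        "\<And>k. \<phi>' (\<alpha> k) = B.side_loop k" "\<And>m. \<phi>' (\<nu> m) = B.vertex_loop m"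
      for E :: "'e monoid" and \<alpha> \<nu>
      by (rule sect[OF that])
    show "\<gamma> [^]\<^bsub>A\<^esub> e = \<one>\<^bsub>A\<^esub>" if "\<gamma> \<in> carrier A" for \<gamma>
      by (rule e(2)[OF that])
  qed blast
  define x where "x h = X (\<psi> h) mod int e" for h
  have x: "x \<in> hom G (integer_mod_group e)"
    unfolding x_def using integer_hom_mod[OF hom_compose[OF \<psi>.homh X] e(1)] by (simp add: comp_def)
  interpret x: group_hom G "integer_mod_group e" x
    using x by (simp add: group_hom_def group_hom_axioms_def groups)
  define H where "H = kernel G (integer_mod_group e) x"
  have H: "H = {h \<in> carrier G. int e dvd X (\<psi> h)}"
    by (auto simp: H_def kernel_def x_def dvd_eq_mod_eq_0)
  have normal: "H \<lhd> G"
    unfolding H_def by (rule x.normal_kernel)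
  then have sub: "subgroup H G"
    by (simp add: normal_def)
  have onto: "x ` carrier G = carrier (integer_mod_group e)"
  proof
    show "carrier (integer_mod_group e) \<subseteq> x ` carrier G"
    proof
      fix n assume n: "n \<in> carrier (integer_mod_group e)"
      have c: "B.side_loop 0 \<in> carrier ?P"
        using B.side_relation_loops by (auto simp: side_relation_def)
      then obtain h where h: "h \<in> carrier G" "\<psi> h = B.side_loop 0"
        using \<psi>_bij(2) by (metis imageE)
      interpret X: group_hom ?P integer_group X
        using X by (simp add: group_hom_def group_hom_axioms_def B.G.group_axioms)
      have "X (\<psi> (h [^]\<^bsub>G\<^esub> n)) = n"
        using h c XY[of 0] g by (simp add: \<psi>.hom_int_pow X.hom_int_pow)
      then have "x (h [^]\<^bsub>G\<^esub> n) = n"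
        using n e(1) by (simp add: x_def carrier_integer_mod_group)
      then show "n \<in> x ` carrier G"
        using h(1) by (metis G.int_pow_closed imageI)
    qed
  qed (use x.hom_closed in auto)
  have iso: "(\<lambda>C. the_elem (x ` C)) \<in> iso (G Mod H) (integer_mod_group e)"
    unfolding H_def by (rule x.FactGroup_iso_set[OF onto])
  then have bij: "bij_betw (\<lambda>C. the_elem (x ` C)) (rcosets\<^bsub>G\<^esub> H) {0..<int e}"
    using e(1) by (simp add: iso_def FactGroup_def carrier_integer_mod_group)
  have "cyclic_group (G Mod H)"
    using isomorphic_group_cyclicity[of "G Mod H" "integer_mod_group e"] iso
      cyclic_integer_mod_group[OF e(1)] normal.factorgroup_is_group[OF normal]
    by (auto simp: is_iso_def)
  moreover have "finite (rcosets\<^bsub>G\<^esub> H)" "card (rcosets\<^bsub>G\<^esub> H) = e"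
    using bij_betw_finite[OF bij] bij_betw_same_card[OF bij] by simp_all
  moreover have "trivial_extension A (induced_extension_group \<Gamma> \<phi> H) (G\<lparr>carrier := H\<rparr>) \<iota> \<phi>"
  proof (rule trivial_extensionI[OF assms(7) sub])
    show "(\<lambda>h. \<sigma> (\<psi> h)) \<in> hom (G\<lparr>carrier := H\<rparr>) \<Gamma>"
      by (rule homI) (auto simp: H \<sigma>)
    fix h assume "h \<in> H"
    then have h: "h \<in> carrier G"
      by (simp add: H)
    then have "\<psi> (\<phi> (\<sigma> (\<psi> h))) = \<psi> h"
      using \<sigma>(2)[of "\<psi> h"] by (simp add: \<phi>'_def)
    moreover have "\<phi> (\<sigma> (\<psi> h)) \<in> carrier G"
      using \<phi> \<sigma>(1)[of "\<psi> h"] h by (auto simp: epi_def hom_def)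
    ultimately show "\<phi> (\<sigma> (\<psi> h)) = h"
      using \<psi>_bij(1) h by (auto dest: inj_onD)
  qed
  ultimately show ?thesis
    using sub normal by (intro exI[of _ H]) (simp add: e_def)
qed

end
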